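(* Let $X$ be a Banach space. The following are equivalent: (1) $X^*$ has the Radon-Nikodým property. (2) For every compact Hausdorff space $H$, every bounded linear operator $T:C(H,X)\to\mathbf R$ with $m\leftrightarrow T$, and every measure $\mu$ on $\beta(H)$ with $m\ll\mu$, one has $T_\pi\to T$ in operator norm. (3) For every $\sigma$-algebra $\Sigma$ of subsets of a set $\Omega$, every bounded linear operator $T:U_X(\Sigma)\to\mathbf R$ with $m\leftrightarrow T$, and every measure $\mu$ on $\Sigma$ with $m\ll\mu$, one has $T_\pi\to T$ in operator norm.
   Context: Banach spaces are real. $C(H,X)$ is the space of continuous functions $H\to X$ with the sup norm; $\beta(H)$ is the Borel $\sigma$-algebra of $H$; $U_X(\Sigma)$ is the uniform closure of the $X$-valued $\Sigma$-simple functions on $\Omega$, with the sup norm. A "measure" is a countably additive set function with values in $[0,\infty)$. Representation: for each bounded linear $T:U_X(\Sigma)\to\mathbf R$ there is a unique finitely additive $m:\Sigma\to L(X,\mathbf R)=X^*$ of finite semivariation (here equal to the total variation $|m|$) with $T(f)=\int f\,dm$ for all $f\in U_X(\Sigma)$. For each bounded linear $T:C(H,X)\to\mathbf R$ there is a unique weakly regular finitely additive $m:\beta(H)\to L(X,\mathbf R^{**})=X^*$ of finite semivariation with $T(f)=\int f\,dm$ for all $f\in C(H,X)$ (weakly regular: for each $x\in X$, $A\mapsto m(A)(x)$ is a regular countably additive Borel measure). In either case write $m\leftrightarrow T$. $m\ll\mu$ means $\lim_{\mu(A)\to 0}\|m(A)\|=0$. For a finite partition $\pi$ of the underlying space into measurable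 sets (sets of $\Sigma$, resp. $\beta(H)$), the conditional expectation operator $T_\pi$ relative to $\mu$ is $$T_\pi(f)=\sum_{A\in\pi} m(A)\left(\frac{\int_A f\,d\mu}{\mu(A)}\right),$$ with the convention $0/0=0$ (terms with $\mu(A)=0$ are omitted). $T_\pi\to T$ means convergence in operator norm of the net $(T_\pi)$ indexed by finite partitions directed by refinement. *)

theory Defs
  imports "HOL-Analysis.Analysis"
begin

section \<open>Partitions\<close>

definition finite_partitions :: "'w set \<Rightarrow> 'w set set \<Rightarrow> 'w set set set" where
  "finite_partitions \<Omega> \<Sigma> = {\<pi>. finite \<pi> \<and> \<pi> \<subseteq> \<Sigma> \<and> partition_on \<Omega> \<pi>}"

text \<open>The filter of the net of finite measurable partitions directed by refinement:
  a property holds eventually iff it holds for all refinements of some partition.\<close>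

definition partition_filter :: "'w set \<Rightarrow> 'w set set \<Rightarrow> 'w set set filter" where
  "partition_filter \<Omega> \<Sigma> =
     (INF \<pi>\<^sub>0\<in>finite_partitions \<Omega> \<Sigma>.
        principal {\<pi> \<in> finite_partitions \<Omega> \<Sigma>. refines \<Omega> \<pi> \<pi>\<^sub>0})"


section \<open>Vector measures\<close>

definition vector_measure :: "'w set set \<Rightarrow> ('w set \<Rightarrow> 'b::real_normed_vector) \<Rightarrow> bool" where
  "vector_measure \<Sigma> G \<longleftrightarrow>
     (\<forall>A. range A \<subseteq> \<Sigma> \<longrightarrow> disjoint_family A \<longrightarrow> (\<lambda>i::nat. G (A i)) sums G (\<Union>i. A i))"

definition bounded_variation ::
    "'w set \<Rightarrow> 'w set set \<Rightarrow> ('w set \<Rightarrow> 'b::real_normed_vector) \<Rightarrow> bool" where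
  "bounded_variation \<Omega> \<Sigma> G \<longleftrightarrow>
     (\<exists>K. \<forall>\<pi>\<in>finite_partitions \<Omega> \<Sigma>. (\<Sum>A\<in>\<pi>. norm (G A)) \<le> K)"

definition finite_semivariation ::
    "'w set \<Rightarrow> 'w set set \<Rightarrow> ('w set \<Rightarrow> ('x::real_normed_vector \<Rightarrow>\<^sub>L real)) \<Rightarrow> bool" where
  "finite_semivariation \<Omega> \<Sigma> m \<longleftrightarrow>
     (\<exists>K. \<forall>\<pi>\<in>finite_partitions \<Omega> \<Sigma>. \<forall>x. (\<forall>A\<in>\<pi>. norm (x A) \<le> 1) \<longrightarrow>
        norm (\<Sum>A\<in>\<pi>. blinfun_apply (m A) (x A)) \<le> K)"

definition continuous_wrt ::
    "('w set \<Rightarrow> 'b::real_normed_vector) \<Rightarrow> 'w measure \<Rightarrow> bool" where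
  "continuous_wrt m \<mu> \<longleftrightarrow>
     (\<forall>\<epsilon>>0. \<exists>\<delta>>0. \<forall>A\<in>sets \<mu>. measure \<mu> A < \<delta> \<longrightarrow> norm (m A) < \<epsilon>)"


section \<open>Bochner integral in arbitrary Banach spaces\<close>

text \<open>The library relation \<^const>\<open>has_bochner_integral\<close> is restricted to second countable target
  spaces. For a general Banach space we require strong measurability, i.e. that the
  function is almost everywhere the limit of simple functions. The almost everywhere limit makes
  the norms below almost everywhere equal to measurable functions, so the use of
  \<^const>\<open>nn_integral\<close> is sound even though \<open>f\<close> need not be Borel measurable.\<close>

definition strongly_measurable :: "'w measure \<Rightarrow> ('w \<Rightarrow> 'b::real_normed_vector) \<Rightarrow> bool" where
  "strongly_measurable \<mu> f \<longleftrightarrow>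
     (\<exists>s. (\<forall>n::nat. simple_function \<mu> (s n)) \<and>
          (AE \<omega> in \<mu>. (\<lambda>n. s n \<omega>) \<longlonglongrightarrow> f \<omega>))"

definition has_strong_integral ::
    "'w measure \<Rightarrow> ('w \<Rightarrow> 'b::real_normed_vector) \<Rightarrow> 'b \<Rightarrow> bool" where
  "has_strong_integral \<mu> f I \<longleftrightarrow>
     strongly_measurable \<mu> f \<and>
     (\<exists>s. (\<forall>n::nat. Bochner_Integration.simple_bochner_integrable \<mu> (s n)) \<and>
          (\<lambda>n. \<integral>\<^sup>+\<omega>. ennreal (norm (f \<omega> - s n \<omega>)) \<partial>\<mu>) \<longlonglongrightarrow> 0 \<and>
          (\<lambda>n. Bochner_Integration.simple_bochner_integral \<mu> (s n)) \<longlonglongrightarrow> I)"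

definition strong_set_integral ::
    "'w measure \<Rightarrow> 'w set \<Rightarrow> ('w \<Rightarrow> 'b::real_normed_vector) \<Rightarrow> 'b" where
  "strong_set_integral \<mu> A f = (THE I. has_strong_integral \<mu> (\<lambda>\<omega>. indicator A \<omega> *\<^sub>R f \<omega>) I)"


section \<open>Radon-Nikodym property\<close>

text \<open>HOL cannot quantify over types, so the type \<open>'w\<close> carrying the measure spaces is a
  parameter. The space of a measure is an arbitrary subset of \<open>'w\<close>.\<close>

definition radon_nikodym_property :: "'w itself \<Rightarrow> 'b::banach itself \<Rightarrow> bool" where
  "radon_nikodym_property _ _ \<longleftrightarrow>
     (\<forall>(\<mu>::'w measure) (G::'w set \<Rightarrow> 'b).
        finite_measure \<mu> \<and> vector_measure (sets \<mu>) G \<and>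
        bounded_variation (space \<mu>) (sets \<mu>) G \<and> continuous_wrt G \<mu> \<longrightarrow>
        (\<exists>g. (\<exists>I. has_strong_integral \<mu> g I) \<and>
             (\<forall>E\<in>sets \<mu>. has_strong_integral \<mu> (\<lambda>\<omega>. indicator E \<omega> *\<^sub>R g \<omega>) (G E))))"


section \<open>Function spaces and bounded linear functionals\<close>

text \<open>The elements of the function spaces are total functions on the carrier type. Only their
  values on the underlying space \<open>\<Omega>\<close> matter: the sup norm below is a seminorm that ignores the
  rest, and so does every functional that is bounded with respect to it.\<close>

definition simple_on :: "'w set \<Rightarrow> 'w set set \<Rightarrow> ('w \<Rightarrow> 'x::real_normed_vector) \<Rightarrow> bool" where
  "simple_on \<Omega> \<Sigma> f \<longleftrightarrow> simple_function (sigma \<Omega> \<Sigma>) f"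

definition U_space :: "'w set \<Rightarrow> 'w set set \<Rightarrow> ('w \<Rightarrow> 'x::real_normed_vector) set" where
  "U_space \<Omega> \<Sigma> =
     {f. \<exists>s. (\<forall>n::nat. simple_on \<Omega> \<Sigma> (s n)) \<and> uniform_limit \<Omega> s f sequentially}"

definition C_space :: "'h topology \<Rightarrow> ('h \<Rightarrow> 'x::real_normed_vector) set" where
  "C_space H = {f. continuous_map H euclidean f}"

text \<open>Inserting 0 changes the supremum only for empty \<open>\<Omega>\<close>.\<close>

definition sup_norm :: "'w set \<Rightarrow> ('w \<Rightarrow> 'x::real_normed_vector) \<Rightarrow> real" where
  "sup_norm \<Omega> f = Sup (insert 0 ((\<lambda>\<omega>. norm (f \<omega>)) ` \<Omega>))"

definition bounded_linear_functional ::
    "'w set \<Rightarrow> ('w \<Rightarrow> 'x::real_normed_vector) set \<Rightarrow> (('w \<Rightarrow> 'x) \<Rightarrow> real) \<Rightarrow> bool" where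
  "bounded_linear_functional \<Omega> F T \<longleftrightarrow>
     (\<forall>f\<in>F. \<forall>g\<in>F. T (\<lambda>\<omega>. f \<omega> + g \<omega>) = T f + T g) \<and>
     (\<forall>c. \<forall>f\<in>F. T (\<lambda>\<omega>. c *\<^sub>R f \<omega>) = c * T f) \<and>
     (\<exists>K. \<forall>f\<in>F. \<bar>T f\<bar> \<le> K * sup_norm \<Omega> f)"

definition functional_norm ::
    "'w set \<Rightarrow> ('w \<Rightarrow> 'x::real_normed_vector) set \<Rightarrow> (('w \<Rightarrow> 'x) \<Rightarrow> real) \<Rightarrow> real" where
  "functional_norm \<Omega> F T = (SUP f\<in>{f\<in>F. sup_norm \<Omega> f \<le> 1}. \<bar>T f\<bar>)"


section \<open>Integration against operator-valued measures\<close>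

definition simple_vm_integral ::
    "'w set \<Rightarrow> ('w set \<Rightarrow> ('x::real_normed_vector \<Rightarrow>\<^sub>L real)) \<Rightarrow> ('w \<Rightarrow> 'x) \<Rightarrow> real" where
  "simple_vm_integral \<Omega> m f = (\<Sum>x\<in>f ` \<Omega>. blinfun_apply (m {\<omega>\<in>\<Omega>. f \<omega> = x}) x)"

definition has_vm_integral ::
    "'w set \<Rightarrow> 'w set set \<Rightarrow> ('w set \<Rightarrow> ('x::real_normed_vector \<Rightarrow>\<^sub>L real)) \<Rightarrow>
     ('w \<Rightarrow> 'x) \<Rightarrow> real \<Rightarrow> bool" where
  "has_vm_integral \<Omega> \<Sigma> m f I \<longleftrightarrow>
     (\<exists>s. (\<forall>n::nat. simple_on \<Omega> \<Sigma> (s n)) \<and> uniform_limit \<Omega> s f sequentially \<and>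
          (\<lambda>n. simple_vm_integral \<Omega> m (s n)) \<longlonglongrightarrow> I)"

definition represents_on_U ::
    "'w set \<Rightarrow> 'w set set \<Rightarrow> ('w set \<Rightarrow> ('x::real_normed_vector \<Rightarrow>\<^sub>L real)) \<Rightarrow>
     (('w \<Rightarrow> 'x) \<Rightarrow> real) \<Rightarrow> bool" where
  "represents_on_U \<Omega> \<Sigma> m T \<longleftrightarrow>
     additive \<Sigma> m \<and> finite_semivariation \<Omega> \<Sigma> m \<and>
     (\<forall>f\<in>U_space \<Omega> \<Sigma>. has_vm_integral \<Omega> \<Sigma> m f (T f))"

definition borel_sets_of :: "'h topology \<Rightarrow> 'h set set" where
  "borel_sets_of H = sigma_sets (topspace H) {U. openin H U}"

text \<open>Regularity of a set function in the sense of Dunford and Schwartz.\<close>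

definition regular_set_function :: "'h topology \<Rightarrow> ('h set \<Rightarrow> real) \<Rightarrow> bool" where
  "regular_set_function H \<nu> \<longleftrightarrow>
     (\<forall>A\<in>borel_sets_of H. \<forall>\<epsilon>>0. \<exists>K U. closedin H K \<and> openin H U \<and> K \<subseteq> A \<and> A \<subseteq> U \<and>
        (\<forall>C\<in>borel_sets_of H. C \<subseteq> U - K \<longrightarrow> \<bar>\<nu> C\<bar> < \<epsilon>))"

definition weakly_regular ::
    "'h topology \<Rightarrow> ('h set \<Rightarrow> ('x::real_normed_vector \<Rightarrow>\<^sub>L real)) \<Rightarrow> bool" where
  "weakly_regular H m \<longleftrightarrow>
     (\<forall>x. vector_measure (borel_sets_of H) (\<lambda>A. blinfun_apply (m A) x) \<and>
          regular_set_function H (\<lambda>A. blinfun_apply (m A) x))"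

text \<open>The bidual of the reals is identified with the reals, so the values of \<open>m\<close> lie in the dual
  of \<open>'x\<close>. On a compact space every continuous function is a uniform limit of simple Borel
  functions, so \<^term>\<open>has_vm_integral\<close> applies to it.\<close>

definition represents_on_C ::
    "'h topology \<Rightarrow> ('h set \<Rightarrow> ('x::real_normed_vector \<Rightarrow>\<^sub>L real)) \<Rightarrow>
     (('h \<Rightarrow> 'x) \<Rightarrow> real) \<Rightarrow> bool" where
  "represents_on_C H m T \<longleftrightarrow>
     additive (borel_sets_of H) m \<and>
     finite_semivariation (topspace H) (borel_sets_of H) m \<and>
     weakly_regular H m \<and>
     (\<forall>f\<in>C_space H. has_vm_integral (topspace H) (borel_sets_of H) m f (T f))"


section \<open>Conditional expectation operators\<close>

text \<open>If \<open>measure \<mu> A = 0\<close>, the factor \<open>inverse (measure \<mu> A)\<close> is 0 and the term vanishes, which is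
  the convention 0/0 = 0.\<close>

definition cond_exp_op ::
    "'w measure \<Rightarrow> ('w set \<Rightarrow> ('x::real_normed_vector \<Rightarrow>\<^sub>L real)) \<Rightarrow> 'w set set \<Rightarrow>
     ('w \<Rightarrow> 'x) \<Rightarrow> real" where
  "cond_exp_op \<mu> m \<pi> f =
     (\<Sum>A\<in>\<pi>. blinfun_apply (m A) (inverse (measure \<mu> A) *\<^sub>R strong_set_integral \<mu> A f))"

definition cond_exps_converge ::
    "'w measure \<Rightarrow> ('w \<Rightarrow> 'x::real_normed_vector) set \<Rightarrow>
     ('w set \<Rightarrow> ('x \<Rightarrow>\<^sub>L real)) \<Rightarrow> (('w \<Rightarrow> 'x) \<Rightarrow> real) \<Rightarrow> bool" where
  "cond_exps_converge \<mu> F m T \<longleftrightarrow>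
     ((\<lambda>\<pi>. functional_norm (space \<mu>) F (\<lambda>f. cond_exp_op \<mu> m \<pi> f - T f)) \<longlongrightarrow> 0)
       (partition_filter (space \<mu>) (sets \<mu>))"

end

theory Submission
  imports Defs
begin

text \<open>The proof replaces operators and densities by set functions. A charge here is a finitely additive
\<open>G\<close> of bounded variation with \<open>G \<ll> \<mu>\<close>. Its average over a finite partition \<open>\<pi>\<close> is the charge with the
step density \<open>\<Sum>A\<in>\<pi>. (G A / \<mu> A) 1\<^sub>A\<close>. Call \<open>G\<close> approximable if for each \<open>\<epsilon> > 0\<close> some average of \<open>G\<close>
differs from \<open>G\<close> by at most \<open>\<epsilon>\<close> in total variation. Three facts give the theorem.

\<^item> A charge is approximable iff it has a Bochner integrable density
  (\<open>strong_density_approximable\<close>, \<open>approximable_has_strong_density\<close>). If \<open>g\<close> is a density, then a simple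
  function close to \<open>g\<close> in \<open>L\<^sup>1\<close> gives a step charge close to \<open>G\<close>, and averaging over its level sets
  at most doubles the error (\<open>averaging_error\<close>). Conversely the step densities of good averages are
  Cauchy in \<open>L\<^sup>1\<close>, and their limit is a density. So the Radon-Nikodym property on \<open>'w\<close> says that all
  charges on \<open>'w\<close> are approximable.

\<^item> The number \<open>T\<^sub>\<pi> f - T f\<close> is the integral of \<open>f\<close> against the difference of the average of \<open>m\<close> and \<open>m\<close>.
  Since the values of \<open>m\<close> are functionals, the norm of \<open>T\<^sub>\<pi> - T\<close> is at most the total variation of this
  difference and at least half of it, provided that there are enough functions. On \<open>U_space\<close> this gives at once
  that convergence is approximability. On \<open>C_space\<close> only the estimate from above is immediate, because
  continuous functions need not approximate step functions. The estimate from below holds for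
  partitions into open sets, whose step functions are continuous.

\<^item> Approximability does not depend on the type that carries the measure spaces
  (\<open>non_approximable_compact_model\<close>). If \<open>G\<close> is not approximable, there is a sequence of successive
  refinements along which the averages keep oscillating by more than a fixed \<open>\<epsilon>\<close>. The sequence of
  blocks that contain a point is a point of a compact product of finite sets, and this product
  embeds in every type of at least the cardinality of the continuum. The image charge lives on the
  Borel sets of a compact Hausdorff space, and the cylinder partitions, which are open, show that it
  is not approximable either. The last step is the martingale argument: sets in the
  \<open>\<sigma>\<close>-algebra generated by the partitions are approximated in measure by unions of blocks, so a step
  charge near the image charge would bound the oscillation.

Hence the Radon-Nikodym property, and convergence on \<open>C_space\<close> and on \<open>U_space\<close>, all say that every
charge is approximable, on \<open>'w\<close>, \<open>'h\<close> and \<open>'s\<close> respectively, and these three statements are equivalent.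
In the passage from \<open>C_space\<close> to approximability the compact model also supplies the compact space.\<close>

section \<open>Finite partitions and additive set functions\<close>

lemma additive_empty:
  fixes G :: "'w set \<Rightarrow> 'b::ab_group_add"
  assumes "additive (sets \<mu>) G" shows "G {} = 0"
  using additiveD[OF assms, of "{}" "{}"] by simp

lemma additive_finite_UN:
  fixes G :: "'w set \<Rightarrow> 'b::ab_group_add"
  assumes G: "additive (sets \<mu>) G" and "finite I" "D ` I \<subseteq> sets \<mu>" "disjoint_family_on D I"
  shows "G (\<Union>i\<in>I. D i) = (\<Sum>i\<in>I. G (D i))"
  using assms(2-)
proof (induction I rule: finite_induct)
  case empty then show ?case using additive_empty[OF G] by simp
next
  case (insert i I)
  have "G (D i \<union> (\<Union>i\<in>I. D i)) = G (D i) + G (\<Union>i\<in>I. D i)"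
    by (rule additiveD[OF G]) (use insert in \<open>auto simp: disjoint_family_on_def\<close>)
  then show ?case using insert by (auto simp: disjoint_family_on_def)
qed

lemma finite_partitionsD:
  assumes "\<pi> \<in> finite_partitions \<Omega> \<Sigma>"
  shows "finite \<pi>" "\<pi> \<subseteq> \<Sigma>" "\<Union>\<pi> = \<Omega>" "disjoint \<pi>" "{} \<notin> \<pi>" "partition_on \<Omega> \<pi>"
  using assms by (auto simp: finite_partitions_def partition_on_def)

lemma additive_partition_split:
  fixes G :: "'w set \<Rightarrow> 'b::ab_group_add"
  assumes G: "additive (sets \<mu>) G" and \<pi>: "\<pi> \<in> finite_partitions (space \<mu>) (sets \<mu>)"
    and E: "E \<in> sets \<mu>"
  shows "(\<Sum>A\<in>\<pi>. G (A \<inter> E)) = G E"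
proof -
  note p = finite_partitionsD[OF \<pi>]
  have "G (\<Union>A\<in>\<pi>. A \<inter> E) = (\<Sum>A\<in>\<pi>. G (A \<inter> E))"
    by (rule additive_finite_UN[OF G])
      (use p E in \<open>auto simp: disjoint_family_on_def dest: disjointD[OF p(4)]\<close>)
  moreover have "(\<Union>A\<in>\<pi>. A \<inter> E) = E" using p(3) sets.sets_into_space[OF E] by auto
  ultimately show ?thesis by simp
qed

lemma additive_measure:
  assumes "finite_measure \<mu>" shows "additive (sets \<mu>) (measure \<mu>)"
  using finite_measure.finite_measure_Union[OF assms] by (auto simp: additive_def)

text \<open>Preimages of the blocks of a partition can be empty, and a single set does not fill the space; a
bound over partitions still applies to such families.\<close>

lemma variation_bound_disjoint_family:
  assumes K: "\<And>\<pi>. \<pi> \<in> finite_partitions (space \<mu>) (sets \<mu>) \<Longrightarrow> (\<Sum>A\<in>\<pi>. norm (N A)) \<le> K"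
    and N: "N {} = (0::'b::real_normed_vector)"
    and "finite I" "D ` I \<subseteq> sets \<mu>" "disjoint_family_on D I"
  shows "(\<Sum>i\<in>I. norm (N (D i))) \<le> K"
proof -
  define J where "J = {i\<in>I. D i \<noteq> {}}"
  define R where "R = space \<mu> - (\<Union>i\<in>I. D i)"
  \<comment> \<open>Drop the empty members and add the rest of the space as one more block.\<close>
  define \<pi> where "\<pi> = D ` J \<union> ({R} - {{}})"
  have inj: "inj_on D J"
    using assms(5) unfolding J_def disjoint_family_on_def inj_on_def by (metis (mono_tags, lifting) inf.idem mem_Collect_eq)
  have "\<pi> \<in> finite_partitions (space \<mu>) (sets \<mu>)"
    unfolding finite_partitions_def partition_on_def
  proof (intro CollectI conjI)
    have "R \<in> sets \<mu>" unfolding R_def using assms(3,4) by (intro sets.compl_sets sets.finite_UN) auto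
    then show "finite \<pi>" "\<pi> \<subseteq> sets \<mu>" "{} \<notin> \<pi>" using assms(3,4) by (auto simp: \<pi>_def J_def)
    show "\<Union>\<pi> = space \<mu>"
    proof -
      have "\<Union>\<pi> = (\<Union>i\<in>I. D i) \<union> R" by (auto simp: \<pi>_def J_def)
      moreover have "(\<Union>i\<in>I. D i) \<subseteq> space \<mu>" using assms(4) sets.sets_into_space[of _ \<mu>] by auto
      ultimately show ?thesis by (auto simp: R_def)
    qed
    show "disjoint \<pi>"
    proof (rule disjointI)
      fix a b assume ab: "a \<in> \<pi>" "b \<in> \<pi>" "a \<noteq> b"
      have D: "D i \<inter> D j = {}" if "i \<in> I" "j \<in> I" "D i \<noteq> D j" for i j
        using assms(5) that by (metis disjoint_family_onD)
      show "a \<inter> b = {}"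
      proof (cases "a = R \<or> b = R")
        case True then show ?thesis using ab by (auto simp: \<pi>_def R_def J_def)
      next
        case False
        then obtain i j where "i \<in> I" "j \<in> I" "a = D i" "b = D j" using ab by (auto simp: \<pi>_def J_def)
        then show ?thesis using D ab by blast
      qed
    qed
  qed
  from K[OF this] have "(\<Sum>A\<in>\<pi>. norm (N A)) \<le> K" .
  moreover have "(\<Sum>A\<in>D ` J. norm (N A)) \<le> (\<Sum>A\<in>\<pi>. norm (N A))"
    by (rule sum_mono2) (use assms(3) in \<open>auto simp: \<pi>_def J_def\<close>)
  moreover have "(\<Sum>A\<in>D ` J. norm (N A)) = (\<Sum>i\<in>J. norm (N (D i)))"
    using inj by (simp add: sum.reindex)
  moreover have "\<dots> = (\<Sum>i\<in>I. norm (N (D i)))"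
    by (rule sum.mono_neutral_left) (use assms(3) N in \<open>auto simp: J_def\<close>)
  ultimately show ?thesis by simp
qed

lemma common_refinement_pair:
  assumes "\<pi> \<in> finite_partitions \<Omega> \<Sigma>" "\<tau> \<in> finite_partitions \<Omega> \<Sigma>"
    and Int: "\<And>A B. A \<in> \<Sigma> \<Longrightarrow> B \<in> \<Sigma> \<Longrightarrow> A \<inter> B \<in> \<Sigma>"
  obtains \<rho> where "\<rho> \<in> finite_partitions \<Omega> \<Sigma>" "refines \<Omega> \<rho> \<pi>" "refines \<Omega> \<rho> \<tau>"
proof -
  define \<rho> where "\<rho> = (\<lambda>(A,B). A \<inter> B) ` (\<pi> \<times> \<tau>) - {{}}"
  note p = finite_partitionsD[OF assms(1)] and t = finite_partitionsD[OF assms(2)]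
  have "partition_on \<Omega> \<rho>"
    unfolding partition_on_def
  proof (intro conjI)
    have "\<Union>\<rho> = \<Union>\<pi> \<inter> \<Union>\<tau>" by (auto simp: \<rho>_def)
    then show "\<Union>\<rho> = \<Omega>" using p(3) t(3) by simp
    show "disjoint \<rho>"
    proof (rule disjointI)
      fix a b assume "a \<in> \<rho>" "b \<in> \<rho>" "a \<noteq> b"
      then obtain A B A' B' where *: "A \<in> \<pi>" "B \<in> \<tau>" "A' \<in> \<pi>" "B' \<in> \<tau>"
        "a = A \<inter> B" "b = A' \<inter> B'" by (auto simp: \<rho>_def)
      with \<open>a \<noteq> b\<close> have "A \<noteq> A' \<or> B \<noteq> B'" by auto
      then have "A \<inter> A' = {} \<or> B \<inter> B' = {}"
        using * disjointD[OF p(4)] disjointD[OF t(4)] by metis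
      then show "a \<inter> b = {}" using * by auto
    qed
  qed (simp add: \<rho>_def)
  then have "\<rho> \<in> finite_partitions \<Omega> \<Sigma>"
    using p(1,2) t(1,2) Int by (fastforce simp: finite_partitions_def \<rho>_def)
  moreover have "refines \<Omega> \<rho> \<pi>" "refines \<Omega> \<rho> \<tau>"
    using \<open>partition_on \<Omega> \<rho>\<close> p t by (auto simp: refines_def \<rho>_def)
  ultimately show ?thesis using that by blast
qed

lemma finite_partitions_nonempty:
  assumes "\<Omega> \<in> \<Sigma>" shows "\<exists>\<pi>. \<pi> \<in> finite_partitions \<Omega> \<Sigma>"
proof (cases "\<Omega> = {}")
  case True then have "{} \<in> finite_partitions \<Omega> \<Sigma>"
    by (auto simp: finite_partitions_def partition_on_empty)
  then show ?thesis by blast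
next
  case False then have "{\<Omega>} \<in> finite_partitions \<Omega> \<Sigma>"
    using assms by (auto simp: finite_partitions_def partition_on_space)
  then show ?thesis by blast
qed

lemma refines_block_cases:
  assumes "refines \<Omega> \<rho> \<pi>" "B \<in> \<rho>" "A \<in> \<pi>"
  shows "B \<subseteq> A \<or> B \<inter> A = {}"
proof -
  obtain A' where A': "A' \<in> \<pi>" "B \<subseteq> A'" using assms by (auto simp: refines_def)
  have "A' = A \<or> A' \<inter> A = {}"
    using assms A' by (auto simp: refines_def partition_on_def dest: disjointD)
  with A' show ?thesis by auto
qed

text \<open>The triangle inequality on the pieces of each block: the variation sums increase under refinement.\<close>

lemma refines_sum_mono:
  fixes N :: "'w set \<Rightarrow> 'b::real_normed_vector"
  assumes N: "additive (sets \<mu>) N" and \<rho>: "\<rho> \<in> finite_partitions (space \<mu>) (sets \<mu>)"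
    and \<tau>: "\<tau> \<in> finite_partitions (space \<mu>) (sets \<mu>)" and r: "refines (space \<mu>) \<rho> \<tau>"
  shows "(\<Sum>B\<in>\<tau>. norm (N B)) \<le> (\<Sum>B\<in>\<rho>. norm (N B))"
proof -
  note p = finite_partitionsD[OF \<rho>] and t = finite_partitionsD[OF \<tau>]
  have "(\<Sum>B\<in>\<tau>. norm (N B)) \<le> (\<Sum>B\<in>\<tau>. \<Sum>C\<in>\<rho>. norm (N (C \<inter> B)))"
  proof (rule sum_mono)
    fix B assume "B \<in> \<tau>"
    then have "N B = (\<Sum>C\<in>\<rho>. N (C \<inter> B))"
      using additive_partition_split[OF N \<rho>] t(2) by auto
    then show "norm (N B) \<le> (\<Sum>C\<in>\<rho>. norm (N (C \<inter> B)))" by (simp add: sum_norm_le)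
  qed
  also have "\<dots> = (\<Sum>C\<in>\<rho>. \<Sum>B\<in>\<tau>. norm (N (C \<inter> B)))" by (rule sum.swap)
  also have "\<dots> = (\<Sum>C\<in>\<rho>. norm (N C))"
  proof (rule sum.cong[OF refl])
    fix C assume C: "C \<in> \<rho>"
    then obtain B0 where B0: "B0 \<in> \<tau>" "C \<subseteq> B0" using r by (auto simp: refines_def)
    have "(\<Sum>B\<in>\<tau>. norm (N (C \<inter> B))) = (\<Sum>B\<in>\<tau>. if B = B0 then norm (N C) else 0)"
    proof (rule sum.cong[OF refl])
      fix B assume "B \<in> \<tau>"
      then have "B \<noteq> B0 \<Longrightarrow> C \<inter> B = {}" using B0 t(4) by (auto simp: disjoint_def)
      then show "norm (N (C \<inter> B)) = (if B = B0 then norm (N C) else 0)"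
        using B0 additive_empty[OF N] by (auto simp: Int_absorb2)
    qed
    then show "(\<Sum>B\<in>\<tau>. norm (N (C \<inter> B))) = norm (N C)" using B0 t(1) by simp
  qed
  finally show ?thesis .
qed

section \<open>Averages of a charge over a partition\<close>

text \<open>The indefinite integral of the step density \<open>\<Sum>i\<in>I. c i 1\<^bsub>S i\<^esub>\<close>. The sets \<open>S i\<close> may overlap, which lets them be
perturbed independently of each other.\<close>

definition step_charge :: "'w measure \<Rightarrow> 'i set \<Rightarrow> ('i \<Rightarrow> 'w set) \<Rightarrow> ('i \<Rightarrow> 'b::real_normed_vector) \<Rightarrow> 'w set \<Rightarrow> 'b" where
  "step_charge \<mu> I S c E = (\<Sum>i\<in>I. measure \<mu> (S i \<inter> E) *\<^sub>R c i)"

text \<open>The indefinite integral of the conditional expectation of \<open>dG/d\<mu>\<close> with respect to \<open>\<pi>\<close>, which makes sense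
without a density.\<close>

definition cond_charge :: "'w measure \<Rightarrow> 'w set set \<Rightarrow> ('w set \<Rightarrow> 'b::real_normed_vector) \<Rightarrow> 'w set \<Rightarrow> 'b" where
  "cond_charge \<mu> \<pi> G E = (\<Sum>A\<in>\<pi>. (measure \<mu> (A \<inter> E) / measure \<mu> A) *\<^sub>R G A)"

lemma cond_charge_eq_step_charge:
  "cond_charge \<mu> \<pi> G = step_charge \<mu> \<pi> (\<lambda>A. A) (\<lambda>A. G A /\<^sub>R measure \<mu> A)"
  by (auto simp: cond_charge_def step_charge_def divide_inverse fun_eq_iff)

lemma additive_step_charge:
  assumes \<mu>: "finite_measure \<mu>" and "\<And>i. i \<in> I \<Longrightarrow> S i \<in> sets \<mu>"
  shows "additive (sets \<mu>) (step_charge \<mu> I S c)"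
  unfolding additive_def
proof (intro ballI impI)
  fix x y assume xy: "x \<in> sets \<mu>" "y \<in> sets \<mu>" "x \<inter> y = {}"
  have "measure \<mu> (S i \<inter> (x \<union> y)) = measure \<mu> (S i \<inter> x) + measure \<mu> (S i \<inter> y)" if "i \<in> I" for i
    unfolding Int_Un_distrib
    by (rule finite_measure.finite_measure_Union[OF \<mu>]) (use xy assms(2)[OF that] in auto)
  then show "step_charge \<mu> I S c (x \<union> y) = step_charge \<mu> I S c x + step_charge \<mu> I S c y"
    by (simp add: step_charge_def sum.distrib[symmetric] scaleR_left.add)
qed

lemma additive_cond_charge:
  assumes \<mu>: "finite_measure \<mu>" and "\<pi> \<in> finite_partitions (space \<mu>) (sets \<mu>)"
  shows "additive (sets \<mu>) (cond_charge \<mu> \<pi> G)"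
  unfolding cond_charge_eq_step_charge
  using finite_partitionsD[OF assms(2)] by (intro additive_step_charge[OF \<mu>]) auto

lemma additive_diff:
  fixes M N :: "'w set \<Rightarrow> 'b::ab_group_add"
  assumes "additive \<Sigma> M" "additive \<Sigma> N" shows "additive \<Sigma> (\<lambda>A. M A - N A)"
  using assms by (auto simp: additive_def)

text \<open>A density that is constant on the blocks of \<open>\<pi>\<close> equals its conditional expectation.\<close>

lemma averaging_fixes_step_charge:
  assumes \<mu>: "finite_measure \<mu>" and \<pi>: "\<pi> \<in> finite_partitions (space \<mu>) (sets \<mu>)"
    and S: "\<And>i. i \<in> I \<Longrightarrow> S i \<in> sets \<mu>"
    and const: "\<And>A i. A \<in> \<pi> \<Longrightarrow> i \<in> I \<Longrightarrow> A \<subseteq> S i \<or> A \<inter> S i = {}"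
    and B: "B \<in> sets \<mu>"
  shows "cond_charge \<mu> \<pi> (step_charge \<mu> I S c) B = step_charge \<mu> I S c B"
proof -
  interpret finite_measure \<mu> by fact
  note p = finite_partitionsD[OF \<pi>]
  have *: "(measure \<mu> (A \<inter> B) / measure \<mu> A) * measure \<mu> (S i \<inter> A) = measure \<mu> (A \<inter> (S i \<inter> B))"
    if "A \<in> \<pi>" "i \<in> I" for A i
  proof -
    have A: "A \<in> sets \<mu>" using that p by auto
    have "measure \<mu> (A \<inter> B) \<le> measure \<mu> A"
      by (rule finite_measure_mono) (use A in auto)
    then have 0: "measure \<mu> A = 0 \<Longrightarrow> measure \<mu> (A \<inter> B) = 0"
      using measure_nonneg[of \<mu> "A \<inter> B"] by linarith
    show ?thesis
    proof (cases "A \<subseteq> S i")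
      case True
      then have "S i \<inter> A = A" "A \<inter> (S i \<inter> B) = A \<inter> B" by auto
      with 0 show ?thesis by simp
    next
      case False
      then have "S i \<inter> A = {}" "A \<inter> (S i \<inter> B) = {}" using const[OF that] by auto
      then show ?thesis by simp
    qed
  qed
  have "cond_charge \<mu> \<pi> (step_charge \<mu> I S c) B =
      (\<Sum>A\<in>\<pi>. \<Sum>i\<in>I. measure \<mu> (A \<inter> (S i \<inter> B)) *\<^sub>R c i)"
    unfolding cond_charge_def step_charge_def scaleR_sum_right scaleR_scaleR
    by (intro sum.cong refl) (simp only: *)
  also have "\<dots> = (\<Sum>i\<in>I. (\<Sum>A\<in>\<pi>. measure \<mu> (A \<inter> (S i \<inter> B))) *\<^sub>R c i)"
    by (subst sum.swap) (simp add: scaleR_sum_left)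
  also have "\<dots> = step_charge \<mu> I S c B"
    unfolding step_charge_def
    by (rule sum.cong[OF refl])
      (use additive_partition_split[OF additive_measure[OF \<mu>] \<pi>] S B in auto)
  finally show ?thesis .
qed

text \<open>Conditional expectation is an \<open>L\<^sup>1\<close> contraction, and it depends only on the values on the blocks
of \<open>\<pi>\<close>.\<close>

lemma averaging_contracts:
  assumes \<mu>: "finite_measure \<mu>" and \<pi>: "\<pi> \<in> finite_partitions (space \<mu>) (sets \<mu>)"
    and \<tau>: "\<tau> \<in> finite_partitions (space \<mu>) (sets \<mu>)"
  shows "(\<Sum>B\<in>\<tau>. norm (cond_charge \<mu> \<pi> N B)) \<le> (\<Sum>A\<in>\<pi>. norm (N A))"
proof -
  note p = finite_partitionsD[OF \<pi>] and t = finite_partitionsD[OF \<tau>]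
  have "(\<Sum>B\<in>\<tau>. norm (cond_charge \<mu> \<pi> N B))
      \<le> (\<Sum>B\<in>\<tau>. \<Sum>A\<in>\<pi>. (measure \<mu> (A \<inter> B) / measure \<mu> A) * norm (N A))"
    unfolding cond_charge_def
    by (intro sum_mono order_trans[OF norm_sum] ) simp
  also have "\<dots> = (\<Sum>A\<in>\<pi>. ((\<Sum>B\<in>\<tau>. measure \<mu> (B \<inter> A)) / measure \<mu> A) * norm (N A))"
    by (subst sum.swap) (simp add: sum_distrib_right sum_divide_distrib Int_commute)
  also have "\<dots> \<le> (\<Sum>A\<in>\<pi>. norm (N A))"
  proof (rule sum_mono)
    fix A assume "A \<in> \<pi>"
    then have "(\<Sum>B\<in>\<tau>. measure \<mu> (B \<inter> A)) = measure \<mu> A"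
      using additive_partition_split[OF additive_measure[OF \<mu>] \<tau>] p(2) by auto
    then show "(\<Sum>B\<in>\<tau>. measure \<mu> (B \<inter> A)) / measure \<mu> A * norm (N A) \<le> norm (N A)" by simp
  qed
  finally show ?thesis .
qed

text \<open>Averaging is linear, fixes the step charge and contracts the difference. The two sums on the right
run over \<open>\<tau>\<close> and \<open>\<pi>\<close> alone; the martingale argument below controls the variation only along the
partitions of one sequence.\<close>

lemma averaging_error:
  assumes \<mu>: "finite_measure \<mu>" and \<pi>: "\<pi> \<in> finite_partitions (space \<mu>) (sets \<mu>)"
    and \<tau>: "\<tau> \<in> finite_partitions (space \<mu>) (sets \<mu>)"
    and S: "\<And>i. i \<in> I \<Longrightarrow> S i \<in> sets \<mu>"
    and const: "\<And>A i. A \<in> \<pi> \<Longrightarrow> i \<in> I \<Longrightarrow> A \<subseteq> S i \<or> A \<inter> S i = {}"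
  shows "(\<Sum>B\<in>\<tau>. norm (G B - cond_charge \<mu> \<pi> G B))
     \<le> (\<Sum>B\<in>\<tau>. norm (G B - step_charge \<mu> I S c B)) + (\<Sum>A\<in>\<pi>. norm (G A - step_charge \<mu> I S c A))"
proof -
  define h where "h = step_charge \<mu> I S c"
  have "(\<Sum>B\<in>\<tau>. norm (G B - cond_charge \<mu> \<pi> G B))
      \<le> (\<Sum>B\<in>\<tau>. norm (G B - h B) + norm (cond_charge \<mu> \<pi> (\<lambda>A. G A - h A) B))"
  proof (rule sum_mono)
    fix B assume "B \<in> \<tau>"
    then have "B \<in> sets \<mu>" using finite_partitionsD[OF \<tau>] by auto
    then have "cond_charge \<mu> \<pi> h B = h B"
      unfolding h_def by (intro averaging_fixes_step_charge[OF \<mu> \<pi>] S const)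
    then have "G B - cond_charge \<mu> \<pi> G B = (G B - h B) - cond_charge \<mu> \<pi> (\<lambda>A. G A - h A) B"
      by (simp add: cond_charge_def scaleR_diff_right sum_subtractf)
    then show "norm (G B - cond_charge \<mu> \<pi> G B)
        \<le> norm (G B - h B) + norm (cond_charge \<mu> \<pi> (\<lambda>A. G A - h A) B)"
      by (simp only: norm_triangle_ineq4)
  qed
  also have "\<dots> \<le> (\<Sum>B\<in>\<tau>. norm (G B - h B)) + (\<Sum>A\<in>\<pi>. norm (G A - h A))"
    using averaging_contracts[OF \<mu> \<pi> \<tau>, of "\<lambda>A. G A - h A"] by (simp add: sum.distrib)
  finally show ?thesis unfolding h_def .
qed

text \<open>By \<open>averaging_error\<close> this says that \<open>G\<close> belongs to the closure of the step charges in the variation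
norm. Averages are used as the approximants because they depend on \<open>\<pi>\<close> alone.\<close>

definition density_approximable :: "'w measure \<Rightarrow> ('w set \<Rightarrow> 'b::real_normed_vector) \<Rightarrow> bool" where
  "density_approximable \<mu> G \<longleftrightarrow>
     (\<forall>\<epsilon>>0. \<exists>\<pi>\<in>finite_partitions (space \<mu>) (sets \<mu>). \<forall>\<tau>\<in>finite_partitions (space \<mu>) (sets \<mu>).
        (\<Sum>B\<in>\<tau>. norm (G B - cond_charge \<mu> \<pi> G B)) \<le> \<epsilon>)"

text \<open>The average over \<open>\<pi>\<^sub>0\<close> is a step charge that is constant on the blocks of every refinement, so
\<open>averaging_error\<close> compares \<open>G\<close> with its average over the refinement at twice the error of \<open>\<pi>\<^sub>0\<close>.\<close>

lemma density_approximable_refines: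
  assumes \<mu>: "finite_measure \<mu>" and "density_approximable \<mu> G" "\<epsilon> > 0"
  obtains \<pi>\<^sub>0 where "\<pi>\<^sub>0 \<in> finite_partitions (space \<mu>) (sets \<mu>)"
    "\<And>\<pi> \<tau>. \<lbrakk>\<pi> \<in> finite_partitions (space \<mu>) (sets \<mu>); refines (space \<mu>) \<pi> \<pi>\<^sub>0;
       \<tau> \<in> finite_partitions (space \<mu>) (sets \<mu>)\<rbrakk> \<Longrightarrow>
       (\<Sum>B\<in>\<tau>. norm (G B - cond_charge \<mu> \<pi> G B)) \<le> \<epsilon>"
proof -
  obtain \<pi>\<^sub>0 where \<pi>0: "\<pi>\<^sub>0 \<in> finite_partitions (space \<mu>) (sets \<mu>)"
    and *: "\<And>\<tau>. \<tau> \<in> finite_partitions (space \<mu>) (sets \<mu>) \<Longrightarrow>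
       (\<Sum>B\<in>\<tau>. norm (G B - cond_charge \<mu> \<pi>\<^sub>0 G B)) \<le> \<epsilon> / 2"
    using assms(2,3) unfolding density_approximable_def by (metis half_gt_zero)
  show ?thesis
  proof (rule that[OF \<pi>0])
    fix \<pi> \<tau> assume \<pi>: "\<pi> \<in> finite_partitions (space \<mu>) (sets \<mu>)" "refines (space \<mu>) \<pi> \<pi>\<^sub>0"
       and \<tau>: "\<tau> \<in> finite_partitions (space \<mu>) (sets \<mu>)"
    have "(\<Sum>B\<in>\<tau>. norm (G B - cond_charge \<mu> \<pi> G B))
     \<le> (\<Sum>B\<in>\<tau>. norm (G B - cond_charge \<mu> \<pi>\<^sub>0 G B)) + (\<Sum>A\<in>\<pi>. norm (G A - cond_charge \<mu> \<pi>\<^sub>0 G A))"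
      unfolding cond_charge_eq_step_charge[of \<mu> \<pi>\<^sub>0]
      by (rule averaging_error[OF \<mu> \<pi>(1) \<tau> _ refines_block_cases[OF \<pi>(2)]])
        (use finite_partitionsD[OF \<pi>0] in auto)
    then show "(\<Sum>B\<in>\<tau>. norm (G B - cond_charge \<mu> \<pi> G B)) \<le> \<epsilon>"
      using *[OF \<tau>] *[OF \<pi>(1)] by linarith
  qed
qed

definition charge_wrt :: "'w measure \<Rightarrow> ('w set \<Rightarrow> 'b::real_normed_vector) \<Rightarrow> bool" where
  "charge_wrt \<mu> G \<longleftrightarrow> finite_measure \<mu> \<and> additive (sets \<mu>) G \<and>
     bounded_variation (space \<mu>) (sets \<mu>) G \<and> continuous_wrt G \<mu>"

section \<open>Bochner integrals and step densities\<close>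

lemma charge_wrtD:
  assumes "charge_wrt \<mu> G"
  shows "finite_measure \<mu>" "additive (sets \<mu>) G" "bounded_variation (space \<mu>) (sets \<mu>) G"
    "continuous_wrt G \<mu>"
  using assms by (auto simp: charge_wrt_def)

text \<open>The tails \<open>\<Union>i\<ge>n. A i\<close> decrease to the empty set, so their \<open>\<mu>\<close>-measures tend to 0, and with them the
values of \<open>G\<close>.\<close>

lemma charge_vector_measure:
  assumes "charge_wrt \<mu> G"
  shows "vector_measure (sets \<mu>) G"
  unfolding vector_measure_def
proof (intro allI impI)
  fix A :: "nat \<Rightarrow> _" assume A: "range A \<subseteq> sets \<mu>" "disjoint_family A"
  note g = charge_wrtD[OF assms]
  interpret finite_measure \<mu> by (rule g)
  define R where "R n = (\<Union>i. A i) - (\<Union>i<n. A i)" for n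
  have U: "(\<Union>i. A i) \<in> sets \<mu>" "(\<Union>i<n. A i) \<in> sets \<mu>" for n using A by auto
  then have R: "R n \<in> sets \<mu>" for n by (auto simp: R_def)
  have "(\<Inter>n. R n) = {}" by (auto simp: R_def)
  moreover have "(\<lambda>n. measure \<mu> (R n)) \<longlonglongrightarrow> measure \<mu> (\<Inter>n. R n)"
    by (rule finite_Lim_measure_decseq) (use R in \<open>auto simp: R_def decseq_def\<close>)
  ultimately have R0: "(\<lambda>n. measure \<mu> (R n)) \<longlonglongrightarrow> 0" by simp
  have split: "(\<Union>i. A i) = (\<Union>i<n. A i) \<union> R n" "(\<Union>i<n. A i) \<inter> R n = {}" for n
    by (auto simp: R_def)
  have fin: "(\<Sum>i<n. G (A i)) = G (\<Union>i. A i) - G (R n)" for n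
  proof -
    have "G (\<Union>i<n. A i) = (\<Sum>i<n. G (A i))"
      by (rule additive_finite_UN[OF g(2)]) (use A in \<open>auto simp: disjoint_family_on_def\<close>)
    moreover have "G (\<Union>i. A i) = G (\<Union>i<n. A i) + G (R n)"
      using additiveD[OF g(2) split(2)[of n] U(2) R] split(1)[of n] by simp
    ultimately show ?thesis by simp
  qed
  have "(\<lambda>n. G (R n)) \<longlonglongrightarrow> 0"
  proof (rule LIMSEQ_I)
    fix e :: real assume "e > 0"
    then obtain d where d: "d > 0" "\<And>A. A \<in> sets \<mu> \<Longrightarrow> measure \<mu> A < d \<Longrightarrow> norm (G A) < e"
      using g(4) unfolding continuous_wrt_def by metis
    obtain N where "\<And>n. n \<ge> N \<Longrightarrow> norm (measure \<mu> (R n) - 0) < d"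
      using LIMSEQ_D[OF R0 d(1)] by blast
    then show "\<exists>N. \<forall>n\<ge>N. norm (G (R n) - 0) < e" using d(2) R by auto
  qed
  then have "(\<lambda>n. G (\<Union>i. A i) - G (R n)) \<longlonglongrightarrow> G (\<Union>i. A i)"
    by (auto intro!: tendsto_eq_intros)
  then show "(\<lambda>i. G (A i)) sums G (\<Union>i. A i)"
    unfolding sums_def fin .
qed

text \<open>The constant sequence of empty sets has a convergent series, which forces the value 0 at the empty
set; two disjoint sets followed by empty ones then give additivity.\<close>

lemma vector_measure_additive:
  assumes G: "vector_measure (sets \<mu>) G"
  shows "additive (sets \<mu>) G"
proof -
  have "(\<lambda>i::nat. G {}) sums G (\<Union>i::nat. {})"
    using G[unfolded vector_measure_def, rule_format, of "\<lambda>_. {}"] by (auto simp: disjoint_family_on_def)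
  then have "(\<lambda>i::nat. G {}) \<longlonglongrightarrow> 0" using sums_summable summable_LIMSEQ_zero by blast
  then have 0: "G {} = 0" by (simp add: LIMSEQ_const_iff)
  show ?thesis
    unfolding additive_def
  proof (intro ballI impI)
    fix A B assume AB: "A \<in> sets \<mu>" "B \<in> sets \<mu>" "A \<inter> B = {}"
    have "(\<lambda>i. G (binaryset A B i)) sums G (\<Union>i. binaryset A B i)"
    proof -
      have "range (binaryset A B) \<subseteq> sets \<mu>" using AB by (auto simp: range_binaryset_eq)
      moreover have "disjoint_family (binaryset A B)"
        using AB by (auto simp: disjoint_family_on_def binaryset_def)
      ultimately show ?thesis using G unfolding vector_measure_def by blast
    qed
    then show "G (A \<union> B) = G A + G B"
      using binaryset_sums[of G A B] 0 sums_unique2 by (fastforce simp: UN_binaryset_eq)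
  qed
qed

abbreviation sb_integrable :: "'w measure \<Rightarrow> ('w \<Rightarrow> 'b::real_vector) \<Rightarrow> bool" where
  "sb_integrable \<equiv> Bochner_Integration.simple_bochner_integrable"

abbreviation sb_integral :: "'w measure \<Rightarrow> ('w \<Rightarrow> 'b::real_vector) \<Rightarrow> 'b" where
  "sb_integral \<equiv> Bochner_Integration.simple_bochner_integral"

lemma simple_function_level_sets:
  assumes "simple_function \<mu> s"
  shows "finite (s ` space \<mu>)" "{\<omega>\<in>space \<mu>. s \<omega> = y} \<in> sets \<mu>"
    "disjoint_family_on (\<lambda>y. {\<omega>\<in>space \<mu>. s \<omega> = y}) I"
proof -
  show "finite (s ` space \<mu>)" using assms by (rule simple_functionD)
  have "s -` {y} \<inter> space \<mu> \<in> sets \<mu>" using assms by (rule simple_functionD)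
  moreover have "s -` {y} \<inter> space \<mu> = {\<omega>\<in>space \<mu>. s \<omega> = y}" by auto
  ultimately show "{\<omega>\<in>space \<mu>. s \<omega> = y} \<in> sets \<mu>" by simp
qed (auto simp: disjoint_family_on_def)

lemma level_sets_partition:
  assumes "simple_function \<mu> s"
  shows "(\<lambda>y. {\<omega>\<in>space \<mu>. s \<omega> = y}) ` (s ` space \<mu>) \<in> finite_partitions (space \<mu>) (sets \<mu>)"
    "inj_on (\<lambda>y. {\<omega>\<in>space \<mu>. s \<omega> = y}) (s ` space \<mu>)"
proof -
  show "(\<lambda>y. {\<omega>\<in>space \<mu>. s \<omega> = y}) ` (s ` space \<mu>) \<in> finite_partitions (space \<mu>) (sets \<mu>)"
    using simple_function_level_sets[OF assms]
    by (auto simp: finite_partitions_def partition_on_def disjoint_def)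
  show "inj_on (\<lambda>y. {\<omega>\<in>space \<mu>. s \<omega> = y}) (s ` space \<mu>)"
    by (auto simp: inj_on_def)
qed

lemma simple_bochner_integrable_finite_measure:
  assumes "finite_measure \<mu>" "simple_function \<mu> s"
  shows "sb_integrable \<mu> s"
  using assms by (auto intro!: simple_bochner_integrable.intros simp: finite_measure.emeasure_finite)

text \<open>The function is written as \<open>c \<circ> g\<close>, where \<open>g\<close> can have values in any type, so that \<open>g\<close> can be the
map from a point to its block of a partition.\<close>

lemma simple_integral_on_set:
  assumes \<mu>: "finite_measure \<mu>" and g: "simple_function \<mu> g" and E: "E \<in> sets \<mu>"
  shows "sb_integral \<mu> (\<lambda>\<omega>. indicator E \<omega> *\<^sub>R c (g \<omega>)) =
     step_charge \<mu> (g ` space \<mu>) (\<lambda>y. {\<omega>\<in>space \<mu>. g \<omega> = y}) c E"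
proof -
  note l = simple_function_level_sets[OF g]
  define p where "p = (\<lambda>\<omega>. (indicator E \<omega> :: real, g \<omega>))"
  define v where "v = (\<lambda>(r::real, y). r *\<^sub>R c y)"
  have p: "simple_function \<mu> p" unfolding p_def using E g by simp
  have s: "simple_function \<mu> (\<lambda>\<omega>. indicator E \<omega> *\<^sub>R c (g \<omega>))"
    using simple_function_compose1[OF p, of v] by (simp add: p_def v_def)
  have "sb_integral \<mu> (\<lambda>\<omega>. indicator E \<omega> *\<^sub>R c (g \<omega>)) =
      (\<Sum>z\<in>p ` space \<mu>. measure \<mu> {\<omega>\<in>space \<mu>. p \<omega> = z} *\<^sub>R v z)"
    by (rule simple_bochner_integral_partition[OF simple_bochner_integrable_finite_measure[OF \<mu> s] p])
      (auto simp: p_def v_def)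
  also have "\<dots> = (\<Sum>z\<in>{0,1} \<times> g ` space \<mu>. measure \<mu> {\<omega>\<in>space \<mu>. p \<omega> = z} *\<^sub>R v z)"
  proof (rule sum.mono_neutral_left)
    show "finite ({0,1::real} \<times> g ` space \<mu>)" using l by simp
    show "p ` space \<mu> \<subseteq> {0,1} \<times> g ` space \<mu>" by (auto simp: p_def indicator_def)
    show "\<forall>i\<in>{0,1} \<times> g ` space \<mu> - p ` space \<mu>. measure \<mu> {\<omega>\<in>space \<mu>. p \<omega> = i} *\<^sub>R v i = 0"
    proof
      fix i assume "i \<in> {0,1} \<times> g ` space \<mu> - p ` space \<mu>"
      then have "{\<omega>\<in>space \<mu>. p \<omega> = i} = {}" by blast
      then show "measure \<mu> {\<omega>\<in>space \<mu>. p \<omega> = i} *\<^sub>R v i = 0" by (simp only: measure_empty scaleR_zero_left)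
    qed
  qed
  also have "\<dots> = (\<Sum>r\<in>{0,1}. \<Sum>y\<in>g ` space \<mu>. measure \<mu> {\<omega>\<in>space \<mu>. p \<omega> = (r,y)} *\<^sub>R v (r,y))"
    by (simp only: sum.cartesian_product split_def prod.collapse)
  also have "\<dots> = (\<Sum>y\<in>g ` space \<mu>. measure \<mu> {\<omega>\<in>space \<mu>. p \<omega> = (1,y)} *\<^sub>R c y)"
    by (simp add: v_def)
  also have "\<dots> = step_charge \<mu> (g ` space \<mu>) (\<lambda>y. {\<omega>\<in>space \<mu>. g \<omega> = y}) c E"
    unfolding step_charge_def
  proof (rule sum.cong[OF refl])
    fix y
    have "{\<omega>\<in>space \<mu>. p \<omega> = (1,y)} = {\<omega>\<in>space \<mu>. g \<omega> = y} \<inter> E"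
      by (auto simp: p_def indicator_def)
    then show "measure \<mu> {\<omega>\<in>space \<mu>. p \<omega> = (1,y)} *\<^sub>R c y = measure \<mu> ({\<omega>\<in>space \<mu>. g \<omega> = y} \<inter> E) *\<^sub>R c y"
      by simp
  qed
  finally show ?thesis .
qed

lemma simple_function_indicator_scaleR:
  assumes "E \<in> sets \<mu>" "simple_function \<mu> s"
  shows "simple_function \<mu> (\<lambda>\<omega>. indicator E \<omega> *\<^sub>R s \<omega>)"
  by (rule simple_function_compose2[of _ "indicator E :: _ \<Rightarrow> real" _ "\<lambda>r x. r *\<^sub>R x"]) (use assms in auto)

lemma simple_function_norm_diff:
  assumes "simple_function \<mu> s" "simple_function \<mu> t"
  shows "simple_function \<mu> (\<lambda>\<omega>. norm (s \<omega> - t \<omega>))"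
  using assms by (rule simple_function_compose2)

lemma simple_integral_dist:
  assumes \<mu>: "finite_measure \<mu>" and s: "simple_function \<mu> s" and t: "simple_function \<mu> t"
  shows "ennreal (norm (sb_integral \<mu> s - sb_integral \<mu> t))
    \<le> (\<integral>\<^sup>+\<omega>. ennreal (norm (s \<omega> - t \<omega>)) \<partial>\<mu>)"
proof -
  note i = simple_bochner_integrable_finite_measure[OF \<mu>]
  have d: "simple_function \<mu> (\<lambda>\<omega>. s \<omega> - t \<omega>)" using s t by (rule simple_function_compose2)
  have "sb_integral \<mu> s - sb_integral \<mu> t = sb_integral \<mu> (\<lambda>\<omega>. s \<omega> - t \<omega>)"
    using simple_bochner_integral_diff[OF i[OF s] i[OF t]] by simp
  then have "norm (sb_integral \<mu> s - sb_integral \<mu> t)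
      \<le> sb_integral \<mu> (\<lambda>\<omega>. norm (s \<omega> - t \<omega>))"
    using simple_bochner_integral_norm_bound[OF i[OF d]] by simp
  then have "ennreal (norm (sb_integral \<mu> s - sb_integral \<mu> t))
      \<le> ennreal (sb_integral \<mu> (\<lambda>\<omega>. norm (s \<omega> - t \<omega>)))" by (rule ennreal_leI)
  also have "\<dots> = (\<integral>\<^sup>+\<omega>. ennreal (norm (s \<omega> - t \<omega>)) \<partial>\<mu>)"
    by (rule simple_bochner_integral_eq_nn_integral[OF i[OF simple_function_norm_diff[OF s t]]]) simp
  finally show ?thesis .
qed

text \<open>The \<open>L\<^sup>1\<close> norm of a simple function is the variation of its indefinite integral over any partition on
whose blocks the function is constant.\<close>

lemma nn_integral_norm_simple:
  assumes \<mu>: "finite_measure \<mu>" and s: "simple_function \<mu> s"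
    and p: "simple_function \<mu> p" and sub: "\<And>\<omega>. \<omega> \<in> space \<mu> \<Longrightarrow> s \<omega> = v (p \<omega>)"
  shows "(\<integral>\<^sup>+\<omega>. ennreal (norm (s \<omega>)) \<partial>\<mu>) =
    ennreal (\<Sum>D\<in>(\<lambda>y. {\<omega>\<in>space \<mu>. p \<omega> = y}) ` (p ` space \<mu>).
      norm (sb_integral \<mu> (\<lambda>\<omega>. indicator D \<omega> *\<^sub>R s \<omega>)))"
proof -
  note i = simple_bochner_integrable_finite_measure[OF \<mu>]
  note l = level_sets_partition[OF p] and ls = simple_function_level_sets[OF p]
  have n: "simple_function \<mu> (\<lambda>\<omega>. norm (s \<omega>))" using s by (rule simple_function_compose1)
  have "sb_integral \<mu> (\<lambda>\<omega>. norm (s \<omega>)) =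
      (\<Sum>y\<in>p ` space \<mu>. measure \<mu> {\<omega>\<in>space \<mu>. p \<omega> = y} *\<^sub>R norm (v y))"
    by (rule simple_bochner_integral_partition[OF i[OF n] p]) (auto simp: sub)
  also have "\<dots> = (\<Sum>y\<in>p ` space \<mu>. norm (sb_integral \<mu>
       (\<lambda>\<omega>. indicator {\<omega>\<in>space \<mu>. p \<omega> = y} \<omega> *\<^sub>R s \<omega>)))"
  proof (rule sum.cong[OF refl])
    fix y assume y: "y \<in> p ` space \<mu>"
    let ?D = "{\<omega>\<in>space \<mu>. p \<omega> = y}"
    have "sb_integral \<mu> (\<lambda>\<omega>. indicator ?D \<omega> *\<^sub>R s \<omega>) =
        (\<Sum>z\<in>p ` space \<mu>. measure \<mu> {\<omega>\<in>space \<mu>. p \<omega> = z} *\<^sub>R (if z = y then v z else 0))"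
      by (rule simple_bochner_integral_partition[OF i[OF simple_function_indicator_scaleR[OF ls(2) s]] p])
        (auto simp: sub indicator_def)
    also have "\<dots> = (\<Sum>z\<in>p ` space \<mu>. if z = y then measure \<mu> {\<omega>\<in>space \<mu>. p \<omega> = y} *\<^sub>R v y else 0)"
      by (rule sum.cong) auto
    also have "\<dots> = measure \<mu> ?D *\<^sub>R v y" using y ls(1) by simp
    finally show "measure \<mu> ?D *\<^sub>R norm (v y) =
      norm (sb_integral \<mu> (\<lambda>\<omega>. indicator ?D \<omega> *\<^sub>R s \<omega>))" by simp
  qed
  also have "\<dots> = (\<Sum>D\<in>(\<lambda>y. {\<omega>\<in>space \<mu>. p \<omega> = y}) ` (p ` space \<mu>).
      norm (sb_integral \<mu> (\<lambda>\<omega>. indicator D \<omega> *\<^sub>R s \<omega>)))"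
    by (simp add: sum.reindex[OF l(2)])
  finally have "ennreal (sb_integral \<mu> (\<lambda>\<omega>. norm (s \<omega>))) = ennreal \<dots>" by simp
  then show ?thesis
    using simple_bochner_integral_eq_nn_integral[OF i[OF n]] by simp
qed

text \<open>A strongly measurable function is a limit of simple functions only almost everywhere, so the norm below
need not be measurable, and \<open>nn_integral\<close>, a supremum over simple functions from below, is not
subadditive on nonmeasurable functions. The measurable function \<open>u\<close> restores the triangle inequality.\<close>

lemma strongly_measurable_norm_diff:
  assumes f: "strongly_measurable \<mu> f" and s: "simple_function \<mu> s"
  obtains u where "u \<in> borel_measurable \<mu>" "AE \<omega> in \<mu>. ennreal (norm (f \<omega> - s \<omega>)) = u \<omega>"
proof -
  obtain t where t: "\<And>n::nat. simple_function \<mu> (t n)" "AE \<omega> in \<mu>. (\<lambda>n. t n \<omega>) \<longlonglongrightarrow> f \<omega>"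
    using f by (auto simp: strongly_measurable_def)
  define u where "u = (\<lambda>\<omega>. limsup (\<lambda>n. ennreal (norm (t n \<omega> - s \<omega>))))"
  show ?thesis
  proof (rule that)
    show "u \<in> borel_measurable \<mu>"
      unfolding u_def
      by (intro borel_measurable_limsup borel_measurable_simple_function simple_function_ennreal
          simple_function_norm_diff t s)
    from t(2) show "AE \<omega> in \<mu>. ennreal (norm (f \<omega> - s \<omega>)) = u \<omega>"
    proof eventually_elim
      case (elim \<omega>)
      then have "(\<lambda>n. ennreal (norm (t n \<omega> - s \<omega>))) \<longlonglongrightarrow> ennreal (norm (f \<omega> - s \<omega>))"
        by (intro tendsto_ennrealI tendsto_intros)
      from lim_imp_Limsup[OF sequentially_bot this] show ?case by (simp only: u_def)
    qed
  qed
qed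

lemma nn_integral_triangle_strong:
  assumes f: "strongly_measurable \<mu> f" and s: "simple_function \<mu> s" and t: "simple_function \<mu> t"
  shows "(\<integral>\<^sup>+\<omega>. ennreal (norm (s \<omega> - t \<omega>)) \<partial>\<mu>)
     \<le> (\<integral>\<^sup>+\<omega>. ennreal (norm (f \<omega> - s \<omega>)) \<partial>\<mu>) + (\<integral>\<^sup>+\<omega>. ennreal (norm (f \<omega> - t \<omega>)) \<partial>\<mu>)"
proof -
  obtain u where u: "u \<in> borel_measurable \<mu>" "AE \<omega> in \<mu>. ennreal (norm (f \<omega> - s \<omega>)) = u \<omega>"
    using strongly_measurable_norm_diff[OF f s] .
  obtain v where v: "v \<in> borel_measurable \<mu>" "AE \<omega> in \<mu>. ennreal (norm (f \<omega> - t \<omega>)) = v \<omega>"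
    using strongly_measurable_norm_diff[OF f t] .
  have "(\<integral>\<^sup>+\<omega>. ennreal (norm (s \<omega> - t \<omega>)) \<partial>\<mu>) \<le> (\<integral>\<^sup>+\<omega>. u \<omega> + v \<omega> \<partial>\<mu>)"
  proof (rule nn_integral_mono_AE)
    from u(2) v(2) show "AE \<omega> in \<mu>. ennreal (norm (s \<omega> - t \<omega>)) \<le> u \<omega> + v \<omega>"
    proof eventually_elim
      case (elim \<omega>)
      have "norm (s \<omega> - t \<omega>) \<le> norm (f \<omega> - s \<omega>) + norm (f \<omega> - t \<omega>)"
        using norm_triangle_ineq4[of "f \<omega> - t \<omega>" "f \<omega> - s \<omega>"] by simp
      then show ?case using elim by (metis ennreal_leI ennreal_plus norm_ge_zero)
    qed
  qed
  also have "\<dots> = (\<integral>\<^sup>+\<omega>. u \<omega> \<partial>\<mu>) + (\<integral>\<^sup>+\<omega>. v \<omega> \<partial>\<mu>)" using u(1) v(1) by (rule nn_integral_add)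
  also have "\<dots> = (\<integral>\<^sup>+\<omega>. ennreal (norm (f \<omega> - s \<omega>)) \<partial>\<mu>) + (\<integral>\<^sup>+\<omega>. ennreal (norm (f \<omega> - t \<omega>)) \<partial>\<mu>)"
    using nn_integral_cong_AE[OF u(2)] nn_integral_cong_AE[OF v(2)] by simp
  finally show ?thesis .
qed

lemma strong_integral_approximation:
  assumes \<mu>: "finite_measure \<mu>" and I: "has_strong_integral \<mu> f I" and t: "simple_function \<mu> t"
  shows "ennreal (norm (I - sb_integral \<mu> t)) \<le> (\<integral>\<^sup>+\<omega>. ennreal (norm (f \<omega> - t \<omega>)) \<partial>\<mu>)"
proof -
  obtain s where f: "strongly_measurable \<mu> f" and s: "\<And>n::nat. sb_integrable \<mu> (s n)"
    "(\<lambda>n. \<integral>\<^sup>+\<omega>. ennreal (norm (f \<omega> - s n \<omega>)) \<partial>\<mu>) \<longlonglongrightarrow> 0"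
    "(\<lambda>n. sb_integral \<mu> (s n)) \<longlonglongrightarrow> I"
    using I by (auto simp: has_strong_integral_def)
  have sf: "simple_function \<mu> (s n)" for n using s(1)[of n] by (auto elim: simple_bochner_integrable.cases)
  let ?c = "\<integral>\<^sup>+\<omega>. ennreal (norm (f \<omega> - t \<omega>)) \<partial>\<mu>"
  have "(\<lambda>n. (\<integral>\<^sup>+\<omega>. ennreal (norm (f \<omega> - s n \<omega>)) \<partial>\<mu>) + ?c) \<longlonglongrightarrow> 0 + ?c"
    by (intro tendsto_add s(2) tendsto_const)
  moreover have "(\<lambda>n. ennreal (norm (sb_integral \<mu> (s n) - sb_integral \<mu> t)))
      \<longlonglongrightarrow> ennreal (norm (I - sb_integral \<mu> t))"
    by (intro tendsto_ennrealI tendsto_intros s(3))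
  moreover have "ennreal (norm (sb_integral \<mu> (s n) - sb_integral \<mu> t)) \<le>
      (\<integral>\<^sup>+\<omega>. ennreal (norm (f \<omega> - s n \<omega>)) \<partial>\<mu>) + ?c" for n
    using simple_integral_dist[OF \<mu> sf t] nn_integral_triangle_strong[OF f sf t] order_trans by blast
  ultimately have "ennreal (norm (I - sb_integral \<mu> t)) \<le> 0 + ?c"
    by (intro LIMSEQ_le[of "\<lambda>n. ennreal (norm (sb_integral \<mu> (s n) - sb_integral \<mu> t))"]) auto
  then show ?thesis by simp
qed

lemma strong_integral_unique:
  assumes \<mu>: "finite_measure \<mu>" and I: "has_strong_integral \<mu> f I" and J: "has_strong_integral \<mu> f J"
  shows "I = J"
proof -
  obtain s where s: "\<And>n::nat. sb_integrable \<mu> (s n)"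
    "(\<lambda>n. \<integral>\<^sup>+\<omega>. ennreal (norm (f \<omega> - s n \<omega>)) \<partial>\<mu>) \<longlonglongrightarrow> 0"
    "(\<lambda>n. sb_integral \<mu> (s n)) \<longlonglongrightarrow> I"
    using I by (auto simp: has_strong_integral_def)
  have "(\<lambda>n. ennreal (norm (J - sb_integral \<mu> (s n)))) \<longlonglongrightarrow> 0"
  proof (rule tendsto_sandwich[OF _ _ tendsto_const s(2)])
    show "\<forall>\<^sub>F n in sequentially. ennreal (norm (J - sb_integral \<mu> (s n)))
        \<le> (\<integral>\<^sup>+\<omega>. ennreal (norm (f \<omega> - s n \<omega>)) \<partial>\<mu>)"
      using strong_integral_approximation[OF \<mu> J] s(1)
      by (auto elim: simple_bochner_integrable.cases intro!: always_eventually)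
  qed auto
  moreover have "(\<lambda>n. ennreal (norm (J - sb_integral \<mu> (s n)))) \<longlonglongrightarrow> ennreal (norm (J - I))"
    by (intro tendsto_ennrealI tendsto_intros s(3))
  ultimately have "ennreal (norm (J - I)) = 0" using LIMSEQ_unique by blast
  then show ?thesis by simp
qed

section \<open>Densities and approximability\<close>

lemma strong_density_approximable:
  assumes \<mu>: "finite_measure \<mu>" and g: "has_strong_integral \<mu> g I"
    and G: "\<And>E. E \<in> sets \<mu> \<Longrightarrow> has_strong_integral \<mu> (\<lambda>\<omega>. indicator E \<omega> *\<^sub>R g \<omega>) (G E)"
  shows "density_approximable \<mu> G"
  unfolding density_approximable_def
proof (intro allI impI)
  fix \<epsilon> :: real assume "\<epsilon> > 0"
  let ?d = "\<lambda>s. \<integral>\<^sup>+\<omega>. ennreal (norm (g \<omega> - s \<omega>)) \<partial>\<mu>"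
  obtain s where gm: "strongly_measurable \<mu> g" and s: "\<And>n::nat. sb_integrable \<mu> (s n)"
    "(\<lambda>n. ?d (s n)) \<longlonglongrightarrow> 0"
    using g by (auto simp: has_strong_integral_def)
  have "\<forall>\<^sub>F n in sequentially. ?d (s n) < ennreal (\<epsilon>/2)"
    using s(2) \<open>\<epsilon> > 0\<close> by (intro order_tendstoD) auto
  then obtain n where n: "?d (s n) < ennreal (\<epsilon>/2)"
    by (auto dest: eventually_happens)
  define t where "t = s n"
  have t: "simple_function \<mu> t" using s(1)[of n] by (auto simp: t_def elim: simple_bochner_integrable.cases)
  note l = simple_function_level_sets[OF t]
  let ?S = "\<lambda>y. {\<omega>\<in>space \<mu>. t \<omega> = y}"
  define h where "h = step_charge \<mu> (t ` space \<mu>) ?S (\<lambda>y. y)"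
  define \<pi> where "\<pi> = ?S ` (t ` space \<mu>)"
  have \<pi>: "\<pi> \<in> finite_partitions (space \<mu>) (sets \<mu>)"
    unfolding \<pi>_def using level_sets_partition[OF t] by blast
  obtain u where u: "u \<in> borel_measurable \<mu>" "AE \<omega> in \<mu>. ennreal (norm (g \<omega> - t \<omega>)) = u \<omega>"
    using strongly_measurable_norm_diff[OF gm t] .
  have ud: "(\<integral>\<^sup>+\<omega>. u \<omega> \<partial>\<mu>) < ennreal (\<epsilon>/2)"
    using n nn_integral_cong_AE[OF u(2)] by (simp add: t_def)
  have near: "(\<Sum>B\<in>\<tau>. norm (G B - h B)) \<le> \<epsilon> / 2"
    if \<tau>: "\<tau> \<in> finite_partitions (space \<mu>) (sets \<mu>)" for \<tau>
  proof -
    note p = finite_partitionsD[OF \<tau>]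
    have "ennreal (norm (G B - h B)) \<le> (\<integral>\<^sup>+\<omega>. indicator B \<omega> * u \<omega> \<partial>\<mu>)" if "B \<in> \<tau>" for B
    proof -
      have B: "B \<in> sets \<mu>" using that p by auto
      have "h B = sb_integral \<mu> (\<lambda>\<omega>. indicator B \<omega> *\<^sub>R t \<omega>)"
        unfolding h_def using simple_integral_on_set[OF \<mu> t B, of "\<lambda>y. y"] by simp
      then have "ennreal (norm (G B - h B)) \<le>
          (\<integral>\<^sup>+\<omega>. ennreal (norm (indicator B \<omega> *\<^sub>R g \<omega> - indicator B \<omega> *\<^sub>R t \<omega>)) \<partial>\<mu>)"
        using strong_integral_approximation[OF \<mu> G[OF B] simple_function_indicator_scaleR[OF B t]] by simp
      also have "\<dots> = (\<integral>\<^sup>+\<omega>. indicator B \<omega> * u \<omega> \<partial>\<mu>)"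
      proof (rule nn_integral_cong_AE)
        from u(2) show "AE \<omega> in \<mu>. ennreal (norm (indicator B \<omega> *\<^sub>R g \<omega> - indicator B \<omega> *\<^sub>R t \<omega>)) = indicator B \<omega> * u \<omega>"
          by eventually_elim (auto simp: indicator_def)
      qed
      finally show ?thesis .
    qed
    then have "(\<Sum>B\<in>\<tau>. ennreal (norm (G B - h B))) \<le> (\<Sum>B\<in>\<tau>. \<integral>\<^sup>+\<omega>. indicator B \<omega> * u \<omega> \<partial>\<mu>)"
      by (rule sum_mono)
    also have "\<dots> = (\<integral>\<^sup>+\<omega>. (\<Sum>B\<in>\<tau>. indicator B \<omega> * u \<omega>) \<partial>\<mu>)"
      by (rule nn_integral_sum[symmetric]) (use u(1) p in auto)
    also have "\<dots> = (\<integral>\<^sup>+\<omega>. u \<omega> \<partial>\<mu>)"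
    proof (rule nn_integral_cong)
      fix \<omega> assume "\<omega> \<in> space \<mu>"
      then obtain B where B: "B \<in> \<tau>" "\<omega> \<in> B" using p(3) by auto
      have "(\<Sum>C\<in>\<tau>. indicator C \<omega> * u \<omega>) = (\<Sum>C\<in>\<tau>. if C = B then u \<omega> else 0)"
        by (rule sum.cong) (use B p(4) in \<open>auto simp: indicator_def dest: disjointD\<close>)
      then show "(\<Sum>C\<in>\<tau>. indicator C \<omega> * u \<omega>) = u \<omega>" using B p(1) by simp
    qed
    finally have "ennreal (\<Sum>B\<in>\<tau>. norm (G B - h B)) < ennreal (\<epsilon>/2)"
      using ud by simp
    then show ?thesis by (simp add: ennreal_less_iff sum_nonneg)
  qed
  show "\<exists>\<pi>\<in>finite_partitions (space \<mu>) (sets \<mu>). \<forall>\<tau>\<in>finite_partitions (space \<mu>) (sets \<mu>).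
        (\<Sum>B\<in>\<tau>. norm (G B - cond_charge \<mu> \<pi> G B)) \<le> \<epsilon>"
  proof (intro bexI[OF _ \<pi>] ballI)
    fix \<tau> assume \<tau>: "\<tau> \<in> finite_partitions (space \<mu>) (sets \<mu>)"
    have "(\<Sum>B\<in>\<tau>. norm (G B - cond_charge \<mu> \<pi> G B))
      \<le> (\<Sum>B\<in>\<tau>. norm (G B - h B)) + (\<Sum>A\<in>\<pi>. norm (G A - h A))"
      unfolding h_def
      by (rule averaging_error[OF \<mu> \<pi> \<tau>]) (use l(2) in \<open>auto simp: \<pi>_def\<close>)
    then show "(\<Sum>B\<in>\<tau>. norm (G B - cond_charge \<mu> \<pi> G B)) \<le> \<epsilon>"
      using near[OF \<tau>] near[OF \<pi>] by simp
  qed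
qed

text \<open>The block that contains a point; outside of the union of \<open>\<pi>\<close> the value is unspecified.\<close>

definition block :: "'w set set \<Rightarrow> 'w \<Rightarrow> 'w set" where
  "block \<pi> \<omega> = (THE A. A \<in> \<pi> \<and> \<omega> \<in> A)"

lemma block_eq:
  assumes "\<pi> \<in> finite_partitions \<Omega> \<Sigma>" "A \<in> \<pi>" "\<omega> \<in> A"
  shows "block \<pi> \<omega> = A"
  unfolding block_def
  using assms disjointD[OF finite_partitionsD(4)[OF assms(1)]] by (intro the_equality) auto

lemma block_in:
  assumes \<pi>: "\<pi> \<in> finite_partitions \<Omega> \<Sigma>" and \<omega>: "\<omega> \<in> \<Omega>"
  shows "block \<pi> \<omega> \<in> \<pi>" "\<omega> \<in> block \<pi> \<omega>"
proof -
  obtain A where "A \<in> \<pi>" "\<omega> \<in> A" using finite_partitionsD(3)[OF \<pi>] \<omega> by auto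
  then show "block \<pi> \<omega> \<in> \<pi>" "\<omega> \<in> block \<pi> \<omega>" using block_eq[OF \<pi>] by auto
qed

lemma block_level_set:
  assumes \<pi>: "\<pi> \<in> finite_partitions \<Omega> \<Sigma>" and "A \<in> \<pi>"
  shows "{\<omega>\<in>\<Omega>. block \<pi> \<omega> = A} = A"
  using block_eq[OF \<pi>] block_in[OF \<pi>] finite_partitionsD(3)[OF \<pi>] assms(2) by auto

lemma block_image:
  assumes \<pi>: "\<pi> \<in> finite_partitions \<Omega> \<Sigma>"
  shows "block \<pi> ` \<Omega> = \<pi>"
proof
  show "block \<pi> ` \<Omega> \<subseteq> \<pi>" using block_in[OF \<pi>] by auto
  show "\<pi> \<subseteq> block \<pi> ` \<Omega>"
  proof
    fix A assume "A \<in> \<pi>"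
    then have "A \<noteq> {}" "A \<subseteq> \<Omega>" using finite_partitionsD(3,5)[OF \<pi>] by auto
    then obtain \<omega> where "\<omega> \<in> A" "\<omega> \<in> \<Omega>" by auto
    then show "A \<in> block \<pi> ` \<Omega>" using block_eq[OF \<pi> \<open>A \<in> \<pi>\<close>] by force
  qed
qed

lemma simple_function_block:
  assumes \<pi>: "\<pi> \<in> finite_partitions (space \<mu>) (sets \<mu>)"
  shows "simple_function \<mu> (block \<pi>)"
  unfolding simple_function_def block_image[OF \<pi>]
proof (intro conjI ballI)
  show "finite \<pi>" using finite_partitionsD(1)[OF \<pi>] .
  fix A assume "A \<in> \<pi>"
  moreover have "block \<pi> -` {A} \<inter> space \<mu> = {\<omega>\<in>space \<mu>. block \<pi> \<omega> = A}" by auto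
  ultimately show "block \<pi> -` {A} \<inter> space \<mu> \<in> sets \<mu>"
    using block_level_set[OF \<pi>] finite_partitionsD(2)[OF \<pi>] by auto
qed

text \<open>The step density whose indefinite integral is the averaged charge.\<close>

definition cond_density :: "'w measure \<Rightarrow> 'w set set \<Rightarrow> ('w set \<Rightarrow> 'b::real_normed_vector) \<Rightarrow> 'w \<Rightarrow> 'b" where
  "cond_density \<mu> \<pi> G \<omega> = G (block \<pi> \<omega>) /\<^sub>R measure \<mu> (block \<pi> \<omega>)"

lemma simple_integral_cond_density:
  assumes \<mu>: "finite_measure \<mu>" and \<pi>: "\<pi> \<in> finite_partitions (space \<mu>) (sets \<mu>)" and E: "E \<in> sets \<mu>"
  shows "sb_integral \<mu> (\<lambda>\<omega>. indicator E \<omega> *\<^sub>R cond_density \<mu> \<pi> G \<omega>) =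
    cond_charge \<mu> \<pi> G E"
proof -
  have "sb_integral \<mu> (\<lambda>\<omega>. indicator E \<omega> *\<^sub>R cond_density \<mu> \<pi> G \<omega>) =
      step_charge \<mu> \<pi> (\<lambda>A. {\<omega>\<in>space \<mu>. block \<pi> \<omega> = A}) (\<lambda>A. G A /\<^sub>R measure \<mu> A) E"
    using simple_integral_on_set[OF \<mu> simple_function_block[OF \<pi>] E, of "\<lambda>A. G A /\<^sub>R measure \<mu> A"]
    by (simp only: cond_density_def block_image[OF \<pi>])
  then show ?thesis
    unfolding cond_charge_eq_step_charge step_charge_def
    by (simp add: block_level_set[OF \<pi>] cong: sum.cong)
qed

lemma simple_function_cond_density:
  "\<pi> \<in> finite_partitions (space \<mu>) (sets \<mu>) \<Longrightarrow> simple_function \<mu> (cond_density \<mu> \<pi> G)"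
  unfolding cond_density_def by (rule simple_function_compose1[OF simple_function_block])

text \<open>On the common refinement both densities are constant, so their \<open>L\<^sup>1\<close> distance is the variation
of the difference of the two averages there, and \<open>G\<close> is within \<open>a\<close> and \<open>b\<close> of them.\<close>

lemma cond_density_L1_distance:
  assumes \<mu>: "finite_measure \<mu>"
    and \<pi>: "\<pi> \<in> finite_partitions (space \<mu>) (sets \<mu>)" and \<rho>: "\<rho> \<in> finite_partitions (space \<mu>) (sets \<mu>)"
    and a: "\<And>\<tau>. \<tau> \<in> finite_partitions (space \<mu>) (sets \<mu>) \<Longrightarrow> (\<Sum>B\<in>\<tau>. norm (G B - cond_charge \<mu> \<pi> G B)) \<le> a"
    and b: "\<And>\<tau>. \<tau> \<in> finite_partitions (space \<mu>) (sets \<mu>) \<Longrightarrow> (\<Sum>B\<in>\<tau>. norm (G B - cond_charge \<mu> \<rho> G B)) \<le> b"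
  shows "(\<integral>\<^sup>+\<omega>. ennreal (norm (cond_density \<mu> \<pi> G \<omega> - cond_density \<mu> \<rho> G \<omega>)) \<partial>\<mu>) \<le> ennreal (a + b)"
proof -
  note i = simple_bochner_integrable_finite_measure[OF \<mu>]
  let ?p = "\<lambda>\<omega>. (block \<pi> \<omega>, block \<rho> \<omega>)"
  let ?s = "\<lambda>\<omega>. cond_density \<mu> \<pi> G \<omega> - cond_density \<mu> \<rho> G \<omega>"
  let ?v = "\<lambda>(A, B). G A /\<^sub>R measure \<mu> A - G B /\<^sub>R measure \<mu> B"
  have p: "simple_function \<mu> ?p" by (intro simple_function_Pair simple_function_block \<pi> \<rho>)
  have s: "simple_function \<mu> ?s"
    by (intro simple_function_compose2[of _ _ _ "(-)"] simple_function_cond_density \<pi> \<rho>)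
  define \<tau> where "\<tau> = (\<lambda>y. {\<omega>\<in>space \<mu>. ?p \<omega> = y}) ` (?p ` space \<mu>)"
  have \<tau>: "\<tau> \<in> finite_partitions (space \<mu>) (sets \<mu>)"
    unfolding \<tau>_def by (rule level_sets_partition[OF p])
  have "(\<integral>\<^sup>+\<omega>. ennreal (norm (?s \<omega>)) \<partial>\<mu>) =
      ennreal (\<Sum>D\<in>\<tau>. norm (sb_integral \<mu> (\<lambda>\<omega>. indicator D \<omega> *\<^sub>R ?s \<omega>)))"
    unfolding \<tau>_def by (rule nn_integral_norm_simple[OF \<mu> s p, of ?v]) (simp add: cond_density_def)
  also have "\<dots> \<le> ennreal (a + b)"
  proof (rule ennreal_leI)
    have "(\<Sum>D\<in>\<tau>. norm (sb_integral \<mu> (\<lambda>\<omega>. indicator D \<omega> *\<^sub>R ?s \<omega>)))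
      \<le> (\<Sum>D\<in>\<tau>. norm (G D - cond_charge \<mu> \<pi> G D) + norm (G D - cond_charge \<mu> \<rho> G D))"
    proof (rule sum_mono)
      fix D assume "D \<in> \<tau>"
      then have D: "D \<in> sets \<mu>" using finite_partitionsD[OF \<tau>] by auto
      have "sb_integral \<mu> (\<lambda>\<omega>. indicator D \<omega> *\<^sub>R ?s \<omega>) =
        sb_integral \<mu> (\<lambda>\<omega>. indicator D \<omega> *\<^sub>R cond_density \<mu> \<pi> G \<omega> - indicator D \<omega> *\<^sub>R cond_density \<mu> \<rho> G \<omega>)"
        by (simp add: scaleR_diff_right)
      also have "\<dots> = cond_charge \<mu> \<pi> G D - cond_charge \<mu> \<rho> G D"
        by (subst simple_bochner_integral_diff)
          (auto intro!: i simple_function_indicator_scaleR D simple_function_cond_density \<pi> \<rho>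
            simp: simple_integral_cond_density[OF \<mu> \<pi> D] simple_integral_cond_density[OF \<mu> \<rho> D])
      finally show "norm (sb_integral \<mu> (\<lambda>\<omega>. indicator D \<omega> *\<^sub>R ?s \<omega>))
         \<le> norm (G D - cond_charge \<mu> \<pi> G D) + norm (G D - cond_charge \<mu> \<rho> G D)"
        using norm_triangle_ineq4[of "G D - cond_charge \<mu> \<rho> G D" "G D - cond_charge \<mu> \<pi> G D"] by simp
    qed
    then show "(\<Sum>D\<in>\<tau>. norm (sb_integral \<mu> (\<lambda>\<omega>. indicator D \<omega> *\<^sub>R ?s \<omega>))) \<le> a + b"
      using a[OF \<tau>] b[OF \<tau>] by (simp add: sum.distrib)
  qed
  finally show ?thesis .
qed

text \<open>Averages that are within \<open>(1/2)^n\<close> of \<open>G\<close> have densities with summable \<open>L\<^sup>1\<close> distances. They converge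
almost everywhere by monotone convergence, and in \<open>L\<^sup>1\<close> by Fatou's lemma.\<close>

lemma approximable_has_strong_density:
  fixes G :: "'w set \<Rightarrow> 'b::banach"
  assumes \<mu>: "finite_measure \<mu>" and G: "additive (sets \<mu>) G" and approx: "density_approximable \<mu> G"
  shows "\<exists>g. (\<exists>I. has_strong_integral \<mu> g I) \<and>
             (\<forall>E\<in>sets \<mu>. has_strong_integral \<mu> (\<lambda>\<omega>. indicator E \<omega> *\<^sub>R g \<omega>) (G E))"
proof -
  let ?P = "finite_partitions (space \<mu>) (sets \<mu>)"
  have "\<forall>n. \<exists>\<pi>\<in>?P. \<forall>\<tau>\<in>?P. (\<Sum>B\<in>\<tau>. norm (G B - cond_charge \<mu> \<pi> G B)) \<le> (1/2)^n"
    using approx unfolding density_approximable_def by auto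
  then obtain \<pi> where \<pi>: "\<And>n. \<pi> n \<in> ?P"
    and var: "\<And>n \<tau>. \<tau> \<in> ?P \<Longrightarrow> (\<Sum>B\<in>\<tau>. norm (G B - cond_charge \<mu> (\<pi> n) G B)) \<le> (1/2)^n"
    by metis
  define s where "s n = cond_density \<mu> (\<pi> n) G" for n
  have s: "simple_function \<mu> (s n)" for n unfolding s_def by (rule simple_function_cond_density[OF \<pi>])
  have dist: "(\<integral>\<^sup>+\<omega>. ennreal (norm (s n \<omega> - s k \<omega>)) \<partial>\<mu>) \<le> ennreal ((1/2)^n + (1/2)^k)" for n k
    unfolding s_def by (rule cond_density_L1_distance[OF \<mu> \<pi> \<pi> var var])
  have meas: "(\<lambda>\<omega>. ennreal (norm (s n \<omega> - s k \<omega>))) \<in> borel_measurable \<mu>" for n k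
    by (intro borel_measurable_simple_function simple_function_ennreal simple_function_norm_diff s)
  define g where "g \<omega> = lim (\<lambda>n. s n \<omega>)" for \<omega>
  have conv: "AE \<omega> in \<mu>. (\<lambda>n. s n \<omega>) \<longlonglongrightarrow> g \<omega>"
  proof -
    have "(\<integral>\<^sup>+\<omega>. (\<Sum>n. ennreal (norm (s (Suc n) \<omega> - s n \<omega>))) \<partial>\<mu>) =
        (\<Sum>n. \<integral>\<^sup>+\<omega>. ennreal (norm (s (Suc n) \<omega> - s n \<omega>)) \<partial>\<mu>)"
      by (rule nn_integral_suminf) (rule meas)
    also have "\<dots> \<le> (\<Sum>n. ennreal (2 * (1/2)^n))"
      by (intro suminf_le summableI order_trans[OF dist] ennreal_leI) auto
    also have "\<dots> < \<infinity>"
      by (subst suminf_ennreal2) (auto intro!: summable_mult summable_geometric)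
    finally have "AE \<omega> in \<mu>. (\<Sum>n. ennreal (norm (s (Suc n) \<omega> - s n \<omega>))) \<noteq> \<infinity>"
      by (intro nn_integral_PInf_AE borel_measurable_suminf_order meas) auto
    then show ?thesis
    proof eventually_elim
      case (elim \<omega>)
      then have "summable (\<lambda>n. norm (s (Suc n) \<omega> - s n \<omega>))"
        by (intro summable_suminf_not_top) auto
      then have "summable (\<lambda>n. s (Suc n) \<omega> - s n \<omega>)" by (rule summable_norm_cancel)
      then have "convergent (\<lambda>n. \<Sum>i<n. s (Suc i) \<omega> - s i \<omega>)" by (simp add: summable_iff_convergent)
      then have "convergent (\<lambda>n. s n \<omega> - s 0 \<omega>)" using sum_lessThan_telescope[of "\<lambda>n. s n \<omega>"] by simp
      from convergent_add[OF this convergent_const[of "s 0 \<omega>"]]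
      show ?case unfolding g_def by (simp add: convergent_LIMSEQ_iff)
    qed
  qed
  have gs: "(\<integral>\<^sup>+\<omega>. ennreal (norm (g \<omega> - s n \<omega>)) \<partial>\<mu>) \<le> ennreal (2 * (1/2)^n)" for n
  proof -
    have "(\<integral>\<^sup>+\<omega>. ennreal (norm (g \<omega> - s n \<omega>)) \<partial>\<mu>) =
        (\<integral>\<^sup>+\<omega>. liminf (\<lambda>k. ennreal (norm (s k \<omega> - s n \<omega>))) \<partial>\<mu>)"
    proof (rule nn_integral_cong_AE)
      from conv show "AE \<omega> in \<mu>. ennreal (norm (g \<omega> - s n \<omega>)) = liminf (\<lambda>k. ennreal (norm (s k \<omega> - s n \<omega>)))"
      proof eventually_elim
        case (elim \<omega>)
        then have "(\<lambda>k. ennreal (norm (s k \<omega> - s n \<omega>))) \<longlonglongrightarrow> ennreal (norm (g \<omega> - s n \<omega>))"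
          by (intro tendsto_ennrealI tendsto_intros)
        from lim_imp_Liminf[OF sequentially_bot this] show ?case by simp
      qed
    qed
    also have "\<dots> \<le> liminf (\<lambda>k. \<integral>\<^sup>+\<omega>. ennreal (norm (s k \<omega> - s n \<omega>)) \<partial>\<mu>)"
      by (rule nn_integral_liminf) (rule meas)
    also have "\<dots> \<le> liminf (\<lambda>k. ennreal (2 * (1/2)^n))"
    proof (rule Liminf_mono)
      have "(\<integral>\<^sup>+\<omega>. ennreal (norm (s k \<omega> - s n \<omega>)) \<partial>\<mu>) \<le> ennreal (2 * (1/2)^n)" if "k \<ge> n" for k
      proof -
        have "(1/2::real)^k \<le> (1/2)^n" using that by (intro power_decreasing) auto
        then show ?thesis by (intro order_trans[OF dist] ennreal_leI) simp
      qed
      then show "\<forall>\<^sub>F k in sequentially. (\<integral>\<^sup>+\<omega>. ennreal (norm (s k \<omega> - s n \<omega>)) \<partial>\<mu>) \<le> ennreal (2 * (1/2)^n)"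
        unfolding eventually_sequentially by blast
    qed
    also have "\<dots> = ennreal (2 * (1/2)^n)" by (simp add: Liminf_const)
    finally show ?thesis .
  qed
  have main: "has_strong_integral \<mu> f (G E)"
    if E: "E \<in> sets \<mu>" and f: "\<And>\<omega>. \<omega> \<in> space \<mu> \<Longrightarrow> f \<omega> = indicator E \<omega> *\<^sub>R g \<omega>" for f E
    unfolding has_strong_integral_def strongly_measurable_def
  proof (intro conjI exI allI)
    let ?t = "\<lambda>n \<omega>. indicator E \<omega> *\<^sub>R s n \<omega>"
    show "simple_function \<mu> (?t n)" for n by (rule simple_function_indicator_scaleR[OF E s])
    then show "sb_integrable \<mu> (?t n)" for n
      by (rule simple_bochner_integrable_finite_measure[OF \<mu>])
    from conv AE_space show "AE \<omega> in \<mu>. (\<lambda>n. ?t n \<omega>) \<longlonglongrightarrow> f \<omega>"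
      by eventually_elim (simp add: f tendsto_intros)
    show "(\<lambda>n. \<integral>\<^sup>+\<omega>. ennreal (norm (f \<omega> - ?t n \<omega>)) \<partial>\<mu>) \<longlonglongrightarrow> 0"
    proof (rule tendsto_sandwich[OF _ _ tendsto_const])
      have "(\<integral>\<^sup>+\<omega>. ennreal (norm (f \<omega> - ?t n \<omega>)) \<partial>\<mu>) \<le> ennreal (2 * (1/2)^n)" for n
      proof (rule order_trans[OF _ gs])
        show "(\<integral>\<^sup>+\<omega>. ennreal (norm (f \<omega> - ?t n \<omega>)) \<partial>\<mu>) \<le> (\<integral>\<^sup>+\<omega>. ennreal (norm (g \<omega> - s n \<omega>)) \<partial>\<mu>)"
          by (rule nn_integral_mono) (auto simp: f indicator_def)
      qed
      then show "\<forall>\<^sub>F n in sequentially. (\<integral>\<^sup>+\<omega>. ennreal (norm (f \<omega> - ?t n \<omega>)) \<partial>\<mu>) \<le> ennreal (2 * (1/2)^n)" by simp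
      have "(\<lambda>n. ennreal (2 * (1/2)^n)) \<longlonglongrightarrow> ennreal (2 * 0)"
        by (intro tendsto_ennrealI tendsto_mult tendsto_const LIMSEQ_realpow_zero) auto
      then show "(\<lambda>n. ennreal (2 * (1/2)^n)) \<longlonglongrightarrow> 0" by simp
    qed simp
    have "norm (G E - cond_charge \<mu> (\<pi> n) G E) \<le> (1/2)^n" for n
    proof -
      have N: "additive (sets \<mu>) (\<lambda>A. G A - cond_charge \<mu> (\<pi> n) G A)"
        by (intro additive_diff G additive_cond_charge \<mu> \<pi>)
      show ?thesis
        using variation_bound_disjoint_family[OF var additive_empty[OF N], where I="{()}" and D="\<lambda>_. E"] E
        by (auto simp: disjoint_family_on_def)
    qed
    then have "(\<lambda>n. cond_charge \<mu> (\<pi> n) G E - G E) \<longlonglongrightarrow> 0"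
      by (intro tendsto_0_le[OF LIMSEQ_realpow_zero[of "1/2"], of _ 1]) (auto simp: norm_minus_commute)
    then show "(\<lambda>n. sb_integral \<mu> (?t n)) \<longlonglongrightarrow> G E"
      unfolding s_def simple_integral_cond_density[OF \<mu> \<pi> E] by (rule LIM_zero_cancel)
  qed
  show ?thesis
  proof (intro exI conjI ballI)
    show "has_strong_integral \<mu> g (G (space \<mu>))" by (rule main) auto
    show "has_strong_integral \<mu> (\<lambda>\<omega>. indicator E \<omega> *\<^sub>R g \<omega>) (G E)" if "E \<in> sets \<mu>" for E
      by (rule main[OF that]) simp
  qed
qed

lemma radon_nikodym_property_iff_approximable:
  "radon_nikodym_property TYPE('w) TYPE('b::banach) \<longleftrightarrow>
    (\<forall>(\<mu>::'w measure) (G :: 'w set \<Rightarrow> 'b). charge_wrt \<mu> G \<longrightarrow> density_approximable \<mu> G)"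
proof (intro iffI allI impI)
  fix \<mu> :: "'w measure" and G :: "'w set \<Rightarrow> 'b"
  assume rnp: "radon_nikodym_property TYPE('w) TYPE('b)" and G: "charge_wrt \<mu> G"
  note g = charge_wrtD[OF G]
  obtain f I where "has_strong_integral \<mu> f I"
    "\<forall>E\<in>sets \<mu>. has_strong_integral \<mu> (\<lambda>\<omega>. indicator E \<omega> *\<^sub>R f \<omega>) (G E)"
    using rnp[unfolded radon_nikodym_property_def] g charge_vector_measure[OF G] by metis
  then show "density_approximable \<mu> G" using strong_density_approximable[OF g(1)] by blast
next
  assume *: "\<forall>(\<mu>::'w measure) (G :: 'w set \<Rightarrow> 'b). charge_wrt \<mu> G \<longrightarrow> density_approximable \<mu> G"
  show "radon_nikodym_property TYPE('w) TYPE('b)"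
    unfolding radon_nikodym_property_def
  proof (intro allI impI)
    fix \<mu> :: "'w measure" and G :: "'w set \<Rightarrow> 'b"
    assume a: "finite_measure \<mu> \<and> vector_measure (sets \<mu>) G \<and>
        bounded_variation (space \<mu>) (sets \<mu>) G \<and> continuous_wrt G \<mu>"
    then have G: "charge_wrt \<mu> G" using vector_measure_additive unfolding charge_wrt_def by blast
    with * have "density_approximable \<mu> G" by blast
    then show "\<exists>g. (\<exists>I. has_strong_integral \<mu> g I) \<and>
             (\<forall>E\<in>sets \<mu>. has_strong_integral \<mu> (\<lambda>\<omega>. indicator E \<omega> *\<^sub>R g \<omega>) (G E))"
      using approximable_has_strong_density charge_wrtD[OF G] by blast
  qed
qed

section \<open>Integration against operator-valued measures\<close>

lemma simple_on_iff: "simple_on (space \<mu>) (sets \<mu>) f \<longleftrightarrow> simple_function \<mu> f"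
  unfolding simple_on_def by (rule simple_function_cong_algebra) (auto simp: sets.sigma_sets_eq)

text \<open>The integral can be computed on any partition on whose blocks the function is constant. Linearity
follows with the partition into level sets of a pair of functions.\<close>

lemma simple_vm_integral_partition:
  fixes m :: "'w set \<Rightarrow> ('x::real_normed_vector \<Rightarrow>\<^sub>L real)"
  assumes m: "additive (sets \<mu>) m" and f: "simple_function \<mu> f" and p: "simple_function \<mu> p"
    and v: "\<And>\<omega>. \<omega> \<in> space \<mu> \<Longrightarrow> f \<omega> = v (p \<omega>)"
  shows "simple_vm_integral (space \<mu>) m f = (\<Sum>z\<in>p ` space \<mu>. m {\<omega>\<in>space \<mu>. p \<omega> = z} (v z))"
proof -
  let ?P = "\<lambda>z. {\<omega>\<in>space \<mu>. p \<omega> = z}" and ?F = "\<lambda>x. {\<omega>\<in>space \<mu>. f \<omega> = x}"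
  note lf = simple_function_level_sets[OF f] and lp = level_sets_partition[OF p]
  have "simple_vm_integral (space \<mu>) m f = (\<Sum>x\<in>f ` space \<mu>. \<Sum>z\<in>p ` space \<mu>. m (?P z \<inter> ?F x) x)"
    unfolding simple_vm_integral_def
  proof (rule sum.cong[OF refl])
    fix x
    have "m (?F x) = (\<Sum>A\<in>?P ` (p ` space \<mu>). m (A \<inter> ?F x))"
      using additive_partition_split[OF m lp(1) lf(2)] by simp
    also have "\<dots> = (\<Sum>z\<in>p ` space \<mu>. m (?P z \<inter> ?F x))"
      by (simp add: sum.reindex[OF lp(2)])
    finally show "m (?F x) x = (\<Sum>z\<in>p ` space \<mu>. m (?P z \<inter> ?F x) x)"
      by (simp add: blinfun.sum_left)
  qed
  also have "\<dots> = (\<Sum>z\<in>p ` space \<mu>. \<Sum>x\<in>f ` space \<mu>. m (?P z \<inter> ?F x) x)" by (rule sum.swap)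
  also have "\<dots> = (\<Sum>z\<in>p ` space \<mu>. m (?P z) (v z))"
  proof (rule sum.cong[OF refl])
    fix z assume z: "z \<in> p ` space \<mu>"
    have "m (?P z \<inter> ?F x) x = (if x = v z then m (?P z) (v z) else 0)" for x
    proof (cases "x = v z")
      case True
      then have "?P z \<inter> ?F x = ?P z" using v by auto
      with True show ?thesis by simp
    next
      case False
      then have "?P z \<inter> ?F x = {}" using v by auto
      with False additive_empty[OF m] show ?thesis by simp
    qed
    moreover have "v z \<in> f ` space \<mu>" using z v by force
    ultimately show "(\<Sum>x\<in>f ` space \<mu>. m (?P z \<inter> ?F x) x) = m (?P z) (v z)"
      using lf(1) by simp
  qed
  finally show ?thesis .
qed

lemma simple_vm_integral_add:
  assumes m: "additive (sets \<mu>) m" and f: "simple_function \<mu> f" and g: "simple_function \<mu> g"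
  shows "simple_vm_integral (space \<mu>) m (\<lambda>\<omega>. f \<omega> + g \<omega>) =
    simple_vm_integral (space \<mu>) m f + simple_vm_integral (space \<mu>) m g"
proof -
  let ?p = "\<lambda>\<omega>. (f \<omega>, g \<omega>)"
  have p: "simple_function \<mu> ?p" using f g by simp
  have fg: "simple_function \<mu> (\<lambda>\<omega>. f \<omega> + g \<omega>)" using f g by (rule simple_function_compose2)
  show ?thesis
    using simple_vm_integral_partition[OF m f p, of fst] simple_vm_integral_partition[OF m g p, of snd]
      simple_vm_integral_partition[OF m fg p, of "\<lambda>z. fst z + snd z"]
    by (simp add: sum.distrib blinfun.add_right)
qed

lemma simple_vm_integral_scaleR:
  assumes m: "additive (sets \<mu>) m" and f: "simple_function \<mu> f"
  shows "simple_vm_integral (space \<mu>) m (\<lambda>\<omega>. c *\<^sub>R f \<omega>) = c * simple_vm_integral (space \<mu>) m f"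
proof -
  have cf: "simple_function \<mu> (\<lambda>\<omega>. c *\<^sub>R f \<omega>)" using f by (rule simple_function_compose1)
  show ?thesis
    using simple_vm_integral_partition[OF m f f, of "\<lambda>z. z"]
      simple_vm_integral_partition[OF m cf f, of "\<lambda>z. c *\<^sub>R z"]
    by (simp add: sum_distrib_left blinfun.scaleR_right)
qed

lemma simple_vm_integral_diff:
  assumes m: "additive (sets \<mu>) m" and f: "simple_function \<mu> f" and g: "simple_function \<mu> g"
  shows "simple_vm_integral (space \<mu>) m (\<lambda>\<omega>. f \<omega> - g \<omega>) =
    simple_vm_integral (space \<mu>) m f - simple_vm_integral (space \<mu>) m g"
  using simple_vm_integral_add[OF m f, of "\<lambda>\<omega>. -1 *\<^sub>R g \<omega>"] simple_vm_integral_scaleR[OF m g, of "-1"]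
    simple_function_compose1[OF g, of "\<lambda>x. -1 *\<^sub>R x"] by simp

text \<open>The set function \<open>N\<close> can be a difference of charges, such as \<open>m\<close> minus one of its averages.\<close>

lemma simple_vm_integral_bound:
  assumes K: "\<And>\<tau>. \<tau> \<in> finite_partitions (space \<mu>) (sets \<mu>) \<Longrightarrow> (\<Sum>B\<in>\<tau>. norm (N B)) \<le> K"
    and f: "simple_function \<mu> f" and c: "\<And>\<omega>. \<omega> \<in> space \<mu> \<Longrightarrow> norm (f \<omega>) \<le> c" "c \<ge> 0"
  shows "\<bar>simple_vm_integral (space \<mu>) N f\<bar> \<le> K * c"
proof -
  let ?F = "\<lambda>x. {\<omega>\<in>space \<mu>. f \<omega> = x}"
  have "\<bar>simple_vm_integral (space \<mu>) N f\<bar> \<le> (\<Sum>x\<in>f ` space \<mu>. norm (N (?F x)) * c)"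
    unfolding simple_vm_integral_def
  proof (intro order_trans[OF sum_abs] sum_mono)
    fix x assume "x \<in> f ` space \<mu>"
    then have "norm x \<le> c" using c by auto
    then show "\<bar>N (?F x) x\<bar> \<le> norm (N (?F x)) * c"
      using norm_blinfun[of "N (?F x)" x] mult_left_mono[of "norm x" c "norm (N (?F x))"] by simp
  qed
  also have "\<dots> = (\<Sum>B\<in>?F ` (f ` space \<mu>). norm (N B)) * c"
    by (simp add: sum_distrib_right sum.reindex[OF level_sets_partition(2)[OF f]])
  also have "\<dots> \<le> K * c" using K[OF level_sets_partition(1)[OF f]] c(2) by (rule mult_right_mono)
  finally show ?thesis .
qed

lemma charge_variation_bound:
  assumes "charge_wrt \<mu> G"
  obtains K where "K \<ge> 0" "\<And>\<tau>. \<tau> \<in> finite_partitions (space \<mu>) (sets \<mu>) \<Longrightarrow> (\<Sum>B\<in>\<tau>. norm (G B)) \<le> K"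
proof -
  obtain K where K: "\<And>\<tau>. \<tau> \<in> finite_partitions (space \<mu>) (sets \<mu>) \<Longrightarrow> (\<Sum>B\<in>\<tau>. norm (G B)) \<le> K"
    using charge_wrtD(3)[OF assms] by (auto simp: bounded_variation_def)
  then have "(\<Sum>B\<in>\<tau>. norm (G B)) \<le> max K 0" if "\<tau> \<in> finite_partitions (space \<mu>) (sets \<mu>)" for \<tau>
    using that by (simp add: max.coboundedI1)
  then show ?thesis using that[of "max K 0"] by simp
qed

lemma has_vm_integralE:
  assumes "has_vm_integral (space \<mu>) (sets \<mu>) m f I"
  obtains s where "\<And>n::nat. simple_function \<mu> (s n)" "uniform_limit (space \<mu>) s f sequentially"
    "(\<lambda>n. simple_vm_integral (space \<mu>) m (s n)) \<longlonglongrightarrow> I"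
  using assms by (auto simp: has_vm_integral_def simple_on_iff)

text \<open>Taking \<open>t = s\<close> gives the Cauchy property, hence existence of the integral; taking \<open>k = n\<close> gives
uniqueness.\<close>

lemma simple_vm_integral_uniform_dist:
  assumes m: "charge_wrt \<mu> m"
    and s: "\<And>n::nat. simple_function \<mu> (s n)" "uniform_limit (space \<mu>) s f sequentially"
    and t: "\<And>n::nat. simple_function \<mu> (t n)" "uniform_limit (space \<mu>) t f sequentially"
    and e: "e > 0"
  shows "\<exists>N. \<forall>n\<ge>N. \<forall>k\<ge>N. \<bar>simple_vm_integral (space \<mu>) m (s n) - simple_vm_integral (space \<mu>) m (t k)\<bar> < e"
proof -
  obtain K where K: "K \<ge> 0" "\<And>\<tau>. \<tau> \<in> finite_partitions (space \<mu>) (sets \<mu>) \<Longrightarrow> (\<Sum>B\<in>\<tau>. norm (m B)) \<le> K"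
    by (rule charge_variation_bound[OF m]) blast
  define d where "d = e / (2 * (K + 1))"
  have d: "d > 0" using e K by (simp add: d_def)
  have "\<forall>\<^sub>F n in sequentially. \<forall>x\<in>space \<mu>. dist (s n x) (f x) < d"
    "\<forall>\<^sub>F n in sequentially. \<forall>x\<in>space \<mu>. dist (t n x) (f x) < d"
    using s(2) t(2) d by (auto intro: uniform_limitD)
  then obtain N where N: "\<And>n x. n \<ge> N \<Longrightarrow> x \<in> space \<mu> \<Longrightarrow> dist (s n x) (f x) < d"
     "\<And>n x. n \<ge> N \<Longrightarrow> x \<in> space \<mu> \<Longrightarrow> dist (t n x) (f x) < d"
    unfolding eventually_sequentially by (metis le_cases order.trans)
  have "\<bar>simple_vm_integral (space \<mu>) m (s n) - simple_vm_integral (space \<mu>) m (t k)\<bar> < e"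
    if "n \<ge> N" "k \<ge> N" for n k
  proof -
    have sf: "simple_function \<mu> (\<lambda>\<omega>. s n \<omega> - t k \<omega>)" using s(1) t(1) by (rule simple_function_compose2)
    have "norm (s n \<omega> - t k \<omega>) \<le> 2 * d" if "\<omega> \<in> space \<mu>" for \<omega>
      using dist_triangle2[of "s n \<omega>" "t k \<omega>" "f \<omega>"] N(1)[OF \<open>n \<ge> N\<close> that] N(2)[OF \<open>k \<ge> N\<close> that]
      by (simp add: dist_norm)
    then have "\<bar>simple_vm_integral (space \<mu>) m (\<lambda>\<omega>. s n \<omega> - t k \<omega>)\<bar> \<le> K * (2 * d)"
      using simple_vm_integral_bound[OF K(2) sf] d by simp
    also have "K * (2 * d) < e" using K(1) e by (simp add: d_def field_simps)
    finally show ?thesis using simple_vm_integral_diff[OF charge_wrtD(2)[OF m] s(1) t(1)] by simp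
  qed
  then show ?thesis by blast
qed

lemma has_vm_integral_unique:
  assumes m: "charge_wrt \<mu> m"
    and I: "has_vm_integral (space \<mu>) (sets \<mu>) m f I" and J: "has_vm_integral (space \<mu>) (sets \<mu>) m f J"
  shows "I = J"
proof -
  obtain s where s: "\<And>n::nat. simple_function \<mu> (s n)" "uniform_limit (space \<mu>) s f sequentially"
    "(\<lambda>n. simple_vm_integral (space \<mu>) m (s n)) \<longlonglongrightarrow> I" using I by (rule has_vm_integralE) blast
  obtain t where t: "\<And>n::nat. simple_function \<mu> (t n)" "uniform_limit (space \<mu>) t f sequentially"
    "(\<lambda>n. simple_vm_integral (space \<mu>) m (t n)) \<longlonglongrightarrow> J" using J by (rule has_vm_integralE) blast
  have "(\<lambda>n. simple_vm_integral (space \<mu>) m (s n) - simple_vm_integral (space \<mu>) m (t n)) \<longlonglongrightarrow> 0"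
  proof (rule LIMSEQ_I)
    fix e :: real assume "e > 0"
    then show "\<exists>N. \<forall>n\<ge>N. norm (simple_vm_integral (space \<mu>) m (s n) - simple_vm_integral (space \<mu>) m (t n) - 0) < e"
      using simple_vm_integral_uniform_dist[OF m s(1,2) t(1,2)] by fastforce
  qed
  moreover have "(\<lambda>n. simple_vm_integral (space \<mu>) m (s n) - simple_vm_integral (space \<mu>) m (t n)) \<longlonglongrightarrow> I - J"
    by (intro tendsto_diff s t)
  ultimately show ?thesis using LIMSEQ_unique by fastforce
qed

lemma has_vm_integral_exists:
  assumes m: "charge_wrt \<mu> m" and f: "f \<in> U_space (space \<mu>) (sets \<mu>)"
  shows "\<exists>I. has_vm_integral (space \<mu>) (sets \<mu>) m f I"
proof -
  obtain s where s: "\<And>n::nat. simple_function \<mu> (s n)" "uniform_limit (space \<mu>) s f sequentially"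
    using f by (auto simp: U_space_def simple_on_iff)
  have "Cauchy (\<lambda>n. simple_vm_integral (space \<mu>) m (s n))"
    unfolding Cauchy_def dist_real_def using simple_vm_integral_uniform_dist[OF m s s] by blast
  then obtain I where "(\<lambda>n. simple_vm_integral (space \<mu>) m (s n)) \<longlonglongrightarrow> I"
    using Cauchy_convergent convergent_def by blast
  with s show ?thesis by (auto simp: has_vm_integral_def simple_on_iff)
qed

lemma has_vm_integral_simple:
  assumes "simple_function \<mu> f"
  shows "has_vm_integral (space \<mu>) (sets \<mu>) m f (simple_vm_integral (space \<mu>) m f)"
  unfolding has_vm_integral_def simple_on_iff
  by (rule exI[of _ "\<lambda>_. f"]) (use assms in \<open>auto intro!: uniform_limitI\<close>)

lemma has_vm_integral_add:
  assumes m: "additive (sets \<mu>) m"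
    and "has_vm_integral (space \<mu>) (sets \<mu>) m f I" "has_vm_integral (space \<mu>) (sets \<mu>) m g J"
  shows "has_vm_integral (space \<mu>) (sets \<mu>) m (\<lambda>\<omega>. f \<omega> + g \<omega>) (I + J)"
proof -
  obtain s where s: "\<And>n::nat. simple_function \<mu> (s n)" "uniform_limit (space \<mu>) s f sequentially"
    "(\<lambda>n. simple_vm_integral (space \<mu>) m (s n)) \<longlonglongrightarrow> I" using assms(2) by (rule has_vm_integralE) blast
  obtain t where t: "\<And>n::nat. simple_function \<mu> (t n)" "uniform_limit (space \<mu>) t g sequentially"
    "(\<lambda>n. simple_vm_integral (space \<mu>) m (t n)) \<longlonglongrightarrow> J" using assms(3) by (rule has_vm_integralE) blast
  show ?thesis
    unfolding has_vm_integral_def simple_on_iff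
  proof (intro exI conjI allI)
    show "simple_function \<mu> (\<lambda>\<omega>. s n \<omega> + t n \<omega>)" for n using s(1) t(1) by (rule simple_function_compose2)
    show "uniform_limit (space \<mu>) (\<lambda>n \<omega>. s n \<omega> + t n \<omega>) (\<lambda>\<omega>. f \<omega> + g \<omega>) sequentially"
      by (rule uniform_limit_add[OF s(2) t(2)])
    show "(\<lambda>n. simple_vm_integral (space \<mu>) m (\<lambda>\<omega>. s n \<omega> + t n \<omega>)) \<longlonglongrightarrow> I + J"
      unfolding simple_vm_integral_add[OF m s(1) t(1)] by (rule tendsto_add[OF s(3) t(3)])
  qed
qed

lemma has_vm_integral_scaleR:
  assumes m: "additive (sets \<mu>) m" and "has_vm_integral (space \<mu>) (sets \<mu>) m f I"
  shows "has_vm_integral (space \<mu>) (sets \<mu>) m (\<lambda>\<omega>. c *\<^sub>R f \<omega>) (c * I)"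
proof -
  obtain s where s: "\<And>n::nat. simple_function \<mu> (s n)" "uniform_limit (space \<mu>) s f sequentially"
    "(\<lambda>n. simple_vm_integral (space \<mu>) m (s n)) \<longlonglongrightarrow> I" using assms(2) by (rule has_vm_integralE) blast
  show ?thesis
    unfolding has_vm_integral_def simple_on_iff
  proof (intro exI conjI allI)
    show "simple_function \<mu> (\<lambda>\<omega>. c *\<^sub>R s n \<omega>)" for n using s(1) by (rule simple_function_compose1)
    show "uniform_limit (space \<mu>) (\<lambda>n \<omega>. c *\<^sub>R s n \<omega>) (\<lambda>\<omega>. c *\<^sub>R f \<omega>) sequentially"
      by (rule bounded_linear.uniform_limit[OF bounded_linear_scaleR_right s(2)])
    show "(\<lambda>n. simple_vm_integral (space \<mu>) m (\<lambda>\<omega>. c *\<^sub>R s n \<omega>)) \<longlonglongrightarrow> c * I"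
      unfolding simple_vm_integral_scaleR[OF m s(1)] by (rule tendsto_mult_left[OF s(3)])
  qed
qed

lemma U_space_bounded:
  assumes "f \<in> U_space (space \<mu>) (sets \<mu>)"
  obtains c where "\<And>\<omega>. \<omega> \<in> space \<mu> \<Longrightarrow> norm (f \<omega>) \<le> c"
proof -
  obtain s where s: "\<And>n::nat. simple_function \<mu> (s n)" "uniform_limit (space \<mu>) s f sequentially"
    using assms by (auto simp: U_space_def simple_on_iff)
  have "\<forall>\<^sub>F n in sequentially. \<forall>x\<in>space \<mu>. dist (s n x) (f x) < 1"
    using s(2) by (rule uniform_limitD) simp
  then obtain n where n: "\<And>x. x \<in> space \<mu> \<Longrightarrow> dist (s n x) (f x) < 1"
    using eventually_happens'[OF sequentially_bot] by blast
  have fin: "finite ((\<lambda>x. norm (s n x)) ` space \<mu>)"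
    using simple_functionD(1)[OF s(1)[of n]] by (metis finite_imageI image_image)
  have "norm (f \<omega>) \<le> Max ((\<lambda>x. norm (s n x)) ` space \<mu>) + 1" if "\<omega> \<in> space \<mu>" for \<omega>
  proof -
    have "norm (f \<omega>) \<le> norm (s n \<omega>) + 1"
      using n[OF that] norm_triangle_ineq4[of "s n \<omega>" "s n \<omega> - f \<omega>"] by (simp add: dist_norm)
    then show ?thesis using Max_ge[OF fin, of "norm (s n \<omega>)"] that by force
  qed
  then show ?thesis by (rule that)
qed

lemma norm_le_sup_norm:
  assumes "f \<in> U_space (space \<mu>) (sets \<mu>)" "\<omega> \<in> space \<mu>"
  shows "norm (f \<omega>) \<le> sup_norm (space \<mu>) f"
proof -
  obtain c where c: "\<And>\<omega>. \<omega> \<in> space \<mu> \<Longrightarrow> norm (f \<omega>) \<le> c" by (rule U_space_bounded[OF assms(1)]) blast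
  have "bdd_above (insert 0 ((\<lambda>\<omega>. norm (f \<omega>)) ` space \<mu>))"
    by (rule bdd_aboveI[of _ "max c 0"]) (use c in \<open>auto simp: max.coboundedI1\<close>)
  then show ?thesis unfolding sup_norm_def using assms(2) by (intro cSup_upper) auto
qed

lemma sup_norm_nonneg:
  assumes "f \<in> U_space (space \<mu>) (sets \<mu>)" shows "0 \<le> sup_norm (space \<mu>) f"
proof (cases "space \<mu> = {}")
  case True then show ?thesis by (simp add: sup_norm_def)
next
  case False
  then obtain \<omega> where "\<omega> \<in> space \<mu>" by auto
  from norm_le_sup_norm[OF assms this] show ?thesis using norm_ge_zero order_trans by blast
qed

lemma sup_norm_le:
  assumes "\<And>\<omega>. \<omega> \<in> \<Omega> \<Longrightarrow> norm (f \<omega>) \<le> c" "c \<ge> 0"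
  shows "sup_norm \<Omega> f \<le> c"
  unfolding sup_norm_def by (rule cSup_least) (use assms in auto)

lemma has_vm_integral_U_space:
  "has_vm_integral \<Omega> \<Sigma> m f I \<Longrightarrow> f \<in> U_space \<Omega> \<Sigma>"
  by (auto simp: has_vm_integral_def U_space_def)

text \<open>On a finite measure space uniform convergence implies \<open>L\<^sup>1\<close> convergence, so the simple functions \<open>s n\<close>
are admissible in the definition of the integral of \<open>f\<close>.\<close>

lemma strong_set_integral_uniform_limit:
  fixes f :: "'w \<Rightarrow> 'x::banach"
  assumes \<mu>: "finite_measure \<mu>" and A: "A \<in> sets \<mu>"
    and s: "\<And>n::nat. simple_function \<mu> (s n)" "uniform_limit (space \<mu>) s f sequentially"
  shows "(\<lambda>n. sb_integral \<mu> (\<lambda>\<omega>. indicator A \<omega> *\<^sub>R s n \<omega>))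
    \<longlonglongrightarrow> strong_set_integral \<mu> A f"
proof -
  interpret finite_measure \<mu> by fact
  let ?t = "\<lambda>n \<omega>. indicator A \<omega> *\<^sub>R s n \<omega>" and ?f = "\<lambda>\<omega>. indicator A \<omega> *\<^sub>R f \<omega>"
  let ?J = "\<lambda>n. sb_integral \<mu> (?t n)"
  have t: "simple_function \<mu> (?t n)" for n by (rule simple_function_indicator_scaleR[OF A s(1)])
  have unif: "\<exists>N. \<forall>n\<ge>N. (\<integral>\<^sup>+\<omega>. ennreal (norm (?f \<omega> - ?t n \<omega>)) \<partial>\<mu>) \<le> ennreal e" if "e > 0" for e
  proof -
    define d where "d = e / (measure \<mu> (space \<mu>) + 1)"
    have d: "d > 0" using that by (simp add: d_def add_nonneg_pos)
    have "\<forall>\<^sub>F n in sequentially. \<forall>x\<in>space \<mu>. dist (s n x) (f x) < d"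
      using s(2) d by (rule uniform_limitD)
    then obtain N where N: "\<And>n x. n \<ge> N \<Longrightarrow> x \<in> space \<mu> \<Longrightarrow> dist (s n x) (f x) < d"
      unfolding eventually_sequentially by blast
    have "(\<integral>\<^sup>+\<omega>. ennreal (norm (?f \<omega> - ?t n \<omega>)) \<partial>\<mu>) \<le> ennreal e" if "n \<ge> N" for n
    proof -
      have "(\<integral>\<^sup>+\<omega>. ennreal (norm (?f \<omega> - ?t n \<omega>)) \<partial>\<mu>) \<le> (\<integral>\<^sup>+\<omega>. ennreal d \<partial>\<mu>)"
        by (rule nn_integral_mono)
          (use N[OF that] d in \<open>force simp: indicator_def dist_norm norm_minus_commute intro!: ennreal_leI\<close>)
      also have "\<dots> = ennreal (d * measure \<mu> (space \<mu>))"
        using d by (simp add: emeasure_eq_measure ennreal_mult)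
      also have "\<dots> \<le> ennreal e"
      proof (rule ennreal_leI)
        have "0 < measure \<mu> (space \<mu>) + 1" by (simp add: add_nonneg_pos)
        then show "d * measure \<mu> (space \<mu>) \<le> e"
          using \<open>e > 0\<close> by (simp add: d_def pos_divide_le_eq distrib_left)
      qed
      finally show ?thesis .
    qed
    then show ?thesis by blast
  qed
  have sm: "strongly_measurable \<mu> ?f"
    unfolding strongly_measurable_def
  proof (intro exI conjI allI AE_I2)
    show "simple_function \<mu> (?t n)" for n by (rule t)
    fix \<omega> assume "\<omega> \<in> space \<mu>"
    then show "(\<lambda>n. ?t n \<omega>) \<longlonglongrightarrow> ?f \<omega>"
      by (intro tendsto_scaleR tendsto_const tendsto_uniform_limitI[OF s(2)])
  qed
  have "Cauchy ?J"
  proof (rule metric_CauchyI)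
    fix e :: real assume e: "e > 0"
    then obtain N where N: "\<And>n. n \<ge> N \<Longrightarrow> (\<integral>\<^sup>+\<omega>. ennreal (norm (?f \<omega> - ?t n \<omega>)) \<partial>\<mu>) \<le> ennreal (e/3)"
      using unif[of "e/3"] by auto
    show "\<exists>M. \<forall>m\<ge>M. \<forall>n\<ge>M. dist (?J m) (?J n) < e"
    proof (intro exI allI impI)
      fix m n assume "N \<le> m" "N \<le> n"
      then have "ennreal (norm (?J m - ?J n)) \<le> ennreal (e/3) + ennreal (e/3)"
        by (intro order_trans[OF simple_integral_dist[OF \<mu> t t]] order_trans[OF nn_integral_triangle_strong[OF sm t t]]
            add_mono N)
      also have "\<dots> = ennreal (e/3 + e/3)" by (rule ennreal_plus[symmetric]) (use e in auto)
      finally have "norm (?J m - ?J n) \<le> e/3 + e/3" using e by (simp add: ennreal_le_iff del: ennreal_plus)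
      then show "dist (?J m) (?J n) < e" using e by (simp add: dist_norm)
    qed
  qed
  then obtain I where I: "?J \<longlonglongrightarrow> I" using Cauchy_convergent convergent_def by blast
  have "has_strong_integral \<mu> ?f I"
    unfolding has_strong_integral_def
  proof (intro conjI exI allI)
    show "strongly_measurable \<mu> ?f" by (rule sm)
    show "sb_integrable \<mu> (?t n)" for n
      by (rule simple_bochner_integrable_finite_measure[OF \<mu> t])
    show "?J \<longlonglongrightarrow> I" by (rule I)
    show "(\<lambda>n. \<integral>\<^sup>+\<omega>. ennreal (norm (?f \<omega> - ?t n \<omega>)) \<partial>\<mu>) \<longlonglongrightarrow> 0"
    proof (rule order_tendstoI)
      fix a :: ennreal assume "0 < a"
      then obtain b where "0 < b" "b < a" using dense by blast
      then obtain e where e: "0 < e" "ennreal e < a"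
        by (cases b) (auto simp: ennreal_zero_less_top)
      then show "\<forall>\<^sub>F n in sequentially. (\<integral>\<^sup>+\<omega>. ennreal (norm (?f \<omega> - ?t n \<omega>)) \<partial>\<mu>) < a"
        unfolding eventually_sequentially using unif[OF e(1)] by (meson le_less_trans)
    qed simp
  qed
  then have "strong_set_integral \<mu> A f = I"
    unfolding strong_set_integral_def using strong_integral_unique[OF \<mu>] by blast
  with I show ?thesis by simp
qed

lemma strong_set_integral_simple:
  fixes f :: "'w \<Rightarrow> 'x::banach"
  assumes \<mu>: "finite_measure \<mu>" and A: "A \<in> sets \<mu>" and f: "simple_function \<mu> f"
  shows "strong_set_integral \<mu> A f = (\<Sum>x\<in>f ` space \<mu>. measure \<mu> ({\<omega>\<in>space \<mu>. f \<omega> = x} \<inter> A) *\<^sub>R x)"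
proof -
  have "(\<lambda>n::nat. sb_integral \<mu> (\<lambda>\<omega>. indicator A \<omega> *\<^sub>R f \<omega>))
    \<longlonglongrightarrow> strong_set_integral \<mu> A f"
    by (rule strong_set_integral_uniform_limit[OF \<mu> A f]) (auto intro!: uniform_limitI)
  then have "strong_set_integral \<mu> A f = sb_integral \<mu> (\<lambda>\<omega>. indicator A \<omega> *\<^sub>R f \<omega>)"
    by (simp add: LIMSEQ_const_iff)
  then show ?thesis using simple_integral_on_set[OF \<mu> f A, of "\<lambda>x. x"] by (simp add: step_charge_def)
qed

text \<open>The conditional expectation operator is integration against the averaged charge: both sides are the
same double sum over blocks and values of \<open>f\<close>.\<close>

lemma cond_exp_op_simple:
  fixes m :: "'w set \<Rightarrow> ('x::banach \<Rightarrow>\<^sub>L real)"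
  assumes \<mu>: "finite_measure \<mu>" and \<pi>: "\<pi> \<in> finite_partitions (space \<mu>) (sets \<mu>)" and f: "simple_function \<mu> f"
  shows "cond_exp_op \<mu> m \<pi> f = simple_vm_integral (space \<mu>) (cond_charge \<mu> \<pi> m) f"
proof -
  let ?F = "\<lambda>x. {\<omega>\<in>space \<mu>. f \<omega> = x}"
  have "cond_exp_op \<mu> m \<pi> f = (\<Sum>A\<in>\<pi>. \<Sum>x\<in>f ` space \<mu>. (measure \<mu> (A \<inter> ?F x) / measure \<mu> A) * m A x)"
    unfolding cond_exp_op_def
  proof (rule sum.cong[OF refl])
    fix A assume "A \<in> \<pi>"
    then have A: "A \<in> sets \<mu>" using finite_partitionsD(2)[OF \<pi>] by auto
    show "m A (inverse (measure \<mu> A) *\<^sub>R strong_set_integral \<mu> A f) =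
      (\<Sum>x\<in>f ` space \<mu>. (measure \<mu> (A \<inter> ?F x) / measure \<mu> A) * m A x)"
      unfolding strong_set_integral_simple[OF \<mu> A f]
      by (simp add: blinfun.scaleR_right blinfun.sum_right sum_distrib_left divide_inverse Int_commute mult_ac)
  qed
  also have "\<dots> = simple_vm_integral (space \<mu>) (cond_charge \<mu> \<pi> m) f"
    by (subst sum.swap) (simp add: simple_vm_integral_def cond_charge_def blinfun.sum_left blinfun.scaleR_left)
  finally show ?thesis .
qed

text \<open>Passes a bound by the sup norm from simple functions to their uniform limits. The norms of \<open>s n\<close> can
slightly exceed that of \<open>f\<close>, which is why the proof works up to \<open>e\<close>.\<close>

lemma uniform_limit_functional_bound:
  assumes s: "uniform_limit (space \<mu>) s f sequentially" and fU: "f \<in> U_space (space \<mu>) (sets \<mu>)"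
    and L: "L \<longlonglongrightarrow> l" and K: "K \<ge> 0"
    and bound: "\<And>n c. (\<And>\<omega>. \<omega> \<in> space \<mu> \<Longrightarrow> norm (s n \<omega>) \<le> c) \<Longrightarrow> 0 \<le> c \<Longrightarrow> \<bar>L n\<bar> \<le> K * c"
  shows "\<bar>l :: real\<bar> \<le> K * sup_norm (space \<mu>) f"
proof (rule field_le_epsilon)
  fix e :: real assume e: "e > 0"
  define d where "d = e / (K + 1)"
  have d: "d > 0" "K * d \<le> e" using e K by (auto simp: d_def field_simps)
  have "\<forall>\<^sub>F n in sequentially. \<forall>x\<in>space \<mu>. dist (s n x) (f x) < d"
    using s d(1) by (rule uniform_limitD)
  then have "\<forall>\<^sub>F n in sequentially. \<bar>L n\<bar> \<le> K * (sup_norm (space \<mu>) f + d)"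
  proof eventually_elim
    case (elim n)
    have "norm (s n \<omega>) \<le> sup_norm (space \<mu>) f + d" if "\<omega> \<in> space \<mu>" for \<omega>
      using elim that norm_le_sup_norm[OF fU that] norm_triangle_ineq2[of "s n \<omega>" "f \<omega>"]
      by (fastforce simp: dist_norm)
    then show ?case using bound sup_norm_nonneg[OF fU] d(1) by simp
  qed
  then have "\<bar>l\<bar> \<le> K * (sup_norm (space \<mu>) f + d)"
    by (intro tendsto_upperbound[OF tendsto_rabs[OF L]]) auto
  then show "\<bar>l\<bar> \<le> K * sup_norm (space \<mu>) f + e"
    using d(2) by (simp add: distrib_left)
qed

lemma vm_integral_bound:
  assumes K: "\<And>\<tau>. \<tau> \<in> finite_partitions (space \<mu>) (sets \<mu>) \<Longrightarrow> (\<Sum>B\<in>\<tau>. norm (m B)) \<le> K" "K \<ge> 0"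
    and f: "has_vm_integral (space \<mu>) (sets \<mu>) m f I"
  shows "\<bar>I\<bar> \<le> K * sup_norm (space \<mu>) f"
proof -
  obtain s where s: "\<And>n::nat. simple_function \<mu> (s n)" "uniform_limit (space \<mu>) s f sequentially"
    "(\<lambda>n. simple_vm_integral (space \<mu>) m (s n)) \<longlonglongrightarrow> I" using f by (rule has_vm_integralE) blast
  show ?thesis
    by (rule uniform_limit_functional_bound[OF s(2) has_vm_integral_U_space[OF f] s(3) K(2)])
      (rule simple_vm_integral_bound[OF K(1) s(1)])
qed

text \<open>On simple functions the difference is the integral against \<open>m\<close> minus its average; both sides pass to
uniform limits.\<close>

lemma cond_exp_op_error:
  fixes m :: "'w set \<Rightarrow> ('x::banach \<Rightarrow>\<^sub>L real)"
  assumes \<mu>: "finite_measure \<mu>" and \<pi>: "\<pi> \<in> finite_partitions (space \<mu>) (sets \<mu>)"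
    and K: "\<And>\<tau>. \<tau> \<in> finite_partitions (space \<mu>) (sets \<mu>) \<Longrightarrow> (\<Sum>B\<in>\<tau>. norm (m B - cond_charge \<mu> \<pi> m B)) \<le> K" "K \<ge> 0"
    and f: "has_vm_integral (space \<mu>) (sets \<mu>) m f I"
  shows "\<bar>cond_exp_op \<mu> m \<pi> f - I\<bar> \<le> K * sup_norm (space \<mu>) f"
proof -
  obtain s where s: "\<And>n::nat. simple_function \<mu> (s n)" "uniform_limit (space \<mu>) s f sequentially"
    "(\<lambda>n. simple_vm_integral (space \<mu>) m (s n)) \<longlonglongrightarrow> I" using f by (rule has_vm_integralE) blast
  have c: "(\<lambda>n. cond_exp_op \<mu> m \<pi> (s n)) \<longlonglongrightarrow> cond_exp_op \<mu> m \<pi> f"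
    unfolding cond_exp_op_def
  proof (intro tendsto_sum tendsto_intros)
    fix A assume "A \<in> \<pi>"
    then have A: "A \<in> sets \<mu>" using finite_partitionsD(2)[OF \<pi>] by auto
    have "strong_set_integral \<mu> A (s n) = sb_integral \<mu> (\<lambda>\<omega>. indicator A \<omega> *\<^sub>R s n \<omega>)" for n
      unfolding strong_set_integral_simple[OF \<mu> A s(1)]
      using simple_integral_on_set[OF \<mu> s(1) A, of "\<lambda>x. x"] by (simp add: step_charge_def)
    then show "(\<lambda>n. strong_set_integral \<mu> A (s n)) \<longlonglongrightarrow> strong_set_integral \<mu> A f"
      using strong_set_integral_uniform_limit[OF \<mu> A s(1,2)] by simp
  qed
  have lim: "(\<lambda>n. cond_exp_op \<mu> m \<pi> (s n) - simple_vm_integral (space \<mu>) m (s n)) \<longlonglongrightarrow> cond_exp_op \<mu> m \<pi> f - I"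
    by (intro tendsto_intros c s(3))
  show ?thesis
  proof (rule uniform_limit_functional_bound[OF s(2) has_vm_integral_U_space[OF f] lim K(2)])
    fix n c assume c: "\<And>\<omega>. \<omega> \<in> space \<mu> \<Longrightarrow> norm (s n \<omega>) \<le> c" "0 \<le> c"
    have "\<bar>simple_vm_integral (space \<mu>) (\<lambda>B. m B - cond_charge \<mu> \<pi> m B) (s n)\<bar> \<le> K * c"
      by (rule simple_vm_integral_bound[OF K(1) s(1) c])
    moreover have "simple_vm_integral (space \<mu>) (\<lambda>B. m B - cond_charge \<mu> \<pi> m B) (s n) =
        simple_vm_integral (space \<mu>) m (s n) - cond_exp_op \<mu> m \<pi> (s n)"
      unfolding cond_exp_op_simple[OF \<mu> \<pi> s(1)]
      by (simp add: simple_vm_integral_def blinfun.diff_left sum_subtractf)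
    ultimately show "\<bar>cond_exp_op \<mu> m \<pi> (s n) - simple_vm_integral (space \<mu>) m (s n)\<bar> \<le> K * c"
      by (simp add: abs_minus_commute)
  qed
qed

section \<open>Norm convergence and approximability\<close>

lemma eventually_partition_filter:
  assumes "\<Omega> \<in> \<Sigma>" and Int: "\<And>A B. A \<in> \<Sigma> \<Longrightarrow> B \<in> \<Sigma> \<Longrightarrow> A \<inter> B \<in> \<Sigma>"
  shows "eventually P (partition_filter \<Omega> \<Sigma>) \<longleftrightarrow>
    (\<exists>\<pi>\<^sub>0\<in>finite_partitions \<Omega> \<Sigma>. \<forall>\<pi>\<in>finite_partitions \<Omega> \<Sigma>. refines \<Omega> \<pi> \<pi>\<^sub>0 \<longrightarrow> P \<pi>)"
proof -
  let ?F = "\<lambda>\<pi>\<^sub>0. principal {\<pi> \<in> finite_partitions \<Omega> \<Sigma>. refines \<Omega> \<pi> \<pi>\<^sub>0}"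
  have "eventually P (partition_filter \<Omega> \<Sigma>) \<longleftrightarrow> (\<exists>\<pi>\<^sub>0\<in>finite_partitions \<Omega> \<Sigma>. eventually P (?F \<pi>\<^sub>0))"
    unfolding partition_filter_def
  proof (rule eventually_INF_base)
    show "finite_partitions \<Omega> \<Sigma> \<noteq> {}" using finite_partitions_nonempty[OF assms(1)] by blast
    fix \<pi> \<tau> assume "\<pi> \<in> finite_partitions \<Omega> \<Sigma>" "\<tau> \<in> finite_partitions \<Omega> \<Sigma>"
    then obtain \<rho> where \<rho>: "\<rho> \<in> finite_partitions \<Omega> \<Sigma>" "refines \<Omega> \<rho> \<pi>" "refines \<Omega> \<rho> \<tau>"
      by (rule common_refinement_pair) (rule Int)
    show "\<exists>\<rho>\<in>finite_partitions \<Omega> \<Sigma>. ?F \<rho> \<le> inf (?F \<pi>) (?F \<tau>)"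
      using \<rho> by (intro bexI[OF _ \<rho>(1)]) (auto intro: refines_trans)
  qed
  then show ?thesis by (auto simp: eventually_principal)
qed

text \<open>The factor 1/2 avoids the question whether the norm is attained.\<close>

lemma norming_vector:
  fixes \<phi> :: "'x::real_normed_vector \<Rightarrow>\<^sub>L real"
  shows "\<exists>x. norm x \<le> 1 \<and> norm \<phi> / 2 \<le> \<phi> x"
proof (rule ccontr)
  assume "\<not> ?thesis"
  then have *: "\<phi> x < norm \<phi> / 2" if "norm x \<le> 1" for x using that by force
  have pos: "norm \<phi> > 0" using *[of 0] by simp
  have "norm \<phi> \<le> norm \<phi> / 2"
  proof (rule norm_blinfun_bound)
    fix x
    show "norm (\<phi> x) \<le> norm \<phi> / 2 * norm x"
    proof (cases "x = 0")
      case False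
      have "\<bar>\<phi> (x /\<^sub>R norm x)\<bar> \<le> norm \<phi> / 2"
        using *[of "x /\<^sub>R norm x"] *[of "- (x /\<^sub>R norm x)"] False
        by (auto simp: blinfun.minus_right abs_le_iff)
      then show ?thesis using False by (simp add: blinfun.scaleR_right abs_mult field_simps)
    qed simp
  qed simp
  then show False using pos by simp
qed

text \<open>For functionals, vectors that norm the values \<open>m A\<close> up to a factor turn the semivariation into the variation.\<close>

lemma finite_semivariation_iff_bounded_variation:
  "finite_semivariation \<Omega> \<Sigma> m \<longleftrightarrow> bounded_variation \<Omega> \<Sigma> m"
proof
  assume "finite_semivariation \<Omega> \<Sigma> m"
  then obtain K where K: "\<And>\<pi> x. \<pi> \<in> finite_partitions \<Omega> \<Sigma> \<Longrightarrow> (\<And>A. A \<in> \<pi> \<Longrightarrow> norm (x A) \<le> 1) \<Longrightarrow>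
        norm (\<Sum>A\<in>\<pi>. m A (x A)) \<le> K" unfolding finite_semivariation_def by blast
  have "\<forall>A. \<exists>x. norm x \<le> 1 \<and> norm (m A) / 2 \<le> m A x" by (intro allI norming_vector)
  then obtain x where x: "\<And>A. norm (x A) \<le> 1" "\<And>A. norm (m A) / 2 \<le> m A (x A)" by metis
  have "(\<Sum>A\<in>\<pi>. norm (m A)) \<le> 2 * K" if "\<pi> \<in> finite_partitions \<Omega> \<Sigma>" for \<pi>
  proof -
    have "(\<Sum>A\<in>\<pi>. norm (m A)) / 2 \<le> (\<Sum>A\<in>\<pi>. m A (x A))"
      unfolding sum_divide_distrib by (rule sum_mono) (rule x)
    also have "\<dots> \<le> K" using K[OF that, of x] x(1) by simp
    finally show ?thesis by simp
  qed
  then show "bounded_variation \<Omega> \<Sigma> m" unfolding bounded_variation_def by blast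
next
  assume "bounded_variation \<Omega> \<Sigma> m"
  then obtain K where K: "\<And>\<pi>. \<pi> \<in> finite_partitions \<Omega> \<Sigma> \<Longrightarrow> (\<Sum>A\<in>\<pi>. norm (m A)) \<le> K"
    unfolding bounded_variation_def by blast
  have "norm (\<Sum>A\<in>\<pi>. m A (x A)) \<le> K" if "\<pi> \<in> finite_partitions \<Omega> \<Sigma>" "\<forall>A\<in>\<pi>. norm (x A) \<le> 1" for \<pi> x
  proof -
    have "norm (\<Sum>A\<in>\<pi>. m A (x A)) \<le> (\<Sum>A\<in>\<pi>. norm (m A))"
    proof (rule sum_norm_le)
      fix A assume "A \<in> \<pi>"
      then have "norm (m A) * norm (x A) \<le> norm (m A) * 1" using that by (intro mult_left_mono) auto
      then show "norm (m A (x A)) \<le> norm (m A)" using norm_blinfun[of "m A" "x A"] by simp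
    qed
    then show ?thesis using K[OF that(1)] by simp
  qed
  then show "finite_semivariation \<Omega> \<Sigma> m" unfolding finite_semivariation_def by blast
qed

text \<open>Works for every \<open>F\<close> whose elements are integrable against \<open>m\<close>, so it covers \<open>U_space\<close> and \<open>C_space\<close>.
The zero function keeps the supremum in the operator norm from ranging over an empty set.\<close>

lemma approximable_cond_exps_converge:
  fixes m :: "'w set \<Rightarrow> ('x::banach \<Rightarrow>\<^sub>L real)"
  assumes \<mu>: "finite_measure \<mu>" and approx: "density_approximable \<mu> m"
    and F: "\<And>f. f \<in> F \<Longrightarrow> has_vm_integral (space \<mu>) (sets \<mu>) m f (T f)" and F0: "(\<lambda>_. 0) \<in> F"
  shows "cond_exps_converge \<mu> F m T"
  unfolding cond_exps_converge_def
proof (rule tendstoI)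
  fix e :: real assume e: "e > 0"
  let ?P = "finite_partitions (space \<mu>) (sets \<mu>)"
  obtain \<pi>\<^sub>0 where \<pi>0: "\<pi>\<^sub>0 \<in> ?P"
    and var: "\<And>\<pi> \<tau>. \<lbrakk>\<pi> \<in> ?P; refines (space \<mu>) \<pi> \<pi>\<^sub>0; \<tau> \<in> ?P\<rbrakk> \<Longrightarrow>
       (\<Sum>B\<in>\<tau>. norm (m B - cond_charge \<mu> \<pi> m B)) \<le> e / 2"
    by (rule density_approximable_refines[OF \<mu> approx, of "e/2"]) (use e in auto)
  have "dist (functional_norm (space \<mu>) F (\<lambda>f. cond_exp_op \<mu> m \<pi> f - T f)) 0 < e"
    if \<pi>: "\<pi> \<in> ?P" "refines (space \<mu>) \<pi> \<pi>\<^sub>0" for \<pi>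
  proof -
    let ?B = "{f \<in> F. sup_norm (space \<mu>) f \<le> 1}"
    have bound: "\<bar>cond_exp_op \<mu> m \<pi> f - T f\<bar> \<le> e / 2" if "f \<in> ?B" for f
    proof -
      have "\<bar>cond_exp_op \<mu> m \<pi> f - T f\<bar> \<le> e / 2 * sup_norm (space \<mu>) f"
        using cond_exp_op_error[OF \<mu> \<pi>(1) var[OF \<pi>] _ F] that e by simp
      also have "\<dots> \<le> e / 2 * 1" using that e by (intro mult_left_mono) auto
      finally show ?thesis by simp
    qed
    have 0: "(\<lambda>_. 0) \<in> ?B" using F0 sup_norm_le[of "space \<mu>" "\<lambda>_. 0::'x" 1] by simp
    have "functional_norm (space \<mu>) F (\<lambda>f. cond_exp_op \<mu> m \<pi> f - T f) \<le> e / 2"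
      unfolding functional_norm_def by (rule cSUP_least) (use 0 bound in auto)
    moreover have "0 \<le> functional_norm (space \<mu>) F (\<lambda>f. cond_exp_op \<mu> m \<pi> f - T f)"
      unfolding functional_norm_def
      by (rule cSUP_upper2[OF bdd_aboveI2[OF bound] 0]) auto
    ultimately show ?thesis using e by simp
  qed
  then show "\<forall>\<^sub>F \<pi> in partition_filter (space \<mu>) (sets \<mu>).
      dist (functional_norm (space \<mu>) F (\<lambda>f. cond_exp_op \<mu> m \<pi> f - T f)) 0 < e"
    using \<pi>0 by (subst eventually_partition_filter) auto
qed

text \<open>A partition whose step functions lie in \<open>F\<close> sees the whole variation of the difference: put on each
block a vector that norms the difference up to the factor 1/2. On \<open>C_space\<close>
this applies to partitions into open sets.\<close>

lemma cond_exps_converge_approximates: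
  fixes m :: "'w set \<Rightarrow> ('x::banach \<Rightarrow>\<^sub>L real)"
  assumes m: "charge_wrt \<mu> m"
    and F: "\<And>f. f \<in> F \<Longrightarrow> has_vm_integral (space \<mu>) (sets \<mu>) m f (T f)"
    and conv: "cond_exps_converge \<mu> F m T" and \<epsilon>: "\<epsilon> > 0"
  shows "\<exists>\<pi>\<in>finite_partitions (space \<mu>) (sets \<mu>). \<forall>\<tau>\<in>finite_partitions (space \<mu>) (sets \<mu>).
     (\<forall>x. (\<lambda>\<omega>. x (block \<tau> \<omega>)) \<in> F) \<longrightarrow> (\<Sum>B\<in>\<tau>. norm (m B - cond_charge \<mu> \<pi> m B)) \<le> \<epsilon>"
proof -
  let ?P = "finite_partitions (space \<mu>) (sets \<mu>)"
  note g = charge_wrtD[OF m]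
  let ?N = "\<lambda>\<pi>. functional_norm (space \<mu>) F (\<lambda>f. cond_exp_op \<mu> m \<pi> f - T f)"
  have "\<forall>\<^sub>F \<pi> in partition_filter (space \<mu>) (sets \<mu>). dist (?N \<pi>) 0 < \<epsilon> / 2"
    using conv \<epsilon> unfolding cond_exps_converge_def by (intro tendstoD) auto
  then obtain \<pi> where \<pi>: "\<pi> \<in> ?P" and N: "?N \<pi> < \<epsilon> / 2"
    by (subst (asm) eventually_partition_filter) (force dest: finite_partitionsD(6) refines_refl)+
  obtain K where K: "K \<ge> 0" "\<And>\<tau>. \<tau> \<in> ?P \<Longrightarrow> (\<Sum>B\<in>\<tau>. norm (m B)) \<le> K"
    by (rule charge_variation_bound[OF m]) blast
  have var: "(\<Sum>B\<in>\<tau>. norm (m B - cond_charge \<mu> \<pi> m B)) \<le> 2 * K" if "\<tau> \<in> ?P" for \<tau>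
  proof -
    have "(\<Sum>B\<in>\<tau>. norm (m B - cond_charge \<mu> \<pi> m B)) \<le> (\<Sum>B\<in>\<tau>. norm (m B)) + (\<Sum>B\<in>\<tau>. norm (cond_charge \<mu> \<pi> m B))"
      unfolding sum.distrib[symmetric] by (rule sum_mono) (rule norm_triangle_ineq4)
    also have "\<dots> \<le> K + K"
      using K(2)[OF that] K(2)[OF \<pi>] averaging_contracts[OF g(1) \<pi> that, of m] by simp
    finally show ?thesis by simp
  qed
  let ?B = "{f \<in> F. sup_norm (space \<mu>) f \<le> 1}"
  have bdd: "bdd_above ((\<lambda>f. \<bar>cond_exp_op \<mu> m \<pi> f - T f\<bar>) ` ?B)"
  proof (rule bdd_aboveI2)
    fix f assume f: "f \<in> ?B"
    have "\<bar>cond_exp_op \<mu> m \<pi> f - T f\<bar> \<le> 2 * K * sup_norm (space \<mu>) f"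
      using cond_exp_op_error[OF g(1) \<pi> var _ F] f K(1) by simp
    also have "\<dots> \<le> 2 * K * 1" using f K(1) by (intro mult_left_mono) auto
    finally show "\<bar>cond_exp_op \<mu> m \<pi> f - T f\<bar> \<le> 2 * K" by simp
  qed
  show ?thesis
  proof (intro bexI[OF _ \<pi>] ballI impI)
    fix \<tau> assume \<tau>: "\<tau> \<in> ?P" and step: "\<forall>x. (\<lambda>\<omega>. x (block \<tau> \<omega>)) \<in> F"
    let ?D = "\<lambda>B. m B - cond_charge \<mu> \<pi> m B"
    have D: "additive (sets \<mu>) ?D" by (intro additive_diff additive_cond_charge g \<pi>)
    have "\<forall>B. \<exists>x. norm x \<le> 1 \<and> norm (?D B) / 2 \<le> ?D B x" by (intro allI norming_vector)
    then obtain x where x: "\<And>B. norm (x B) \<le> 1" "\<And>B. norm (?D B) / 2 \<le> ?D B (x B)" by metis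
    define f where "f = (\<lambda>\<omega>. x (block \<tau> \<omega>))"
    have f: "simple_function \<mu> f"
      unfolding f_def by (rule simple_function_compose1[OF simple_function_block[OF \<tau>]])
    have fB: "f \<in> ?B" using step x(1) by (auto simp: f_def intro!: sup_norm_le)
    have T: "T f = simple_vm_integral (space \<mu>) m f"
      using has_vm_integral_unique[OF m F has_vm_integral_simple[OF f]] fB by simp
    have "(\<Sum>B\<in>\<tau>. norm (?D B)) / 2 \<le> (\<Sum>B\<in>\<tau>. ?D B (x B))"
      unfolding sum_divide_distrib by (rule sum_mono) (rule x)
    also have "\<dots> = simple_vm_integral (space \<mu>) ?D f"
      using simple_vm_integral_partition[OF D f simple_function_block[OF \<tau>], of x]
      by (simp add: f_def block_image[OF \<tau>] block_level_set[OF \<tau>] cong: sum.cong)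
    also have "\<dots> = T f - cond_exp_op \<mu> m \<pi> f"
      unfolding cond_exp_op_simple[OF g(1) \<pi> f] T
      by (simp add: simple_vm_integral_def blinfun.diff_left sum_subtractf)
    also have "\<dots> \<le> \<bar>cond_exp_op \<mu> m \<pi> f - T f\<bar>" by simp
    also have "\<dots> \<le> ?N \<pi>"
      unfolding functional_norm_def by (rule cSUP_upper[OF fB bdd])
    finally show "(\<Sum>B\<in>\<tau>. norm (?D B)) \<le> \<epsilon>" using N by simp
  qed
qed

text \<open>Well defined on \<open>U_space\<close> by \<open>has_vm_integral_unique\<close>, unspecified elsewhere.\<close>

definition vm_functional :: "'w measure \<Rightarrow> ('w set \<Rightarrow> ('x::real_normed_vector \<Rightarrow>\<^sub>L real)) \<Rightarrow> ('w \<Rightarrow> 'x) \<Rightarrow> real" where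
  "vm_functional \<mu> m f = (THE I. has_vm_integral (space \<mu>) (sets \<mu>) m f I)"

lemma has_vm_integral_vm_functional:
  assumes m: "charge_wrt \<mu> m" and f: "f \<in> U_space (space \<mu>) (sets \<mu>)"
  shows "has_vm_integral (space \<mu>) (sets \<mu>) m f (vm_functional \<mu> m f)"
  unfolding vm_functional_def
  using has_vm_integral_exists[OF m f] has_vm_integral_unique[OF m] by (metis theI)

lemma vm_functional_bounded_linear:
  fixes m :: "'w set \<Rightarrow> ('x::banach \<Rightarrow>\<^sub>L real)"
  assumes m: "charge_wrt \<mu> m" and F: "F \<subseteq> U_space (space \<mu>) (sets \<mu>)"
  shows "bounded_linear_functional (space \<mu>) F (vm_functional \<mu> m)"
proof -
  note T = has_vm_integral_vm_functional[OF m]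
  note g = charge_wrtD[OF m]
  have eq: "vm_functional \<mu> m f = I" if I: "has_vm_integral (space \<mu>) (sets \<mu>) m f I" for f I
    by (rule has_vm_integral_unique[OF m T[OF has_vm_integral_U_space[OF I]] I])
  obtain K where K: "K \<ge> 0" "\<And>\<tau>. \<tau> \<in> finite_partitions (space \<mu>) (sets \<mu>) \<Longrightarrow> (\<Sum>B\<in>\<tau>. norm (m B)) \<le> K"
    by (rule charge_variation_bound[OF m]) blast
  show ?thesis
    unfolding bounded_linear_functional_def
  proof (intro conjI ballI allI exI)
    fix f g assume "f \<in> F" "g \<in> F"
    then show "vm_functional \<mu> m (\<lambda>\<omega>. f \<omega> + g \<omega>) = vm_functional \<mu> m f + vm_functional \<mu> m g"
      using F by (intro eq has_vm_integral_add g T) auto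
  next
    fix c f assume "f \<in> F"
    then show "vm_functional \<mu> m (\<lambda>\<omega>. c *\<^sub>R f \<omega>) = c * vm_functional \<mu> m f"
      using F by (intro eq has_vm_integral_scaleR g T) auto
  next
    fix f assume "f \<in> F"
    then show "\<bar>vm_functional \<mu> m f\<bar> \<le> K * sup_norm (space \<mu>) f"
      using F by (intro vm_integral_bound[OF K(2,1)] T) auto
  qed
qed

section \<open>Oscillation along a sequence of partitions\<close>

text \<open>A partition that exposes the failure of \<open>\<pi>\<close> can be replaced by its common refinement with \<open>\<pi>\<close>, since
the variation sums increase.\<close>

lemma oscillating_refinements:
  assumes G: "charge_wrt \<mu> G" and "\<not> density_approximable \<mu> G"
  obtains \<epsilon> :: real and \<pi> :: "nat \<Rightarrow> 'w set set" where "\<epsilon> > 0"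
    "\<And>n. \<pi> n \<in> finite_partitions (space \<mu>) (sets \<mu>)"
    "\<And>n. refines (space \<mu>) (\<pi> (Suc n)) (\<pi> n)"
    "\<And>n. \<epsilon> < (\<Sum>B\<in>\<pi> (Suc n). norm (G B - cond_charge \<mu> (\<pi> n) G B))"
proof -
  let ?P = "finite_partitions (space \<mu>) (sets \<mu>)"
  note g = charge_wrtD[OF G]
  obtain \<epsilon> :: real where \<epsilon>: "\<epsilon> > 0"
    and *: "\<And>\<pi>. \<pi> \<in> ?P \<Longrightarrow> \<exists>\<tau>\<in>?P. \<epsilon> < (\<Sum>B\<in>\<tau>. norm (G B - cond_charge \<mu> \<pi> G B))"
    using assms(2) unfolding density_approximable_def by (meson not_le)
  have step: "\<exists>\<rho>. \<rho> \<in> ?P \<and> refines (space \<mu>) \<rho> \<pi> \<and> \<epsilon> < (\<Sum>B\<in>\<rho>. norm (G B - cond_charge \<mu> \<pi> G B))"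
    if \<pi>: "\<pi> \<in> ?P" for \<pi>
  proof -
    obtain \<tau> where \<tau>: "\<tau> \<in> ?P" "\<epsilon> < (\<Sum>B\<in>\<tau>. norm (G B - cond_charge \<mu> \<pi> G B))" using *[OF \<pi>] by blast
    obtain \<rho> where \<rho>: "\<rho> \<in> ?P" "refines (space \<mu>) \<rho> \<pi>" "refines (space \<mu>) \<rho> \<tau>"
      by (rule common_refinement_pair[OF \<pi> \<tau>(1)]) auto
    have "additive (sets \<mu>) (\<lambda>B. G B - cond_charge \<mu> \<pi> G B)"
      by (intro additive_diff additive_cond_charge g \<pi>)
    from refines_sum_mono[OF this \<rho>(1) \<tau>(1) \<rho>(3)] \<tau>(2) \<rho> show ?thesis by auto
  qed
  obtain \<pi>\<^sub>0 where "\<pi>\<^sub>0 \<in> ?P" using finite_partitions_nonempty[of "space \<mu>" "sets \<mu>"] by auto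
  then obtain \<pi> where "\<And>n. \<pi> n \<in> ?P"
     "\<And>n. refines (space \<mu>) (\<pi> (Suc n)) (\<pi> n) \<and> \<epsilon> < (\<Sum>B\<in>\<pi> (Suc n). norm (G B - cond_charge \<mu> (\<pi> n) G B))"
    using dependent_nat_choice[of "\<lambda>_ \<pi>. \<pi> \<in> ?P"
        "\<lambda>_ \<pi> \<rho>. refines (space \<mu>) \<rho> \<pi> \<and> \<epsilon> < (\<Sum>B\<in>\<rho>. norm (G B - cond_charge \<mu> \<pi> G B))"] step
    by blast
  then show ?thesis using that[OF \<epsilon>] by blast
qed

text \<open>For a countable union, cut off a tail of small measure and approximate the finitely many remaining
sets with errors that add up to at most half of \<open>\<delta>\<close>.\<close>

lemma approximable_sets_sigma_algebra:
  assumes \<mu>: "finite_measure \<mu>" and alg: "algebra (space \<mu>) \<A>" and "\<A> \<subseteq> sets \<mu>"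
  shows "sigma_algebra (space \<mu>)
    {F \<in> sets \<mu>. \<forall>\<delta>>0. \<exists>A\<in>\<A>. measure \<mu> ((F - A) \<union> (A - F)) < \<delta>}" (is "sigma_algebra _ ?D")
proof -
  interpret finite_measure \<mu> by fact
  interpret A: algebra "space \<mu>" \<A> by fact
  have mA: "A \<in> \<A> \<Longrightarrow> A \<in> sets \<mu>" for A using assms(3) by auto
  show ?thesis
    unfolding sigma_algebra_iff2
  proof (intro conjI allI impI ballI)
    show "?D \<subseteq> Pow (space \<mu>)" using sets.sets_into_space by auto
    show "{} \<in> ?D" by (auto intro!: bexI[of _ "{}"])
    fix F assume F: "F \<in> ?D"
    show "space \<mu> - F \<in> ?D"
    proof (intro CollectI conjI allI impI)
      fix \<delta> :: real assume "\<delta> > 0"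
      then obtain A where A: "A \<in> \<A>" "measure \<mu> ((F - A) \<union> (A - F)) < \<delta>" using F by blast
      have "(space \<mu> - F - (space \<mu> - A)) \<union> (space \<mu> - A - (space \<mu> - F)) = (F - A) \<union> (A - F)"
        using F mA[OF A(1)] sets.sets_into_space by blast
      then show "\<exists>A\<in>\<A>. measure \<mu> ((space \<mu> - F - A) \<union> (A - (space \<mu> - F))) < \<delta>"
        using A by (intro bexI[of _ "space \<mu> - A"]) auto
    qed (use F in auto)
  next
    fix F :: "nat \<Rightarrow> 'a set" assume F: "range F \<subseteq> ?D"
    then have Fs: "F i \<in> sets \<mu>" for i by auto
    show "(\<Union>i. F i) \<in> ?D"
    proof (intro CollectI conjI allI impI)
      fix \<delta> :: real assume \<delta>: "\<delta> > 0"
      define R where "R n = (\<Union>i. F i) - (\<Union>i<n. F i)" for n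
      have R: "R n \<in> sets \<mu>" for n using Fs by (auto simp: R_def)
      have "(\<lambda>n. measure \<mu> (R n)) \<longlonglongrightarrow> measure \<mu> (\<Inter>n. R n)"
        by (rule finite_Lim_measure_decseq) (use R in \<open>auto simp: R_def decseq_def\<close>)
      moreover have "(\<Inter>n. R n) = {}" by (auto simp: R_def)
      ultimately have "(\<lambda>n. measure \<mu> (R n)) \<longlonglongrightarrow> 0" by simp
      then have "\<forall>\<^sub>F n in sequentially. measure \<mu> (R n) < \<delta> / 2" using \<delta> by (intro order_tendstoD) auto
      then obtain n where n: "measure \<mu> (R n) < \<delta> / 2"
        using eventually_happens'[OF sequentially_bot] by blast
      define d where "d = \<delta> / (2 * (real n + 1))"
      have d: "d > 0" using \<delta> by (simp add: d_def)
      have "\<forall>i. \<exists>A\<in>\<A>. measure \<mu> ((F i - A) \<union> (A - F i)) < d" using F d by blast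
      then obtain A where A: "\<And>i. A i \<in> \<A>" "\<And>i. measure \<mu> ((F i - A i) \<union> (A i - F i)) < d" by metis
      let ?A = "\<Union>i<n. A i" and ?S = "\<lambda>i. (F i - A i) \<union> (A i - F i)"
      have S: "?S i \<in> sets \<mu>" for i using Fs mA[OF A(1)] by auto
      have "measure \<mu> (((\<Union>i. F i) - ?A) \<union> (?A - (\<Union>i. F i))) \<le> measure \<mu> (R n \<union> (\<Union>i<n. ?S i))"
        by (rule finite_measure_mono) (use R S in \<open>auto simp: R_def\<close>)
      also have "\<dots> \<le> measure \<mu> (R n) + measure \<mu> (\<Union>i<n. ?S i)"
        by (rule measure_Un_le) (use R S in auto)
      also have "measure \<mu> (\<Union>i<n. ?S i) \<le> (\<Sum>i<n. measure \<mu> (?S i))"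
        by (rule finite_measure_subadditive_finite) (use S in auto)
      also have "\<dots> \<le> real n * d" using sum_bounded_above[of "{..<n}" "\<lambda>i. measure \<mu> (?S i)" d] A(2) by (simp add: less_imp_le)
      also have "\<dots> \<le> \<delta> / 2" using \<delta> by (simp add: d_def field_simps)
      finally have "measure \<mu> (((\<Union>i. F i) - ?A) \<union> (?A - (\<Union>i. F i))) < \<delta>" using n by simp
      moreover have "?A \<in> \<A>" using A(1) by (intro A.finite_UN) auto
      ultimately show "\<exists>A\<in>\<A>. measure \<mu> (((\<Union>i. F i) - A) \<union> (A - (\<Union>i. F i))) < \<delta>" by blast
    qed (use Fs in auto)
  qed
qed

text \<open>The algebra generated by \<open>\<pi>\<close>, described without choosing subfamilies of \<open>\<pi>\<close> so that complements
and refinements are immediate.\<close>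

definition block_unions :: "'w set \<Rightarrow> 'w set set \<Rightarrow> 'w set set" where
  "block_unions \<Omega> \<pi> = {D. D \<subseteq> \<Omega> \<and> (\<forall>A\<in>\<pi>. A \<subseteq> D \<or> A \<inter> D = {})}"

lemma block_unions_measurable:
  assumes \<pi>: "\<pi> \<in> finite_partitions (space \<mu>) (sets \<mu>)"
  shows "block_unions (space \<mu>) \<pi> \<subseteq> sets \<mu>"
proof
  fix D assume D: "D \<in> block_unions (space \<mu>) \<pi>"
  note p = finite_partitionsD[OF \<pi>]
  have "D = \<Union>{A\<in>\<pi>. A \<subseteq> D}"
  proof (intro equalityI subsetI)
    fix x assume x: "x \<in> D"
    then have "x \<in> \<Union>\<pi>" using D p(3) by (auto simp: block_unions_def)
    then obtain A where A: "A \<in> \<pi>" "x \<in> A" by blast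
    with D x have "A \<subseteq> D" by (auto simp: block_unions_def)
    with A show "x \<in> \<Union>{A\<in>\<pi>. A \<subseteq> D}" by blast
  qed blast
  moreover have "\<Union>{A\<in>\<pi>. A \<subseteq> D} \<in> sets \<mu>" using p(1,2) by (intro sets.finite_Union) auto
  ultimately show "D \<in> sets \<mu>" by simp
qed

lemma block_unions_mono:
  "refines \<Omega> \<rho> \<pi> \<Longrightarrow> block_unions \<Omega> \<pi> \<subseteq> block_unions \<Omega> \<rho>"
  by (fastforce simp: block_unions_def refines_def)

lemma incseq_block_unions:
  assumes "\<And>n. refines \<Omega> (\<pi> (Suc n)) (\<pi> n)"
  shows "incseq (\<lambda>n. block_unions \<Omega> (\<pi> n))"
  by (rule incseq_SucI) (rule block_unions_mono[OF assms])

lemma block_unions_algebra: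
  assumes "\<And>n. refines \<Omega> (\<pi> (Suc n)) (\<pi> n)"
  shows "algebra \<Omega> (\<Union>n. block_unions \<Omega> (\<pi> n))"
  unfolding algebra_iff_Un
proof (intro conjI ballI)
  note mono = incseqD[OF incseq_block_unions[of \<Omega> \<pi>, OF assms]]
  fix a b assume "a \<in> (\<Union>n. block_unions \<Omega> (\<pi> n))" "b \<in> (\<Union>n. block_unions \<Omega> (\<pi> n))"
  then obtain m n where "a \<in> block_unions \<Omega> (\<pi> m)" "b \<in> block_unions \<Omega> (\<pi> n)" by blast
  then have "a \<in> block_unions \<Omega> (\<pi> (max m n))" "b \<in> block_unions \<Omega> (\<pi> (max m n))"
    using mono[of m "max m n"] mono[of n "max m n"] by auto
  then have "a \<union> b \<in> block_unions \<Omega> (\<pi> (max m n))" by (auto simp: block_unions_def)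
  then show "a \<union> b \<in> (\<Union>n. block_unions \<Omega> (\<pi> n))" by blast
next
  fix a assume "a \<in> (\<Union>n. block_unions \<Omega> (\<pi> n))"
  then obtain n where n: "a \<in> block_unions \<Omega> (\<pi> n)" by blast
  have "A \<subseteq> \<Omega>" if "A \<in> \<pi> n" for A
    using assms[of n] that by (auto simp: refines_def partition_on_def)
  with n have "\<Omega> - a \<in> block_unions \<Omega> (\<pi> n)" unfolding block_unions_def by blast
  then show "\<Omega> - a \<in> (\<Union>n. block_unions \<Omega> (\<pi> n))" by blast
qed (auto simp: block_unions_def)

lemma step_charge_variation_diff:
  assumes \<mu>: "finite_measure \<mu>" and \<tau>: "\<tau> \<in> finite_partitions (space \<mu>) (sets \<mu>)"
    and F: "\<And>i. i \<in> I \<Longrightarrow> F i \<in> sets \<mu>" and S: "\<And>i. i \<in> I \<Longrightarrow> S i \<in> sets \<mu>"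
  shows "(\<Sum>A\<in>\<tau>. norm (step_charge \<mu> I F c A - step_charge \<mu> I S c A))
    \<le> (\<Sum>i\<in>I. measure \<mu> ((F i - S i) \<union> (S i - F i)) * norm (c i))"
proof -
  interpret finite_measure \<mu> by fact
  let ?R = "\<lambda>i. (F i - S i) \<union> (S i - F i)"
  have diff: "\<bar>measure \<mu> (F i \<inter> A) - measure \<mu> (S i \<inter> A)\<bar> \<le> measure \<mu> (A \<inter> ?R i)"
    if "i \<in> I" "A \<in> sets \<mu>" for i A
  proof -
    have m: "F i \<inter> A \<in> sets \<mu>" "S i \<inter> A \<in> sets \<mu>" "A \<inter> ?R i \<in> sets \<mu>"
      using F[OF that(1)] S[OF that(1)] that(2) by auto
    have "measure \<mu> (F i \<inter> A) \<le> measure \<mu> ((S i \<inter> A) \<union> (A \<inter> ?R i))"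
      "measure \<mu> (S i \<inter> A) \<le> measure \<mu> ((F i \<inter> A) \<union> (A \<inter> ?R i))"
      by (rule finite_measure_mono; use m in auto)+
    moreover have "measure \<mu> ((S i \<inter> A) \<union> (A \<inter> ?R i)) \<le> measure \<mu> (S i \<inter> A) + measure \<mu> (A \<inter> ?R i)"
      "measure \<mu> ((F i \<inter> A) \<union> (A \<inter> ?R i)) \<le> measure \<mu> (F i \<inter> A) + measure \<mu> (A \<inter> ?R i)"
      by (rule measure_Un_le; use m in auto)+
    ultimately show ?thesis by linarith
  qed
  have "(\<Sum>A\<in>\<tau>. norm (step_charge \<mu> I F c A - step_charge \<mu> I S c A))
      \<le> (\<Sum>A\<in>\<tau>. \<Sum>i\<in>I. measure \<mu> (A \<inter> ?R i) * norm (c i))"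
  proof (rule sum_mono)
    fix A assume "A \<in> \<tau>"
    then have A: "A \<in> sets \<mu>" using finite_partitionsD(2)[OF \<tau>] by auto
    have "step_charge \<mu> I F c A - step_charge \<mu> I S c A =
        (\<Sum>i\<in>I. (measure \<mu> (F i \<inter> A) - measure \<mu> (S i \<inter> A)) *\<^sub>R c i)"
      by (simp add: step_charge_def sum_subtractf scaleR_left_diff_distrib)
    also have "norm \<dots> \<le> (\<Sum>i\<in>I. measure \<mu> (A \<inter> ?R i) * norm (c i))"
    proof (rule sum_norm_le)
      fix i assume "i \<in> I"
      from mult_right_mono[OF diff[OF this A] norm_ge_zero[of "c i"]]
      show "norm ((measure \<mu> (F i \<inter> A) - measure \<mu> (S i \<inter> A)) *\<^sub>R c i) \<le> measure \<mu> (A \<inter> ?R i) * norm (c i)"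
        by simp
    qed
    finally show "norm (step_charge \<mu> I F c A - step_charge \<mu> I S c A) \<le> (\<Sum>i\<in>I. measure \<mu> (A \<inter> ?R i) * norm (c i))" .
  qed
  also have "\<dots> = (\<Sum>i\<in>I. (\<Sum>A\<in>\<tau>. measure \<mu> (A \<inter> ?R i)) * norm (c i))"
    by (subst sum.swap) (simp add: sum_distrib_right)
  also have "\<dots> = (\<Sum>i\<in>I. measure \<mu> (?R i) * norm (c i))"
    by (rule sum.cong[OF refl], subst additive_partition_split[OF additive_measure[OF \<mu>] \<tau>])
      (use F S in auto)
  finally show ?thesis .
qed

text \<open>Martingale convergence in the form that is needed. Replace the sets \<open>F i\<close> by unions \<open>S i\<close> of blocks
of some \<open>\<pi> n\<close> at a cost of \<open>\<epsilon>/8\<close> in variation. If \<open>G\<close> were within \<open>\<epsilon>/4\<close> of the original step charge along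
all partitions of the sequence, it would be
within \<open>3\<epsilon>/8\<close> of the new one along \<open>\<pi> n\<close> and \<open>\<pi> (Suc n)\<close>, and
\<open>averaging_error\<close> would bound the oscillation by \<open>3\<epsilon>/4\<close>.\<close>

lemma oscillation_excludes_step_charges:
  assumes \<mu>: "finite_measure \<mu>" and \<pi>: "\<And>n. \<pi> n \<in> finite_partitions (space \<mu>) (sets \<mu>)"
    and ref: "\<And>n. refines (space \<mu>) (\<pi> (Suc n)) (\<pi> n)"
    and osc: "\<And>n. \<epsilon> < (\<Sum>B\<in>\<pi> (Suc n). norm (G B - cond_charge \<mu> (\<pi> n) G B))" and \<epsilon>: "\<epsilon> > 0"
    and I: "finite I"
    and F: "\<And>i. i \<in> I \<Longrightarrow> F i \<in> sigma_sets (space \<mu>) (\<Union>n. block_unions (space \<mu>) (\<pi> n))"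
  shows "\<exists>n. \<epsilon> / 4 < (\<Sum>A\<in>\<pi> n. norm (G A - step_charge \<mu> I F c A))"
proof (rule ccontr)
  assume "\<not> ?thesis"
  then have near: "(\<Sum>A\<in>\<pi> n. norm (G A - step_charge \<mu> I F c A)) \<le> \<epsilon> / 4" for n
    by (simp add: not_less)
  let ?\<A> = "\<Union>n. block_unions (space \<mu>) (\<pi> n)"
  have \<A>: "?\<A> \<subseteq> sets \<mu>" using block_unions_measurable[OF \<pi>] by blast
  \<comment> \<open>The summand 1 only keeps the denominator positive.\<close>
  define \<delta> where "\<delta> = \<epsilon> / (8 * (1 + (\<Sum>i\<in>I. norm (c i))))"
  have pos: "0 < 1 + (\<Sum>i\<in>I. norm (c i))" by (intro add_pos_nonneg sum_nonneg) auto
  have \<delta>: "\<delta> > 0" using \<epsilon> pos by (simp add: \<delta>_def)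
  have "sigma_sets (space \<mu>) ?\<A> \<subseteq>
      {F \<in> sets \<mu>. \<forall>\<delta>>0. \<exists>A\<in>?\<A>. measure \<mu> ((F - A) \<union> (A - F)) < \<delta>}"
  proof (rule sigma_algebra.sigma_sets_subset[OF approximable_sets_sigma_algebra[OF \<mu> block_unions_algebra \<A>]])
    show "?\<A> \<subseteq> {F \<in> sets \<mu>. \<forall>\<delta>>0. \<exists>A\<in>?\<A>. measure \<mu> ((F - A) \<union> (A - F)) < \<delta>}"
    proof
      fix A assume A: "A \<in> ?\<A>"
      have "\<exists>B\<in>?\<A>. measure \<mu> ((A - B) \<union> (B - A)) < \<delta>" if "\<delta> > 0" for \<delta>
        by (rule bexI[OF _ A]) (use that in simp)
      then show "A \<in> {F \<in> sets \<mu>. \<forall>\<delta>>0. \<exists>A\<in>?\<A>. measure \<mu> ((F - A) \<union> (A - F)) < \<delta>}"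
        using A \<A> by blast
    qed
  qed (rule ref)
  then have Fs: "\<And>i. i \<in> I \<Longrightarrow> F i \<in> sets \<mu>"
    and "\<forall>i\<in>I. \<exists>A\<in>?\<A>. measure \<mu> ((F i - A) \<union> (A - F i)) < \<delta>"
    using F \<delta> by blast+
  then obtain S where S: "\<And>i. i \<in> I \<Longrightarrow> S i \<in> ?\<A>" "\<And>i. i \<in> I \<Longrightarrow> measure \<mu> ((F i - S i) \<union> (S i - F i)) < \<delta>"
    by metis
  have Ss: "\<And>i. i \<in> I \<Longrightarrow> S i \<in> sets \<mu>" using S(1) \<A> by blast
  have "\<forall>i\<in>I. \<exists>n. S i \<in> block_unions (space \<mu>) (\<pi> n)" using S(1) by blast
  then obtain k where k: "\<And>i. i \<in> I \<Longrightarrow> S i \<in> block_unions (space \<mu>) (\<pi> (k i))" by metis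
  define n where "n = Max (insert 0 (k ` I))"
  have Sn: "S i \<in> block_unions (space \<mu>) (\<pi> n)" if "i \<in> I" for i
  proof -
    have "k i \<le> n" unfolding n_def using I that by (intro Max_ge) auto
    then show ?thesis using incseqD[OF incseq_block_unions[of "space \<mu>" \<pi>, OF ref]] k[OF that] by blast
  qed
  have near': "(\<Sum>A\<in>\<pi> j. norm (G A - step_charge \<mu> I S c A)) \<le> 3 * \<epsilon> / 8" for j
  proof -
    have "(\<Sum>A\<in>\<pi> j. norm (step_charge \<mu> I F c A - step_charge \<mu> I S c A))
        \<le> (\<Sum>i\<in>I. measure \<mu> ((F i - S i) \<union> (S i - F i)) * norm (c i))"
      by (rule step_charge_variation_diff[OF \<mu> \<pi> Fs Ss])
    also have "\<dots> \<le> (\<Sum>i\<in>I. \<delta> * norm (c i))"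
      by (rule sum_mono) (simp add: mult_right_mono less_imp_le S(2))
    also have "\<dots> \<le> \<epsilon> / 8"
      unfolding sum_distrib_left[symmetric] \<delta>_def using \<epsilon> pos by (simp add: field_simps)
    finally have 1: "(\<Sum>A\<in>\<pi> j. norm (step_charge \<mu> I F c A - step_charge \<mu> I S c A)) \<le> \<epsilon> / 8" .
    have "(\<Sum>A\<in>\<pi> j. norm (G A - step_charge \<mu> I S c A)) \<le>
      (\<Sum>A\<in>\<pi> j. norm (G A - step_charge \<mu> I F c A) + norm (step_charge \<mu> I F c A - step_charge \<mu> I S c A))"
    proof (rule sum_mono)
      fix A
      show "norm (G A - step_charge \<mu> I S c A) \<le>
          norm (G A - step_charge \<mu> I F c A) + norm (step_charge \<mu> I F c A - step_charge \<mu> I S c A)"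
        using norm_triangle_ineq[of "G A - step_charge \<mu> I F c A" "step_charge \<mu> I F c A - step_charge \<mu> I S c A"]
        by simp
    qed
    also have "\<dots> \<le> \<epsilon> / 4 + \<epsilon> / 8" using near[of j] 1 by (simp add: sum.distrib)
    finally show ?thesis by simp
  qed
  have "(\<Sum>B\<in>\<pi> (Suc n). norm (G B - cond_charge \<mu> (\<pi> n) G B))
     \<le> (\<Sum>B\<in>\<pi> (Suc n). norm (G B - step_charge \<mu> I S c B)) + (\<Sum>A\<in>\<pi> n. norm (G A - step_charge \<mu> I S c A))"
    by (rule averaging_error[OF \<mu> \<pi> \<pi> Ss]) (use Sn in \<open>auto simp: block_unions_def\<close>)
  then show False using near'[of "Suc n"] near'[of n] osc[of n] \<epsilon> by simp
qed

section \<open>Coding on a compact Hausdorff space\<close>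

text \<open>A sequence of natural numbers is determined by its graph, a countable set of codes of pairs. The
sequences are taken in the Polish space of real sequences, where finite Borel measures are regular.\<close>

lemma inj_on_nat_sequences:
  assumes "\<exists>i :: real \<Rightarrow> 'a. inj i"
  shows "\<exists>e :: (nat \<Rightarrow> real) \<Rightarrow> 'a. inj_on e {x. \<forall>n. x n \<in> \<nat>}"
proof -
  obtain i :: "real \<Rightarrow> 'a" where i: "inj i" using assms by blast
  obtain r :: "nat set \<Rightarrow> real" where r: "inj r"
    using nat_sets_eqpoll_reals by (auto simp: eqpoll_def bij_betw_def)
  define g where "g x = range (\<lambda>n. prod_encode (n, nat \<lfloor>x n\<rfloor>))" for x :: "nat \<Rightarrow> real"
  have "inj_on g {x. \<forall>n. x n \<in> \<nat>}"
  proof (rule inj_onI, rule ext)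
    fix x y :: "nat \<Rightarrow> real" and n
    assume x: "x \<in> {x. \<forall>n. x n \<in> \<nat>}" and y: "y \<in> {x. \<forall>n. x n \<in> \<nat>}" and "g x = g y"
    then have "prod_encode (n, nat \<lfloor>x n\<rfloor>) \<in> g y" by (auto simp: g_def)
    then have "nat \<lfloor>x n\<rfloor> = nat \<lfloor>y n\<rfloor>" by (auto simp: g_def)
    moreover obtain a b where "x n = real a" "y n = real b" using x y by (metis Nats_cases mem_Collect_eq)
    ultimately show "x n = y n" by simp
  qed
  then have "inj_on (i \<circ> r \<circ> g) {x. \<forall>n. x n \<in> \<nat>}"
    using i r by (auto simp: inj_on_def inj_def)
  then show ?thesis by blast
qed

text \<open>A compact metric space transported along an injection to another type. The \<open>\<sigma>\<close>-algebra and the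
topology are pulled back along the inverse of \<open>e\<close>, so that both are described by sets of the original
space.\<close>

locale compact_copy =
  fixes K :: "'k::metric_space set" and e :: "'k \<Rightarrow> 'a"
  assumes compact_K: "compact K" and inj_e: "inj_on e K"
begin

definition decode :: "'a \<Rightarrow> 'k" where "decode = inv_into K e"

definition copy :: "'a topology" where "copy = pullback_topology (e ` K) decode euclidean"

lemma decode_e [simp]: "x \<in> K \<Longrightarrow> decode (e x) = x"
  by (simp add: decode_def inj_e)

lemma decode_in: "y \<in> e ` K \<Longrightarrow> decode y \<in> K" by auto

lemma openin_copy: "openin copy U \<longleftrightarrow> (\<exists>V. open V \<and> U = decode -` V \<inter> e ` K)"
  by (simp add: copy_def openin_pullback_topology)

lemma topspace_copy [simp]: "topspace copy = e ` K"
  by (simp add: copy_def topspace_pullback_topology)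

lemma compact_space_copy: "compact_space copy"
proof -
  have "continuous_map (top_of_set K) copy e"
    unfolding copy_def
  proof (rule continuous_map_pullback')
    have "continuous_map (top_of_set K) euclidean (\<lambda>x. x)" by (simp add: continuous_map_from_subtopology)
    then show "continuous_map (top_of_set K) euclidean (decode \<circ> e)"
      by (rule continuous_map_eq) simp
  qed auto
  moreover have "compactin (top_of_set K) K" using compact_K by (simp add: compactin_subtopology)
  ultimately have "compactin copy (e ` K)" by (rule image_compactin[rotated])
  then show ?thesis by (simp add: compact_space_def)
qed

lemma Hausdorff_space_copy: "Hausdorff_space copy"
proof (rule Hausdorff_space_injective_preimage[of euclidean _ decode])
  show "continuous_map copy euclidean decode"
    using continuous_map_pullback[of euclidean euclidean "\<lambda>x. x" "e ` K" decode] by (simp add: copy_def comp_def)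
  show "inj_on decode (topspace copy)" by (auto simp: inj_on_def)
  show "Hausdorff_space (euclidean :: 'k topology)" by simp
qed

lemma borel_sets_of_copy: "borel_sets_of copy = {decode -` B \<inter> e ` K | B. B \<in> sets borel}"
proof -
  have "{U. openin copy U} = {decode -` V \<inter> e ` K | V. V \<in> {V. open V}}" by (auto simp: openin_copy)
  then show ?thesis
    unfolding borel_sets_of_def topspace_copy sets_borel
    by (subst sigma_sets_vimage_commute[of decode "e ` K" UNIV]) auto
qed

end

lemma sets_measure_of_borel_sets_of:
  "sets (measure_of (topspace H) {U. openin H U} \<mu>) = borel_sets_of H"
  unfolding borel_sets_of_def by (rule sets_measure_of) (auto dest: openin_subset)

lemma compact_nat_boxes:
  "compact {x :: nat \<Rightarrow> real. \<forall>n. x n \<in> real ` {..<N n}}"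
proof -
  have "compactin (product_topology (\<lambda>_. euclidean) UNIV) (PiE UNIV (\<lambda>n. real ` {..<N n}))"
    unfolding compactin_PiE by (auto intro: finite_imp_compact)
  moreover have "PiE UNIV (\<lambda>n. real ` {..<N n}) = {x :: nat \<Rightarrow> real. \<forall>n. x n \<in> real ` {..<N n}}"
    by (auto simp: PiE_def Pi_def)
  ultimately show ?thesis by (simp add: euclidean_product_topology)
qed

lemma finite_borel_measure_regular:
  fixes B :: "'k::polish_space set"
  assumes M: "finite_measure M" "sets M = sets borel" and B: "B \<in> sets borel" and \<delta>: "\<delta> > 0"
  obtains C U where "compact C" "open U" "C \<subseteq> B" "B \<subseteq> U" "measure M (U - C) < \<delta>"
proof -
  interpret finite_measure M by fact
  have i: "emeasure M B = (SUP K \<in> {K. K \<subseteq> B \<and> compact K}. emeasure M K)"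
    and o: "emeasure M B = (INF U \<in> {U. B \<subseteq> U \<and> open U}. emeasure M U)"
    using inner_regular[of M B] outer_regular[of M B] M B by (auto simp: emeasure_eq_measure)
  obtain C where C: "C \<subseteq> B" "compact C" "measure M B - \<delta> / 2 < measure M C"
  proof (cases "measure M B - \<delta> / 2 < 0")
    case True
    then show ?thesis using that[of "{}"] by simp
  next
    case False
    have "ennreal (measure M B - \<delta> / 2) < emeasure M B"
      using \<delta> False unfolding emeasure_eq_measure by (intro ennreal_lessI) auto
    then obtain C where "C \<subseteq> B" "compact C" "ennreal (measure M B - \<delta> / 2) < emeasure M C"
      unfolding i less_SUP_iff by auto
    then show ?thesis using that[of C] False by (simp add: emeasure_eq_measure ennreal_less_iff)
  qed
  have "emeasure M B < ennreal (measure M B + \<delta> / 2)"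
    using \<delta> unfolding emeasure_eq_measure by (intro ennreal_lessI add_nonneg_pos) auto
  then obtain U where U: "B \<subseteq> U" "open U" "measure M U < measure M B + \<delta> / 2"
    unfolding o INF_less_iff by (auto simp: emeasure_eq_measure ennreal_less_iff)
  have "C \<in> sets M" "U \<in> sets M" using C U M by (auto intro: borel_compact)
  then have "measure M (U - C) = measure M U - measure M C"
    using C U by (intro finite_measure_Diff) auto
  then show ?thesis using that[of C U] C U by simp
qed

text \<open>A charge inherits regularity from the measure that dominates it.\<close>

lemma weakly_regular_charge:
  fixes m :: "'h set \<Rightarrow> ('x::real_normed_vector \<Rightarrow>\<^sub>L real)"
  assumes m: "charge_wrt \<nu> m" and sets: "sets \<nu> = borel_sets_of H"
    and reg: "\<And>A \<delta>. A \<in> borel_sets_of H \<Longrightarrow> \<delta> > 0 \<Longrightarrow>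
      \<exists>K U. closedin H K \<and> openin H U \<and> K \<subseteq> A \<and> A \<subseteq> U \<and> measure \<nu> (U - K) < \<delta>"
  shows "weakly_regular H m"
  unfolding weakly_regular_def
proof (intro allI conjI)
  fix x
  note g = charge_wrtD[OF m]
  interpret finite_measure \<nu> by (rule g)
  show "vector_measure (borel_sets_of H) (\<lambda>A. m A x)"
    using charge_vector_measure[OF m] unfolding vector_measure_def sets
    by (auto intro!: bounded_linear.sums[OF blinfun.bounded_linear_left])
  show "regular_set_function H (\<lambda>A. m A x)"
    unfolding regular_set_function_def
  proof (intro ballI allI impI)
    fix A and \<epsilon> :: real assume A: "A \<in> borel_sets_of H" and \<epsilon>: "\<epsilon> > 0"
    have "\<epsilon> / (norm x + 1) > 0" using \<epsilon> by (simp add: add_nonneg_pos)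
    then obtain \<delta> where \<delta>: "\<delta> > 0" "\<And>A. A \<in> sets \<nu> \<Longrightarrow> measure \<nu> A < \<delta> \<Longrightarrow> norm (m A) < \<epsilon> / (norm x + 1)"
      using g(4) unfolding continuous_wrt_def by metis
    obtain K U where KU: "closedin H K" "openin H U" "K \<subseteq> A" "A \<subseteq> U" "measure \<nu> (U - K) < \<delta>"
      using reg[OF A \<delta>(1)] by blast
    have Km: "U - K \<in> sets \<nu>"
    proof -
      have "U - K = U \<inter> (topspace H - K)" using openin_subset[OF KU(2)] by auto
      moreover have "openin H (U \<inter> (topspace H - K))" using KU(1,2) by (intro openin_Int openin_diff) auto
      ultimately show ?thesis unfolding sets borel_sets_of_def by (intro sigma_sets.Basic) auto
    qed
    have "\<bar>m C x\<bar> < \<epsilon>" if C: "C \<in> borel_sets_of H" "C \<subseteq> U - K" for C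
    proof -
      have "measure \<nu> C \<le> measure \<nu> (U - K)" using C Km sets by (intro finite_measure_mono) auto
      then have "norm (m C) < \<epsilon> / (norm x + 1)" using \<delta>(2)[of C] C sets KU(5) by auto
      then have "norm (m C) * (norm x + 1) < \<epsilon>" by (simp add: pos_less_divide_eq add_nonneg_pos)
      moreover have "\<bar>m C x\<bar> \<le> norm (m C) * (norm x + 1)"
        using norm_blinfun[of "m C" x] by (simp add: distrib_left add_increasing2)
      ultimately show ?thesis by simp
    qed
    then show "\<exists>K U. closedin H K \<and> openin H U \<and> K \<subseteq> A \<and> A \<subseteq> U \<and>
        (\<forall>C\<in>borel_sets_of H. C \<subseteq> U - K \<longrightarrow> \<bar>m C x\<bar> < \<epsilon>)" using KU by blast
  qed
qed

text \<open>Taking preimages commutes with all set operations, and \<open>variation_bound_disjoint_family\<close> absorbs blocks with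
empty preimage.\<close>

lemma charge_wrt_image:
  assumes G: "charge_wrt \<mu> G" and f: "f \<in> measurable \<mu> N"
  shows "charge_wrt (distr \<mu> N f) (\<lambda>E. G (f -` E \<inter> space \<mu>))"
proof -
  note g = charge_wrtD[OF G]
  have m: "E \<in> sets N \<Longrightarrow> f -` E \<inter> space \<mu> \<in> sets \<mu>" for E using f by (rule measurable_sets)
  obtain K where K: "\<And>\<tau>. \<tau> \<in> finite_partitions (space \<mu>) (sets \<mu>) \<Longrightarrow> (\<Sum>B\<in>\<tau>. norm (G B)) \<le> K"
    by (rule charge_variation_bound[OF G]) blast
  show ?thesis
    unfolding charge_wrt_def
  proof (intro conjI)
    show "finite_measure (distr \<mu> N f)" using finite_measure.finite_measure_distr[OF g(1) f] .
    show "additive (sets (distr \<mu> N f)) (\<lambda>E. G (f -` E \<inter> space \<mu>))"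
      unfolding additive_def
    proof (intro ballI impI)
      fix A B assume "A \<in> sets (distr \<mu> N f)" "B \<in> sets (distr \<mu> N f)" "A \<inter> B = {}"
      moreover have "f -` (A \<union> B) \<inter> space \<mu> = (f -` A \<inter> space \<mu>) \<union> (f -` B \<inter> space \<mu>)" by auto
      ultimately show "G (f -` (A \<union> B) \<inter> space \<mu>) = G (f -` A \<inter> space \<mu>) + G (f -` B \<inter> space \<mu>)"
        using additiveD[OF g(2), of "f -` A \<inter> space \<mu>" "f -` B \<inter> space \<mu>"] m by auto
    qed
    show "bounded_variation (space (distr \<mu> N f)) (sets (distr \<mu> N f)) (\<lambda>E. G (f -` E \<inter> space \<mu>))"
      unfolding bounded_variation_def
    proof (intro exI[of _ K] ballI)
      fix \<tau> assume \<tau>: "\<tau> \<in> finite_partitions (space (distr \<mu> N f)) (sets (distr \<mu> N f))"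
      note t = finite_partitionsD[OF \<tau>]
      show "(\<Sum>A\<in>\<tau>. norm (G (f -` A \<inter> space \<mu>))) \<le> K"
      proof (rule variation_bound_disjoint_family[OF K additive_empty[OF g(2)] t(1)])
        show "(\<lambda>A. f -` A \<inter> space \<mu>) ` \<tau> \<subseteq> sets \<mu>" using t(2) m by auto
        show "disjoint_family_on (\<lambda>A. f -` A \<inter> space \<mu>) \<tau>"
          using disjointD[OF t(4)] by (fastforce simp: disjoint_family_on_def)
      qed
    qed
    show "continuous_wrt (\<lambda>E. G (f -` E \<inter> space \<mu>)) (distr \<mu> N f)"
      unfolding continuous_wrt_def
    proof (intro allI impI)
      fix \<epsilon> :: real assume "\<epsilon> > 0"
      then obtain \<delta> where "\<delta> > 0" "\<And>A. A \<in> sets \<mu> \<Longrightarrow> measure \<mu> A < \<delta> \<Longrightarrow> norm (G A) < \<epsilon>"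
        using g(4) unfolding continuous_wrt_def by metis
      then show "\<exists>\<delta>>0. \<forall>A\<in>sets (distr \<mu> N f). measure (distr \<mu> N f) A < \<delta> \<longrightarrow> norm (G (f -` A \<inter> space \<mu>)) < \<epsilon>"
        using m by (auto simp: measure_distr[OF f] intro!: exI[of _ \<delta>])
    qed
  qed
qed

text \<open>The model lives on a copy \<open>e ` K\<close> of the product \<open>K\<close> of the finite sets of block numbers. A point of
the original space goes to its sequence of block numbers, and the cylinder \<open>C n A\<close> has \<open>A\<close> as its
preimage. Thus the variation of the image charge along \<open>\<tau> n\<close> is the variation of \<open>G\<close> along \<open>\<pi> n\<close>, and
every average of the image charge pulls back to a step charge whose sets are generated by the
partitions \<open>\<pi> n\<close>.\<close>

lemma non_approximable_compact_model:
  fixes G :: "'b set \<Rightarrow> 'v::real_normed_vector"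
  assumes inj: "\<exists>i :: real \<Rightarrow> 'a. inj i" and G: "charge_wrt \<mu> G" and not: "\<not> density_approximable \<mu> G"
  obtains H :: "'a topology" and \<nu> :: "'a measure" and G' :: "'a set \<Rightarrow> 'v"
    and \<tau> :: "nat \<Rightarrow> 'a set set" and \<epsilon> :: real
  where "compact_space H" "Hausdorff_space H" "space \<nu> = topspace H" "sets \<nu> = borel_sets_of H"
    "charge_wrt \<nu> G'"
    "\<forall>A\<in>borel_sets_of H. \<forall>\<delta>>0.
      \<exists>K U. closedin H K \<and> openin H U \<and> K \<subseteq> A \<and> A \<subseteq> U \<and> measure \<nu> (U - K) < \<delta>"
    "\<forall>n. \<tau> n \<in> finite_partitions (space \<nu>) (sets \<nu>)" "\<forall>n. \<forall>A\<in>\<tau> n. openin H A"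
    "\<epsilon> > 0"
    "\<forall>\<pi>\<in>finite_partitions (space \<nu>) (sets \<nu>).
       \<exists>n. \<epsilon> < (\<Sum>C\<in>\<tau> n. norm (G' C - cond_charge \<nu> \<pi> G' C))"
proof -
  note g = charge_wrtD[OF G]
  obtain \<epsilon> :: real and \<pi> :: "nat \<Rightarrow> 'b set set" where \<epsilon>: "\<epsilon> > 0"
    and \<pi>: "\<And>n. \<pi> n \<in> finite_partitions (space \<mu>) (sets \<mu>)"
    and ref: "\<And>n. refines (space \<mu>) (\<pi> (Suc n)) (\<pi> n)"
    and osc: "\<And>n. \<epsilon> < (\<Sum>B\<in>\<pi> (Suc n). norm (G B - cond_charge \<mu> (\<pi> n) G B))"
    by (rule oscillating_refinements[OF G not]) blast
  note p = finite_partitionsD[OF \<pi>]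
  have "\<forall>n. \<exists>h. inj_on h (\<pi> n) \<and> (\<exists>N::nat. h ` \<pi> n = {i. i < N})"
    using finite_imp_inj_to_nat_seg[OF p(1)] by metis
  then obtain h :: "nat \<Rightarrow> 'b set \<Rightarrow> nat" and N where h: "\<And>n. inj_on (h n) (\<pi> n)" "\<And>n. h n ` \<pi> n = {..<N n}"
    unfolding lessThan_def by metis
  define K where "K = {x :: nat \<Rightarrow> real. \<forall>n. x n \<in> real ` {..<N n}}"
  obtain e :: "(nat \<Rightarrow> real) \<Rightarrow> 'a" where e: "inj_on e {x. \<forall>n. x n \<in> \<nat>}"
    using inj_on_nat_sequences[OF inj] by blast
  have "x n \<in> \<nat>" if "x \<in> K" for x n
  proof -
    have "x n \<in> real ` {..<N n}" using that by (simp add: K_def)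
    then show ?thesis by auto
  qed
  then have "inj_on e K" by (intro inj_on_subset[OF e]) auto
  then interpret compact_copy K e
    by unfold_locales (simp_all add: K_def compact_nat_boxes)
  define \<phi> where "\<phi> \<omega> = (\<lambda>n. real (h n (block (\<pi> n) \<omega>)))" for \<omega>
  have \<phi>K: "\<phi> \<omega> \<in> K" if "\<omega> \<in> space \<mu>" for \<omega>
    using block_in(1)[OF \<pi> that] h(2) unfolding K_def \<phi>_def by blast
  have \<phi>_meas: "\<phi> \<in> borel_measurable M"
    if "\<And>n. \<pi> n \<in> finite_partitions (space M) (sets M)" for M
    unfolding \<phi>_def
    by (intro measurable_coordinatewise_then_product borel_measurable_simple_function
        simple_function_compose1[OF simple_function_block[OF that]])
  define \<psi> where "\<psi> = e \<circ> \<phi>"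
  have \<psi>E: "\<psi> \<omega> \<in> e ` K" if "\<omega> \<in> space \<mu>" for \<omega> using \<phi>K[OF that] by (simp add: \<psi>_def)
  have pre: "\<psi> -` (decode -` B \<inter> e ` K) \<inter> space \<mu> = \<phi> -` B \<inter> space \<mu>" for B
    using \<phi>K \<psi>E by (auto simp: \<psi>_def)
  define N' where "N' = measure_of (topspace copy) {U. openin copy U} (\<lambda>_. 0)"
  have sN: "sets N' = borel_sets_of copy" "space N' = e ` K"
    unfolding N'_def sets_measure_of_borel_sets_of by (auto simp: space_measure_of_conv)
  have \<psi>: "\<psi> \<in> measurable \<mu> N'"
  proof (rule measurableI)
    fix A assume "A \<in> sets N'"
    then obtain B where "B \<in> sets borel" "A = decode -` B \<inter> e ` K" by (auto simp: sN borel_sets_of_copy)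
    then show "\<psi> -` A \<inter> space \<mu> \<in> sets \<mu>"
      using pre measurable_sets[OF \<phi>_meas[OF \<pi>]] by simp
  qed (use \<psi>E sN in auto)
  define \<nu> where "\<nu> = distr \<mu> N' \<psi>"
  define G' where "G' E = G (\<psi> -` E \<inter> space \<mu>)" for E
  have s\<nu>: "sets \<nu> = borel_sets_of copy" "space \<nu> = e ` K" by (auto simp: \<nu>_def sN)
  have m\<nu>: "measure \<nu> A = measure \<mu> (\<psi> -` A \<inter> space \<mu>)" if "A \<in> sets \<nu>" for A
    using that measure_distr[OF \<psi>] by (simp add: \<nu>_def)
  have G': "charge_wrt \<nu> G'"
    unfolding \<nu>_def G'_def by (rule charge_wrt_image[OF G \<psi>])
  define C where "C n A = {y \<in> e ` K. decode y n = real (h n A)}" for n A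
  have C_open: "openin copy (C n A)" for n A
    unfolding openin_copy
  proof (intro exI conjI)
    \<comment> \<open>The coordinates of points of \<open>K\<close> are natural numbers, so distance less than 1 means
      equality.\<close>
    show "open {x :: nat \<Rightarrow> real. \<bar>x n - real (h n A)\<bar> < 1}"
      by (intro open_Collect_less continuous_intros continuous_on_product_coordinates)
    have "decode y n = real (h n A)" if "\<bar>decode y n - real (h n A)\<bar> < 1" and y: "y \<in> e ` K" for y
    proof -
      obtain k where k: "decode y n = real k" using decode_in[OF y] unfolding K_def by blast
      then have "k = h n A" using that(1) by linarith
      with k show ?thesis by simp
    qed
    then show "C n A = decode -` {x. \<bar>x n - real (h n A)\<bar> < 1} \<inter> e ` K" by (auto simp: C_def)
  qed
  have C_sets: "C n A \<in> sets \<nu>" for n A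
    unfolding s\<nu> borel_sets_of_def using C_open by (intro sigma_sets.Basic) auto
  have C_pre: "\<psi> -` C n A \<inter> space \<mu> = A" if "A \<in> \<pi> n" for n A
  proof -
    have "\<psi> \<omega> \<in> C n A \<longleftrightarrow> block (\<pi> n) \<omega> = A" if \<omega>: "\<omega> \<in> space \<mu>" for \<omega>
      using \<phi>K[OF \<omega>] \<psi>E[OF \<omega>] inj_onD[OF h(1) _ block_in(1)[OF \<pi> \<omega>] \<open>A \<in> \<pi> n\<close>]
      by (auto simp: C_def \<psi>_def \<phi>_def)
    then have "\<psi> -` C n A \<inter> space \<mu> = {\<omega>\<in>space \<mu>. block (\<pi> n) \<omega> = A}" by auto
    then show ?thesis using block_level_set[OF \<pi> that] by simp
  qed
  define \<tau> where "\<tau> n = C n ` \<pi> n" for n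
  have inj_C: "inj_on (C n) (\<pi> n)" for n by (rule inj_onI) (metis C_pre)
  have \<tau>: "\<tau> n \<in> finite_partitions (space \<nu>) (sets \<nu>)" for n
    unfolding finite_partitions_def partition_on_def
  proof (intro CollectI conjI)
    show "finite (\<tau> n)" "\<tau> n \<subseteq> sets \<nu>" using p(1) C_sets by (auto simp: \<tau>_def)
    show "\<Union>(\<tau> n) = space \<nu>"
    proof
      show "\<Union>(\<tau> n) \<subseteq> space \<nu>" by (auto simp: \<tau>_def C_def s\<nu>)
      show "space \<nu> \<subseteq> \<Union>(\<tau> n)"
      proof
        fix y assume y: "y \<in> space \<nu>"
        then have "decode y \<in> K" using decode_in s\<nu> by auto
        then have "decode y n \<in> real ` h n ` \<pi> n" unfolding K_def h(2) by blast
        then obtain A where "A \<in> \<pi> n" "decode y n = real (h n A)" by blast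
        then show "y \<in> \<Union>(\<tau> n)" using y s\<nu> by (auto simp: \<tau>_def C_def)
      qed
    qed
    show "disjoint (\<tau> n)" by (rule disjointI) (auto simp: \<tau>_def C_def)
    show "{} \<notin> \<tau> n"
    proof
      assume "{} \<in> \<tau> n"
      then obtain A where "A \<in> \<pi> n" "C n A = {}" by (auto simp: \<tau>_def)
      then show False using C_pre[of A n] p(5)[of n] by auto
    qed
  qed
  \<comment> \<open>The coordinates of \<open>\<phi>\<close> are constant on blocks, so \<open>\<phi>\<close> is measurable already for the
    \<open>\<sigma>\<close>-algebra generated by the partitions.\<close>
  have borel_pre: "\<psi> -` E \<inter> space \<mu> \<in> sigma_sets (space \<mu>) (\<Union>n. block_unions (space \<mu>) (\<pi> n))"
    if E: "E \<in> sets \<nu>" for E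
  proof -
    let ?\<A> = "\<Union>n. block_unions (space \<mu>) (\<pi> n)"
    define M where "M = sigma (space \<mu>) ?\<A>"
    have M: "space M = space \<mu>" "sets M = sigma_sets (space \<mu>) ?\<A>"
      unfolding M_def by (auto simp: space_measure_of_conv block_unions_def intro!: sets_measure_of)
    have "A \<in> ?\<A>" if "A \<in> \<pi> n" for A n
      using that p(3) disjointD[OF p(4)] by (fastforce simp: block_unions_def)
    then have "\<pi> n \<in> finite_partitions (space M) (sets M)" for n
      using \<pi>[of n] unfolding finite_partitions_def M by (auto intro: sigma_sets.Basic)
    then have \<phi>M: "\<phi> \<in> borel_measurable M" by (rule \<phi>_meas)
    obtain B where "B \<in> sets borel" "E = decode -` B \<inter> e ` K"
      using E by (auto simp: s\<nu> borel_sets_of_copy)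
    then show ?thesis using measurable_sets[OF \<phi>M] pre M by simp
  qed
  show ?thesis
  proof (rule that[of copy \<nu> G' \<tau> "\<epsilon> / 4"])
    show "compact_space copy" "Hausdorff_space copy" by (rule compact_space_copy Hausdorff_space_copy)+
    show "space \<nu> = topspace copy" "sets \<nu> = borel_sets_of copy" by (simp_all add: s\<nu>)
    show "charge_wrt \<nu> G'" by (rule G')
    show "\<forall>n. \<tau> n \<in> finite_partitions (space \<nu>) (sets \<nu>)" using \<tau> by blast
    show "\<forall>n. \<forall>A\<in>\<tau> n. openin copy A" using C_open by (auto simp: \<tau>_def)
    show "\<epsilon> / 4 > 0" using \<epsilon> by simp
    show "\<forall>A\<in>borel_sets_of copy. \<forall>\<delta>>0. \<exists>L U. closedin copy L \<and> openin copy U \<and> L \<subseteq> A \<and> A \<subseteq> U \<and>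
        measure \<nu> (U - L) < \<delta>"
    proof (intro ballI allI impI)
      fix A and \<delta> :: real assume A: "A \<in> borel_sets_of copy" and \<delta>: "\<delta> > 0"
      obtain B where B: "B \<in> sets borel" "A = decode -` B \<inter> e ` K" using A by (auto simp: borel_sets_of_copy)
      have \<phi>b: "\<phi> \<in> borel_measurable \<mu>" by (rule \<phi>_meas[OF \<pi>])
      obtain L U where LU: "compact L" "open U" "L \<subseteq> B" "B \<subseteq> U" "measure (distr \<mu> borel \<phi>) (U - L) < \<delta>"
        by (rule finite_borel_measure_regular[OF finite_measure.finite_measure_distr[OF g(1) \<phi>b] _ B(1) \<delta>]) auto
      let ?D = "\<lambda>S. decode -` S \<inter> e ` K"
      have UL: "U - L \<in> sets borel" using LU by (auto intro: borel_compact)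
      have "?D U - ?D L = ?D (U - L)" by auto
      moreover have "?D (U - L) \<in> sets \<nu>" using UL by (auto simp: s\<nu> borel_sets_of_copy)
      ultimately have "measure \<nu> (?D U - ?D L) < \<delta>"
        using LU(5) m\<nu> pre measure_distr[OF \<phi>b UL] by simp
      moreover have "openin copy (?D U)" using LU(2) by (auto simp: openin_copy)
      moreover have "closedin copy (?D L)"
      proof -
        have "e ` K - ?D L = ?D (- L)" by auto
        moreover have "open (- L)" using LU(1) compact_imp_closed by blast
        ultimately have "openin copy (e ` K - ?D L)" by (auto simp: openin_copy)
        then show ?thesis by (simp add: closedin_def)
      qed
      moreover have "?D L \<subseteq> A" "A \<subseteq> ?D U" using B(2) LU(3,4) by auto
      ultimately show "\<exists>L U. closedin copy L \<and> openin copy U \<and> L \<subseteq> A \<and> A \<subseteq> U \<and> measure \<nu> (U - L) < \<delta>"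
        by blast
    qed
    show "\<forall>\<rho>\<in>finite_partitions (space \<nu>) (sets \<nu>). \<exists>n. \<epsilon> / 4 < (\<Sum>E\<in>\<tau> n. norm (G' E - cond_charge \<nu> \<rho> G' E))"
    proof
      fix \<rho> assume \<rho>: "\<rho> \<in> finite_partitions (space \<nu>) (sets \<nu>)"
      note r = finite_partitionsD[OF \<rho>]
      let ?F = "\<lambda>B. \<psi> -` B \<inter> space \<mu>" and ?c = "\<lambda>B. G' B /\<^sub>R measure \<nu> B"
      obtain n where n: "\<epsilon> / 4 < (\<Sum>A\<in>\<pi> n. norm (G A - step_charge \<mu> \<rho> ?F ?c A))"
        using oscillation_excludes_step_charges[where \<pi> = \<pi> and G = G and F = ?F and c = ?c,
            OF g(1) \<pi> ref osc \<epsilon> r(1)] borel_pre r(2) by blast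
      have "(\<Sum>E\<in>\<tau> n. norm (G' E - cond_charge \<nu> \<rho> G' E)) = (\<Sum>A\<in>\<pi> n. norm (G A - step_charge \<mu> \<rho> ?F ?c A))"
        unfolding \<tau>_def sum.reindex[OF inj_C] comp_def
      proof (rule sum.cong[OF refl])
        fix A assume A: "A \<in> \<pi> n"
        have "measure \<nu> (B \<inter> C n A) = measure \<mu> (?F B \<inter> A)" if "B \<in> \<rho>" for B
        proof -
          have "B \<inter> C n A \<in> sets \<nu>" using that r(2) C_sets by auto
          moreover have "?F (B \<inter> C n A) = ?F B \<inter> A" using C_pre[OF A] by auto
          ultimately show ?thesis using m\<nu> by simp
        qed
        then have "cond_charge \<nu> \<rho> G' (C n A) = step_charge \<mu> \<rho> ?F ?c A"
          unfolding cond_charge_eq_step_charge step_charge_def by simp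
        then show "norm (G' (C n A) - cond_charge \<nu> \<rho> G' (C n A)) = norm (G A - step_charge \<mu> \<rho> ?F ?c A)"
          by (simp add: G'_def C_pre[OF A])
      qed
      then show "\<exists>n. \<epsilon> / 4 < (\<Sum>E\<in>\<tau> n. norm (G' E - cond_charge \<nu> \<rho> G' E))"
        using n by (intro exI[of _ n]) simp
    qed
  qed
qed

text \<open>The range of a continuous function on a compact space is totally bounded. Given a finite net, send
each point to an element of the net near its value, choosing among several by induction over the net.\<close>

lemma C_space_subset_U_space:
  assumes "compact_space H"
  shows "C_space H \<subseteq> U_space (topspace H) (borel_sets_of H)"
proof
  fix f :: "'a \<Rightarrow> 'b" assume "f \<in> C_space H"
  then have f: "continuous_map H euclidean f" by (simp add: C_space_def)
  let ?M = "sigma (topspace H) (borel_sets_of H)"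
  have "borel_sets_of H \<subseteq> Pow (topspace H)"
    unfolding borel_sets_of_def using sigma_sets_into_sp[of "{U. openin H U}" "topspace H"] by (auto dest: openin_subset)
  then have op: "U \<in> sets ?M" if "openin H U" for U
    using that by (subst sets_measure_of) (auto simp: borel_sets_of_def)
  have sp: "space ?M = topspace H" by (simp add: space_measure_of_conv)
  have "\<exists>s. simple_function ?M s \<and> (\<forall>\<omega>\<in>topspace H. dist (s \<omega>) (f \<omega>) < e)" if e: "e > 0" for e
  proof -
    have "compactin euclidean (f ` topspace H)"
      using assms f unfolding compact_space_def by (rule image_compactin)
    then have "compact (f ` topspace H)" by simp
    then obtain k where k: "finite k" "f ` topspace H \<subseteq> (\<Union>x\<in>k. ball x e)"
      using e unfolding compact_eq_totally_bounded by blast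
    have "\<exists>s. simple_function ?M s \<and>
        (\<forall>\<omega>\<in>topspace H. f \<omega> \<in> (\<Union>x\<in>k. ball x e) \<longrightarrow> dist (s \<omega>) (f \<omega>) < e)"
      using k(1)
    proof induction
      case empty
      show ?case by (rule exI[of _ "\<lambda>_. undefined"]) simp
    next
      case (insert x k)
      then obtain s where s: "simple_function ?M s"
        "\<forall>\<omega>\<in>topspace H. f \<omega> \<in> (\<Union>x\<in>k. ball x e) \<longrightarrow> dist (s \<omega>) (f \<omega>) < e" by blast
      have "{\<omega>\<in>space ?M. f \<omega> \<in> ball x e} \<in> sets ?M"
        unfolding sp using f by (intro op openin_continuous_map_preimage) auto
      then have "simple_function ?M (\<lambda>\<omega>. if f \<omega> \<in> ball x e then x else s \<omega>)"
        by (intro simple_function_If s(1) simple_function_const)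
      then show ?case using s(2)
        by (intro exI[of _ "\<lambda>\<omega>. if f \<omega> \<in> ball x e then x else s \<omega>"]) auto
    qed
    then show ?thesis using k(2) by blast
  qed
  then have "\<forall>n. \<exists>s. simple_function ?M s \<and> (\<forall>\<omega>\<in>topspace H. dist (s \<omega>) (f \<omega>) < inverse (real (Suc n)))"
    by simp
  then obtain s where s: "\<And>n. simple_function ?M (s n)"
    "\<And>n \<omega>. \<omega> \<in> topspace H \<Longrightarrow> dist (s n \<omega>) (f \<omega>) < inverse (real (Suc n))" by metis
  have "uniform_limit (topspace H) s f sequentially"
  proof (rule uniform_limitI)
    fix e :: real assume "e > 0"
    then have "\<forall>\<^sub>F n in sequentially. inverse (real (Suc n)) < e"
      using LIMSEQ_inverse_real_of_nat by (intro order_tendstoD)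
    then show "\<forall>\<^sub>F n in sequentially. \<forall>\<omega>\<in>topspace H. dist (s n \<omega>) (f \<omega>) < e"
      by eventually_elim (meson s(2) less_trans)
  qed
  with s(1) show "f \<in> U_space (topspace H) (borel_sets_of H)"
    by (auto simp: U_space_def simple_on_def)
qed

section \<open>The equivalences\<close>

definition all_charges_approximable :: "'a itself \<Rightarrow> 'v::real_normed_vector itself \<Rightarrow> bool" where
  "all_charges_approximable _ _ \<longleftrightarrow>
     (\<forall>(\<mu>::'a measure) (G::'a set \<Rightarrow> 'v). charge_wrt \<mu> G \<longrightarrow> density_approximable \<mu> G)"

text \<open>Only \<open>'a\<close> has to be large, because the compact model of a charge on \<open>'b\<close> that is not
approximable fits into \<open>'a\<close>.\<close>

lemma all_charges_approximable_transfer: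
  assumes inj: "\<exists>i :: real \<Rightarrow> 'a. inj i"
    and all: "all_charges_approximable TYPE('a) TYPE('v::real_normed_vector)"
  shows "all_charges_approximable TYPE('b) TYPE('v)"
  unfolding all_charges_approximable_def
proof (intro allI impI, rule ccontr)
  fix \<mu> :: "'b measure" and G :: "'b set \<Rightarrow> 'v"
  assume G: "charge_wrt \<mu> G" "\<not> density_approximable \<mu> G"
  obtain H :: "'a topology" and \<nu> :: "'a measure" and G' :: "'a set \<Rightarrow> 'v" and \<tau> and \<epsilon> :: real
    where model: "charge_wrt \<nu> G'" "\<forall>n. \<tau> n \<in> finite_partitions (space \<nu>) (sets \<nu>)" "\<epsilon> > 0"
    "\<forall>\<pi>\<in>finite_partitions (space \<nu>) (sets \<nu>).
       \<exists>n::nat. \<epsilon> < (\<Sum>C\<in>\<tau> n. norm (G' C - cond_charge \<nu> \<pi> G' C))"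
    by (rule non_approximable_compact_model[OF inj G])
  have "density_approximable \<nu> G'" using all model(1) by (simp add: all_charges_approximable_def)
  then obtain \<pi> where "\<pi> \<in> finite_partitions (space \<nu>) (sets \<nu>)"
    "\<And>\<tau>. \<tau> \<in> finite_partitions (space \<nu>) (sets \<nu>) \<Longrightarrow> (\<Sum>C\<in>\<tau>. norm (G' C - cond_charge \<nu> \<pi> G' C)) \<le> \<epsilon>"
    using model(3) unfolding density_approximable_def by blast
  then show False using model(2,4) by (metis not_less)
qed

lemma continuous_block_function:
  fixes x :: "'h set \<Rightarrow> 'x::real_normed_vector"
  assumes \<tau>: "\<tau> \<in> finite_partitions (topspace H) \<Sigma>" and op: "\<And>A. A \<in> \<tau> \<Longrightarrow> openin H A"
  shows "(\<lambda>\<omega>. x (block \<tau> \<omega>)) \<in> C_space H"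
  unfolding C_space_def continuous_map_def
proof (intro CollectI conjI allI impI)
  fix U :: "'x set" assume "openin euclidean U"
  have "{\<omega>\<in>topspace H. x (block \<tau> \<omega>) \<in> U} = \<Union>{A\<in>\<tau>. x A \<in> U}"
  proof (intro equalityI subsetI)
    fix \<omega> assume "\<omega> \<in> {\<omega>\<in>topspace H. x (block \<tau> \<omega>) \<in> U}"
    then show "\<omega> \<in> \<Union>{A\<in>\<tau>. x A \<in> U}" using block_in[OF \<tau>] by blast
  next
    fix \<omega> assume "\<omega> \<in> \<Union>{A\<in>\<tau>. x A \<in> U}"
    then obtain A where A: "A \<in> \<tau>" "\<omega> \<in> A" "x A \<in> U" by blast
    moreover have "\<omega> \<in> topspace H" using A finite_partitionsD(3)[OF \<tau>] by blast
    ultimately show "\<omega> \<in> {\<omega>\<in>topspace H. x (block \<tau> \<omega>) \<in> U}" using block_eq[OF \<tau>] by simp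
  qed
  then show "openin H {\<omega>\<in>topspace H. x (block \<tau> \<omega>) \<in> U}" using op by auto
qed simp

lemma represents_on_C_charge:
  assumes "represents_on_C H m T" "finite_measure \<mu>" "space \<mu> = topspace H" "sets \<mu> = borel_sets_of H"
    "continuous_wrt m \<mu>"
  shows "charge_wrt \<mu> m"
  using assms by (simp add: charge_wrt_def represents_on_C_def finite_semivariation_iff_bounded_variation)

lemma represents_on_U_charge:
  assumes "represents_on_U (space \<mu>) (sets \<mu>) m T" "finite_measure \<mu>" "continuous_wrt m \<mu>"
  shows "charge_wrt \<mu> m"
  using assms by (simp add: charge_wrt_def represents_on_U_def finite_semivariation_iff_bounded_variation)

text \<open>From right to left the compact space is arbitrary. From left to right convergence is used
only on the compact model of a charge that is not approximable, where the oscillation is visible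
along partitions into open sets.\<close>

lemma convergence_on_C_iff_approximable:
  assumes inj: "\<exists>i :: real \<Rightarrow> 'h. inj i"
  shows "(\<forall>(H :: 'h topology) (T :: ('h \<Rightarrow> 'x::banach) \<Rightarrow> real) (m :: 'h set \<Rightarrow> ('x \<Rightarrow>\<^sub>L real))
          (\<mu> :: 'h measure).
        compact_space H \<and> Hausdorff_space H \<and>
        bounded_linear_functional (topspace H) (C_space H) T \<and> represents_on_C H m T \<and>
        finite_measure \<mu> \<and> space \<mu> = topspace H \<and> sets \<mu> = borel_sets_of H \<and>
        continuous_wrt m \<mu> \<longrightarrow>
        cond_exps_converge \<mu> (C_space H) m T) \<longleftrightarrow>
    all_charges_approximable TYPE('h) TYPE('x \<Rightarrow>\<^sub>L real)" (is "?conv \<longleftrightarrow> ?approx")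
proof
  assume ?approx
  show ?conv
  proof (intro allI impI, elim conjE)
    fix H :: "'h topology" and T :: "('h \<Rightarrow> 'x) \<Rightarrow> real" and m :: "'h set \<Rightarrow> ('x \<Rightarrow>\<^sub>L real)" and \<mu> :: "'h measure"
    assume *: "represents_on_C H m T" "finite_measure \<mu>" "space \<mu> = topspace H" "sets \<mu> = borel_sets_of H"
        "continuous_wrt m \<mu>"
    have "density_approximable \<mu> m"
      using \<open>?approx\<close> represents_on_C_charge[OF *] by (simp add: all_charges_approximable_def)
    then show "cond_exps_converge \<mu> (C_space H) m T"
      using * by (intro approximable_cond_exps_converge) (auto simp: represents_on_C_def C_space_def)
  qed
next
  assume conv: ?conv
  show ?approx
    unfolding all_charges_approximable_def
  proof (intro allI impI, rule ccontr)
    fix \<mu> :: "'h measure" and G :: "'h set \<Rightarrow> ('x \<Rightarrow>\<^sub>L real)"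
    assume G: "charge_wrt \<mu> G" "\<not> density_approximable \<mu> G"
    obtain H :: "'h topology" and \<nu> :: "'h measure" and m :: "'h set \<Rightarrow> ('x \<Rightarrow>\<^sub>L real)" and \<tau> and \<epsilon> :: real
      where H: "compact_space H" "Hausdorff_space H" "space \<nu> = topspace H" "sets \<nu> = borel_sets_of H"
      and m: "charge_wrt \<nu> m"
      and reg: "\<forall>A\<in>borel_sets_of H. \<forall>\<delta>>0.
        \<exists>K U. closedin H K \<and> openin H U \<and> K \<subseteq> A \<and> A \<subseteq> U \<and> measure \<nu> (U - K) < \<delta>"
      and \<tau>: "\<forall>n. \<tau> n \<in> finite_partitions (space \<nu>) (sets \<nu>)" "\<forall>n. \<forall>A\<in>\<tau> n. openin H A"
      and \<epsilon>: "\<epsilon> > 0"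
      and far: "\<forall>\<pi>\<in>finite_partitions (space \<nu>) (sets \<nu>).
         \<exists>n::nat. \<epsilon> < (\<Sum>C\<in>\<tau> n. norm (m C - cond_charge \<nu> \<pi> m C))"
      by (rule non_approximable_compact_model[OF inj G])
    note g = charge_wrtD[OF m]
    let ?T = "vm_functional \<nu> m"
    have CU: "C_space H \<subseteq> U_space (space \<nu>) (sets \<nu>)"
      using C_space_subset_U_space[OF H(1)] H(3,4) by simp
    then have vm: "f \<in> C_space H \<Longrightarrow> has_vm_integral (space \<nu>) (sets \<nu>) m f (?T f)" for f
      using has_vm_integral_vm_functional[OF m] by blast
    have "represents_on_C H m ?T"
      using g(2,3) vm weakly_regular_charge[OF m H(4) reg[rule_format]] H(3,4)
      by (simp add: represents_on_C_def finite_semivariation_iff_bounded_variation)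
    then have conv': "cond_exps_converge \<nu> (C_space H) m ?T"
      using conv H g(1,4) vm_functional_bounded_linear[OF m CU] by simp
    have "\<exists>\<pi>\<in>finite_partitions (space \<nu>) (sets \<nu>). \<forall>\<tau>\<in>finite_partitions (space \<nu>) (sets \<nu>).
        (\<forall>x :: 'h set \<Rightarrow> 'x. (\<lambda>\<omega>. x (block \<tau> \<omega>)) \<in> C_space H) \<longrightarrow> (\<Sum>B\<in>\<tau>. norm (m B - cond_charge \<nu> \<pi> m B)) \<le> \<epsilon>"
      by (rule cond_exps_converge_approximates[OF m vm conv' \<epsilon>])
    then obtain \<pi> where \<pi>: "\<pi> \<in> finite_partitions (space \<nu>) (sets \<nu>)"
      and close: "\<forall>\<tau>\<in>finite_partitions (space \<nu>) (sets \<nu>). (\<forall>x :: 'h set \<Rightarrow> 'x. (\<lambda>\<omega>. x (block \<tau> \<omega>)) \<in> C_space H) \<longrightarrow>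
        (\<Sum>B\<in>\<tau>. norm (m B - cond_charge \<nu> \<pi> m B)) \<le> \<epsilon>" by blast
    obtain n where "\<epsilon> < (\<Sum>C\<in>\<tau> n. norm (m C - cond_charge \<nu> \<pi> m C))" using far \<pi> by blast
    moreover have "(\<lambda>\<omega>. x (block (\<tau> n) \<omega>)) \<in> C_space H" for x :: "'h set \<Rightarrow> 'x"
      by (rule continuous_block_function) (use \<tau> H(3) in auto)
    ultimately show False using close \<tau>(1) by (meson not_less)
  qed
qed

text \<open>All step functions lie in \<open>U_space\<close>, so here convergence can be tested on the given measure space
itself.\<close>

lemma convergence_on_U_iff_approximable:
  "(\<forall>(\<Omega> :: 's set) (\<Sigma> :: 's set set) (T :: ('s \<Rightarrow> 'x::banach) \<Rightarrow> real)
          (m :: 's set \<Rightarrow> ('x \<Rightarrow>\<^sub>L real)) (\<mu> :: 's measure).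
        sigma_algebra \<Omega> \<Sigma> \<and>
        bounded_linear_functional \<Omega> (U_space \<Omega> \<Sigma>) T \<and> represents_on_U \<Omega> \<Sigma> m T \<and>
        finite_measure \<mu> \<and> space \<mu> = \<Omega> \<and> sets \<mu> = \<Sigma> \<and>
        continuous_wrt m \<mu> \<longrightarrow>
        cond_exps_converge \<mu> (U_space \<Omega> \<Sigma>) m T) \<longleftrightarrow>
    all_charges_approximable TYPE('s) TYPE('x \<Rightarrow>\<^sub>L real)" (is "?conv \<longleftrightarrow> ?approx")
proof
  assume ?approx
  show ?conv
  proof (intro allI impI, elim conjE)
    fix \<Omega> :: "'s set" and \<Sigma> and T :: "('s \<Rightarrow> 'x) \<Rightarrow> real" and m :: "'s set \<Rightarrow> ('x \<Rightarrow>\<^sub>L real)" and \<mu> :: "'s measure"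
    assume *: "represents_on_U \<Omega> \<Sigma> m T" "finite_measure \<mu>" "space \<mu> = \<Omega>" "sets \<mu> = \<Sigma>" "continuous_wrt m \<mu>"
    then have "charge_wrt \<mu> m" using represents_on_U_charge[of \<mu> m T] by simp
    then have "density_approximable \<mu> m"
      using \<open>?approx\<close> by (simp add: all_charges_approximable_def)
    moreover have "(\<lambda>_. 0) \<in> U_space \<Omega> \<Sigma>"
      by (auto simp: U_space_def simple_on_def intro!: exI[of _ "\<lambda>_ _. 0"] uniform_limitI)
    ultimately show "cond_exps_converge \<mu> (U_space \<Omega> \<Sigma>) m T"
      using * by (intro approximable_cond_exps_converge) (auto simp: represents_on_U_def)
  qed
next
  assume conv: ?conv
  show ?approx
    unfolding all_charges_approximable_def density_approximable_def
  proof (intro allI impI)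
    fix \<mu> :: "'s measure" and m :: "'s set \<Rightarrow> ('x \<Rightarrow>\<^sub>L real)" and \<epsilon> :: real
    assume m: "charge_wrt \<mu> m" and \<epsilon>: "\<epsilon> > 0"
    note g = charge_wrtD[OF m]
    let ?U = "U_space (space \<mu>) (sets \<mu>) :: ('s \<Rightarrow> 'x) set"
    let ?T = "vm_functional \<mu> m"
    note vm = has_vm_integral_vm_functional[OF m]
    have "represents_on_U (space \<mu>) (sets \<mu>) m ?T"
      using g(2,3) vm by (simp add: represents_on_U_def finite_semivariation_iff_bounded_variation)
    then have conv': "cond_exps_converge \<mu> ?U m ?T"
      using conv g(1,4) vm_functional_bounded_linear[OF m order_refl] sets.sigma_algebra_axioms by blast
    have "(\<lambda>\<omega>. x (block \<tau> \<omega>)) \<in> ?U" if "\<tau> \<in> finite_partitions (space \<mu>) (sets \<mu>)" for \<tau> and x :: "'s set \<Rightarrow> 'x"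
      using has_vm_integral_U_space[OF has_vm_integral_simple[OF simple_function_compose1[OF simple_function_block[OF that]]]] .
    moreover note cond_exps_converge_approximates[where F = ?U and T = ?T, OF m vm conv' \<epsilon>]
    ultimately show "\<exists>\<pi>\<in>finite_partitions (space \<mu>) (sets \<mu>). \<forall>\<tau>\<in>finite_partitions (space \<mu>) (sets \<mu>).
        (\<Sum>B\<in>\<tau>. norm (m B - cond_charge \<mu> \<pi> m B)) \<le> \<epsilon>"
      by blast
  qed
qed

theorem theorem4:
  assumes "\<exists>i :: real \<Rightarrow> 'w. inj i"
    and "\<exists>i :: real \<Rightarrow> 'h. inj i"
    and "\<exists>i :: real \<Rightarrow> 's. inj i"
  shows "(radon_nikodym_property TYPE('w) TYPE('x::banach \<Rightarrow>\<^sub>L real) \<longleftrightarrow>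
      (\<forall>(H :: 'h topology) (T :: ('h \<Rightarrow> 'x) \<Rightarrow> real) (m :: 'h set \<Rightarrow> ('x \<Rightarrow>\<^sub>L real))
          (\<mu> :: 'h measure).
        compact_space H \<and> Hausdorff_space H \<and>
        bounded_linear_functional (topspace H) (C_space H) T \<and> represents_on_C H m T \<and>
        finite_measure \<mu> \<and> space \<mu> = topspace H \<and> sets \<mu> = borel_sets_of H \<and>
        continuous_wrt m \<mu> \<longrightarrow>
        cond_exps_converge \<mu> (C_space H) m T))
    \<and>
    (radon_nikodym_property TYPE('w) TYPE('x \<Rightarrow>\<^sub>L real) \<longleftrightarrow>
      (\<forall>(\<Omega> :: 's set) (\<Sigma> :: 's set set) (T :: ('s \<Rightarrow> 'x) \<Rightarrow> real)
          (m :: 's set \<Rightarrow> ('x \<Rightarrow>\<^sub>L real)) (\<mu> :: 's measure).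
        sigma_algebra \<Omega> \<Sigma> \<and>
        bounded_linear_functional \<Omega> (U_space \<Omega> \<Sigma>) T \<and> represents_on_U \<Omega> \<Sigma> m T \<and>
        finite_measure \<mu> \<and> space \<mu> = \<Omega> \<and> sets \<mu> = \<Sigma> \<and>
        continuous_wrt m \<mu> \<longrightarrow>
        cond_exps_converge \<mu> (U_space \<Omega> \<Sigma>) m T))"
proof -
  have rnp: "radon_nikodym_property TYPE('w) TYPE('x \<Rightarrow>\<^sub>L real) \<longleftrightarrow>
      all_charges_approximable TYPE('w) TYPE('x \<Rightarrow>\<^sub>L real)"
    unfolding all_charges_approximable_def by (rule radon_nikodym_property_iff_approximable)
  have "all_charges_approximable TYPE('w) TYPE('x \<Rightarrow>\<^sub>L real) \<longleftrightarrow>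
      all_charges_approximable TYPE('h) TYPE('x \<Rightarrow>\<^sub>L real)"
    using all_charges_approximable_transfer[OF assms(1)] all_charges_approximable_transfer[OF assms(2)] by blast
  moreover have "all_charges_approximable TYPE('w) TYPE('x \<Rightarrow>\<^sub>L real) \<longleftrightarrow>
      all_charges_approximable TYPE('s) TYPE('x \<Rightarrow>\<^sub>L real)"
    using all_charges_approximable_transfer[OF assms(1)] all_charges_approximable_transfer[OF assms(3)] by blast
  ultimately show ?thesis
    unfolding rnp convergence_on_C_iff_approximable[OF assms(2)] convergence_on_U_iff_approximable by blast
qed

end
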